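(* Fix an element $K$ of a simplicial mesh and assume $\alpha_1>\frac12\|\mathbf w\|_{L^\infty}$, $\alpha_2>0$, $\alpha_3>0$. Given $\hat{\mathbf u}_h\in[\mathcal P_k(e)]^d$, $\hat{\mathbf b}^t_h$ tangential in $[\mathcal P_k(e)]^d$, $\hat r_h\in\mathcal P_k(e)$ on each face $e\subset\partial K$, sources $\mathbf g,\mathbf f\in[L^2(K)]^d$ and a constant $\rho_h\in\mathbb R$, there exists a unique $(\mathbf L_h,\mathbf u_h,p_h,\mathbf H_h,\mathbf b_h,r_h)\in[\mathcal P_k(K)]^{d\times d}\times[\mathcal P_k(K)]^d\times\mathcal P_k(K)\times[\mathcal P_k(K)]^{\tilde d}\times[\mathcal P_k(K)]^d\times\mathcal P_k(K)$ satisfying, for all test functions $(\mathbf G,\mathbf v,q,\mathbf J,\mathbf c,s)$ in the same spaces: $\mathrm{Re}(\mathbf L_h,\mathbf G)_K+(\mathbf u_h,\nabla\cdot\mathbf G)_K-\langle\hat{\mathbf u}_h\otimes\mathbf n,\mathbf G\rangle_{\partial K}=0$; $(\mathbf L_h,\nabla\mathbf v)_K-(p_h,\nabla\cdot\mathbf v)_K-(\mathbf u_h\otimes\mathbf w,\nabla\mathbf v)_K+\kappa(\mathbf b_h,\nabla\times(\mathbf v\times\mathbf d))_K+\langle-\mathbf L_h\mathbf n+m\mathbf u_h+p_h\mathbf n+\frac12\kappa\mathbf d\times(\mathbf n\times(\mathbf b_h^t+\hat{\mathbf b}^t_h))+\alpha_1(\mathbf u_h-\hat{\mathbf u}_h),\mathbf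 v\rangle_{\partial K}=(\mathbf g,\mathbf v)_K$; $-(\mathbf u_h,\nabla q)_K+\langle\hat{\mathbf u}_h\cdot\mathbf n,q\rangle_{\partial K}+(p_h,\bar q)_K=|K|^{-1}(\rho_h,\bar q)_K$, where $\bar q=|K|^{-1}(q,1)_K$; $\frac{\mathrm{Rm}}{\kappa}(\mathbf H_h,\mathbf J)_K-(\mathbf b_h,\nabla\times\mathbf J)_K-\langle\mathbf n\times\hat{\mathbf b}^t_h,\mathbf J\rangle_{\partial K}=0$; $(\mathbf H_h,\nabla\times\mathbf c)_K-(r_h,\nabla\cdot\mathbf c)_K-\kappa(\mathbf u_h,\mathbf d\times(\nabla\times\mathbf c))_K+\langle\mathbf n\times\mathbf H_h+\hat r_h\mathbf n-\frac12\kappa\mathbf n\times((\mathbf u_h+\hat{\mathbf u}_h)\times\mathbf d)+\alpha_2(\mathbf b_h^t-\hat{\mathbf b}^t_h),\mathbf c\rangle_{\partial K}=(\mathbf f,\mathbf c)_K$; $-(\mathbf b_h,\nabla s)_K+\langle\mathbf b_h\cdot\mathbf n+\alpha_3(r_h-\hat r_h),s\rangle_{\partial K}=0$.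
   Context: $K\subset\mathbb R^d$, $d\in\{2,3\}$, is a $d$-simplex with volume $|K|$ and unit outward normal $\mathbf n$; $(\cdot,\cdot)_K$, $\langle\cdot,\cdot\rangle_{\partial K}$ are $L^2$ inner products (componentwise/Frobenius for vectors and matrices); $\mathcal P_k$ denotes polynomials of degree at most $k\ge0$. For a vector $\mathbf a$, $\mathbf a^t:=-\mathbf n\times(\mathbf n\times\mathbf a)$; $(\nabla\mathbf u)_{ij}=\partial u_i/\partial x_j$, $(\nabla\cdot\mathbf G)_i=\sum_j\partial G_{ij}/\partial x_j$, $(\mathbf a\otimes\mathbf b)_{ij}=a_ib_j$. $\tilde d=3$ if $d=3$ and $\tilde d=1$ if $d=2$; for $d=2$ curls and cross products are understood in the standard two-dimensional sense. Parameters: constants $\mathrm{Re},\mathrm{Rm},\kappa>0$; $\mathbf d\in[W^{1,\infty}(K)]^d$; $\mathbf w\in[W^{1,\infty}(K)]^d$ with $\nabla\cdot\mathbf w=0$; $m:=\mathbf w\cdot\mathbf n$; constants $\alpha_1,\alpha_2,\alpha_3$. *)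

theory Defs
  imports "HOL-Analysis.Analysis"
begin

definition poly_space :: "nat \<Rightarrow> ((real^'n) \<Rightarrow> real) set" where
  "poly_space k = {f. \<exists>c :: ('n \<Rightarrow> nat) \<Rightarrow> real.
      f = (\<lambda>x. \<Sum>\<alpha>\<in>{\<alpha>. sum \<alpha> UNIV \<le> k}. c \<alpha> * (\<Prod>i\<in>UNIV. (x $ i) ^ (\<alpha> i)))}"

definition vpoly_space :: "nat \<Rightarrow> ((real^'n) \<Rightarrow> 'a::euclidean_space) set" where
  "vpoly_space k = {f. \<forall>b\<in>Basis. (\<lambda>x. f x \<bullet> b) \<in> poly_space k}"

definition pd :: "'n \<Rightarrow> ((real^'n) \<Rightarrow> 'a::real_normed_vector) \<Rightarrow> real^'n \<Rightarrow> 'a" where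
  "pd j f x = vector_derivative (\<lambda>t. f (x + t *\<^sub>R axis j 1)) (at 0)"

definition gradV :: "((real^'n) \<Rightarrow> real^'n) \<Rightarrow> real^'n \<Rightarrow> real^'n^'n" where
  "gradV v x = (\<chi> i j. pd j (\<lambda>y. v y $ i) x)"

definition gradS :: "((real^'n) \<Rightarrow> real) \<Rightarrow> real^'n \<Rightarrow> real^'n" where
  "gradS q x = (\<chi> j. pd j q x)"

definition divV :: "((real^'n) \<Rightarrow> real^'n) \<Rightarrow> real^'n \<Rightarrow> real" where
  "divV v x = (\<Sum>j\<in>UNIV. pd j (\<lambda>y. v y $ j) x)"

definition divM :: "((real^'n) \<Rightarrow> real^'n^'n) \<Rightarrow> real^'n \<Rightarrow> real^'n" where
  "divM G x = (\<chi> i. \<Sum>j\<in>UNIV. pd j (\<lambda>y. G y $ i $ j) x)"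

definition outerp :: "real^'n \<Rightarrow> real^'n \<Rightarrow> real^'n^'n" where
  "outerp a b = (\<chi> i j. a $ i * b $ j)"

definition curl3 :: "((real^3) \<Rightarrow> real^3) \<Rightarrow> real^3 \<Rightarrow> real^3" where
  "curl3 v x = vector [pd 2 (\<lambda>y. v y $ 3) x - pd 3 (\<lambda>y. v y $ 2) x,
                       pd 3 (\<lambda>y. v y $ 1) x - pd 1 (\<lambda>y. v y $ 3) x,
                       pd 1 (\<lambda>y. v y $ 2) x - pd 2 (\<lambda>y. v y $ 1) x]"

definition cross2VV :: "real^2 \<Rightarrow> real^2 \<Rightarrow> real" where
  "cross2VV a b = a $ 1 * b $ 2 - a $ 2 * b $ 1"

text \<open>vector x scalar = vector (a x (phi e_3) restricted to the plane)\<close>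
definition cross2VS :: "real^2 \<Rightarrow> real \<Rightarrow> real^2" where
  "cross2VS a \<phi> = vector [a $ 2 * \<phi>, - (a $ 1 * \<phi>)]"

definition curl2V :: "((real^2) \<Rightarrow> real^2) \<Rightarrow> real^2 \<Rightarrow> real" where
  "curl2V v x = pd 1 (\<lambda>y. v y $ 2) x - pd 2 (\<lambda>y. v y $ 1) x"

definition curl2S :: "((real^2) \<Rightarrow> real) \<Rightarrow> real^2 \<Rightarrow> real^2" where
  "curl2S \<phi> x = vector [pd 2 \<phi> x, - pd 1 \<phi> x]"

definition simplex_vertices :: "(nat \<Rightarrow> real^'n) \<Rightarrow> bool" where
  "simplex_vertices p \<longleftrightarrow> inj_on p {0..CARD('n)} \<and> \<not> affine_dependent (p ` {0..CARD('n)})"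

definition simplex_of :: "(nat \<Rightarrow> real^'n) \<Rightarrow> (real^'n) set" where
  "simplex_of p = convex hull (p ` {0..CARD('n)})"

text \<open>The j-th vertex (j < d) of the face opposite to vertex i.\<close>
definition oth :: "nat \<Rightarrow> nat \<Rightarrow> nat" where
  "oth i j = (if j < i then j else j + 1)"

definition face :: "(nat \<Rightarrow> real^'n) \<Rightarrow> nat \<Rightarrow> (real^'n) set" where
  "face p i = convex hull (p ` ({0..CARD('n)} - {i}))"

definition onormal :: "(nat \<Rightarrow> real^'n) \<Rightarrow> nat \<Rightarrow> real^'n" where
  "onormal p i = (THE n. norm n = 1 \<and>
      (\<forall>j\<in>{0..CARD('n)} - {i}. \<forall>j'\<in>{0..CARD('n)} - {i}. (p j - p j') \<bullet> n = 0) \<and>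
      (\<forall>j\<in>{0..CARD('n)} - {i}. (p i - p j) \<bullet> n < 0))"

definition face_int2 :: "(nat \<Rightarrow> real^2) \<Rightarrow> nat \<Rightarrow> (real^2 \<Rightarrow> real) \<Rightarrow> real" where
  "face_int2 p i \<phi> = dist (p (oth i 0)) (p (oth i 1)) *
     (LINT t:{0..1}|lborel. \<phi> (p (oth i 0) + t *\<^sub>R (p (oth i 1) - p (oth i 0))))"

definition face_int3 :: "(nat \<Rightarrow> real^3) \<Rightarrow> nat \<Rightarrow> (real^3 \<Rightarrow> real) \<Rightarrow> real" where
  "face_int3 p i \<phi> = norm (cross3 (p (oth i 1) - p (oth i 0)) (p (oth i 2) - p (oth i 0))) *
     (LINT st:{st :: real \<times> real. 0 \<le> fst st \<and> 0 \<le> snd st \<and> fst st + snd st \<le> 1}|lborel.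
        \<phi> (p (oth i 0) + fst st *\<^sub>R (p (oth i 1) - p (oth i 0)) + snd st *\<^sub>R (p (oth i 2) - p (oth i 0))))"

definition L2_on :: "(real^'n) set \<Rightarrow> ((real^'n) \<Rightarrow> real^'n) \<Rightarrow> bool" where
  "L2_on K g \<longleftrightarrow> set_borel_measurable lebesgue K g \<and> set_integrable lebesgue K (\<lambda>x. (norm (g x))^2)"

text \<open>W^{1,infinity}(K) on a simplex: Lipschitz functions on K.\<close>
definition W1inf_on :: "(real^'n) set \<Rightarrow> ((real^'n) \<Rightarrow> real^'n) \<Rightarrow> bool" where
  "W1inf_on K g \<longleftrightarrow> (\<exists>C. C-lipschitz_on K g)"

definition vint :: "(real^'n) set \<Rightarrow> ((real^'n) \<Rightarrow> real) \<Rightarrow> real" where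
  "vint K \<phi> = (LINT x:K|lebesgue. \<phi> x)"

definition tang :: "('v \<Rightarrow> 'h \<Rightarrow> 'v) \<Rightarrow> ('v \<Rightarrow> 'v \<Rightarrow> 'h) \<Rightarrow> 'v \<Rightarrow> 'v \<Rightarrow> 'v::real_vector" where
  "tang cVH cVV n a = - cVH n (cVV n a)"

text \<open>
  Parameters: cVV (vector x vector), cVH (vector x curl-space), curlV (curl of a vector field),
  curlH (curl of a curl-space-valued field); K the simplex; F the face index set,
  bint e phi the surface integral over face e, nr e the outward unit normal on face e.
  Face data uh, bh, rh are given per face.  The boundary pairing is the sum of face integrals.
\<close>
definition hdg_local_system ::
  "(real^'n \<Rightarrow> real^'n \<Rightarrow> 'h::euclidean_space) \<Rightarrow> (real^'n \<Rightarrow> 'h \<Rightarrow> real^'n) \<Rightarrow>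
   ((real^'n \<Rightarrow> real^'n) \<Rightarrow> real^'n \<Rightarrow> 'h) \<Rightarrow> ((real^'n \<Rightarrow> 'h) \<Rightarrow> real^'n \<Rightarrow> real^'n) \<Rightarrow>
   nat \<Rightarrow> (real^'n) set \<Rightarrow> 'f set \<Rightarrow> ('f \<Rightarrow> (real^'n \<Rightarrow> real) \<Rightarrow> real) \<Rightarrow> ('f \<Rightarrow> real^'n) \<Rightarrow>
   real \<Rightarrow> real \<Rightarrow> real \<Rightarrow> (real^'n \<Rightarrow> real^'n) \<Rightarrow> (real^'n \<Rightarrow> real^'n) \<Rightarrow>
   real \<Rightarrow> real \<Rightarrow> real \<Rightarrow>
   ('f \<Rightarrow> real^'n \<Rightarrow> real^'n) \<Rightarrow> ('f \<Rightarrow> real^'n \<Rightarrow> real^'n) \<Rightarrow> ('f \<Rightarrow> real^'n \<Rightarrow> real) \<Rightarrow>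
   (real^'n \<Rightarrow> real^'n) \<Rightarrow> (real^'n \<Rightarrow> real^'n) \<Rightarrow> real \<Rightarrow>
   (real^'n \<Rightarrow> real^'n^'n) \<Rightarrow> (real^'n \<Rightarrow> real^'n) \<Rightarrow> (real^'n \<Rightarrow> real) \<Rightarrow>
   (real^'n \<Rightarrow> 'h) \<Rightarrow> (real^'n \<Rightarrow> real^'n) \<Rightarrow> (real^'n \<Rightarrow> real) \<Rightarrow> bool" where
  "hdg_local_system cVV cVH curlV curlH k K F bint nr Rey Rm \<kappa> dd w \<alpha>1 \<alpha>2 \<alpha>3
     uh bh rh g f \<rho> L u p H b r \<longleftrightarrow>
   (let bnd = (\<lambda>\<Phi>. \<Sum>e\<in>F. bint e (\<Phi> e));
        m = (\<lambda>e x. w x \<bullet> nr e);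
        tn = (\<lambda>e a. tang cVH cVV (nr e) a);
        vol = measure lebesgue K in
   (\<forall>G \<in> vpoly_space k.
      Rey * vint K (\<lambda>x. L x \<bullet> G x) + vint K (\<lambda>x. u x \<bullet> divM G x)
      - bnd (\<lambda>e x. outerp (uh e x) (nr e) \<bullet> G x) = 0) \<and>
   (\<forall>v \<in> vpoly_space k.
      vint K (\<lambda>x. L x \<bullet> gradV v x) - vint K (\<lambda>x. p x * divV v x)
      - vint K (\<lambda>x. outerp (u x) (w x) \<bullet> gradV v x)
      + \<kappa> * vint K (\<lambda>x. b x \<bullet> curlH (\<lambda>y. cVV (v y) (dd y)) x)
      + bnd (\<lambda>e x. (- (L x *v nr e) + m e x *\<^sub>R u x + p x *\<^sub>R nr e
            + (1/2 * \<kappa>) *\<^sub>R cVH (dd x) (cVV (nr e) (tn e (b x) + bh e x))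
            + \<alpha>1 *\<^sub>R (u x - uh e x)) \<bullet> v x)
      = vint K (\<lambda>x. g x \<bullet> v x)) \<and>
   (\<forall>q \<in> vpoly_space k.
      let qbar = vint K q / vol in
      - vint K (\<lambda>x. u x \<bullet> gradS q x) + bnd (\<lambda>e x. (uh e x \<bullet> nr e) * q x)
      + vint K (\<lambda>x. p x * qbar)
      = (1 / vol) * vint K (\<lambda>x. \<rho> * qbar)) \<and>
   (\<forall>J \<in> vpoly_space k.
      (Rm / \<kappa>) * vint K (\<lambda>x. H x \<bullet> J x) - vint K (\<lambda>x. b x \<bullet> curlH J x)
      - bnd (\<lambda>e x. cVV (nr e) (bh e x) \<bullet> J x) = 0) \<and>
   (\<forall>c \<in> vpoly_space k.
      vint K (\<lambda>x. H x \<bullet> curlV c x) - vint K (\<lambda>x. r x * divV c x)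
      - \<kappa> * vint K (\<lambda>x. u x \<bullet> cVH (dd x) (curlV c x))
      + bnd (\<lambda>e x. (cVH (nr e) (H x) + rh e x *\<^sub>R nr e
            - (1/2 * \<kappa>) *\<^sub>R cVH (nr e) (cVV (u x + uh e x) (dd x))
            + \<alpha>2 *\<^sub>R (tn e (b x) - bh e x)) \<bullet> c x)
      = vint K (\<lambda>x. f x \<bullet> c x)) \<and>
   (\<forall>s \<in> vpoly_space k.
      - vint K (\<lambda>x. b x \<bullet> gradS s x)
      + bnd (\<lambda>e x. (b x \<bullet> nr e + \<alpha>3 * (r x - rh e x)) * s x) = 0))"

abbreviation hdg_system2 where
  "hdg_system2 k P \<equiv> hdg_local_system cross2VV cross2VS curl2V curl2S k (simplex_of P) {0..2}
      (face_int2 P) (onormal P)"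

abbreviation hdg_system3 where
  "hdg_system3 k P \<equiv> hdg_local_system cross3 cross3 curl3 curl3 k (simplex_of P) {0..3}
      (face_int3 P) (onormal P)"

end

theory Submission
  imports Defs
begin

text \<open>
  The system is square and linear, so it suffices to show that the homogeneous problem has only the zero
  solution. Testing it with its own solution, all couplings cancel by integration by parts and, since
  \<open>w\<close> is divergence free, what remains is
  \<open>Re |L|^2 + (Rm/\<kappa>) |H|^2 + \<langle>\<alpha>1 + m/2, |u|^2\<rangle> + \<alpha>2 |b^t|^2 + \<alpha>3 |r|^2 + (p,1)^2/|K| = 0\<close>,
  a sum of nonnegative terms because \<open>|w| < 2 \<alpha>1\<close>. Hence \<open>L = 0\<close>, \<open>H = 0\<close>, the mean of \<open>p\<close> is zero, and
  \<open>u\<close>, \<open>b^t\<close>, \<open>r\<close> vanish on the boundary. Then \<open>u\<close>, \<open>p\<close> and \<open>r\<close> have zero gradient and vanish, while \<open>b\<close> is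
  curl free and divergence free with zero tangential trace. A Rellich identity for such fields on a
  domain that is star-shaped about an interior point kills the normal trace of \<open>b\<close> as well,
  and then \<open>b = 0\<close>.

  As \<open>w\<close> and \<open>d\<close> are merely Lipschitz, the divergence theorem is needed for Lipschitz functions. These
  are partially differentiable almost everywhere (Vitali covering on lines), the functional
  \<open>F \<mapsto> (\<partial>F/\<partial>x\<^sub>j, 1)\<^sub>K\<close> is bounded in the supremum norm because \<open>K\<close> is convex, and on
  polynomials, which are dense, the theorem follows by integrating along the edge directions of the simplex.
\<close>

section \<open>Partial derivatives of Lipschitz functions\<close>

text \<open>Only test functions of degree at most \<open>k\<close> are available, so the argument
  works with derivatives of the solution itself: \<open>poly_space k\<close> is closed under
  \<open>pd\<close>, which makes grad u, curl b, grad p, grad r and div b admissible. The factor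
  curl(v x d) leaves the polynomials and exists only almost everywhere; it has to be moved onto b by
  parts, which is where Lipschitz regularity meets the divergence theorem. The weight \<kappa>/2 on
  both magnetic boundary terms is dictated by this step: moving the curl from u x d to b produces
  -\<kappa> <u x d, n x b>, and the two boundary terms return one half each. Convection likewise
  leaves half of m, whence the threshold for \<alpha>1. The energy is silent about the normal trace
  of b, since only the tangential trace is stabilised. The Rellich identity supplies it without a
  scalar potential; star-shapedness makes its boundary weight positive. Plane and space share one
  argument, with cross products and curls abstracted to a few algebraic identities.\<close>

lemma increment_ge_of_frequently_slope_gt:
  fixes f :: "real \<Rightarrow> real"
  assumes f: "mono f" "continuous_on UNIV f" and q: "0 \<le> q" and cd: "c \<le> d" and E: "E \<in> sets borel"
    and slope: "\<And>x \<delta>. x \<in> E \<Longrightarrow> 0 < \<delta> \<Longrightarrow> \<exists>h. h \<noteq> 0 \<and> \<bar>h\<bar> < \<delta> \<and> q < (f (x + h) - f x) / h"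
  shows "q * measure lborel (E \<inter> {c<..<d}) \<le> f d - f c"
proof -
  \<comment> \<open>The Stieltjes measure of \<open>f\<close> turns a sum of increments over
    disjoint intervals into countable additivity, so together they cannot exceed
    \<open>f d - f c\<close>.\<close>
  let ?I = "{c<..<d}" and ?\<mu> = "interval_measure f"
  have mono: "\<And>x y. x \<le> y \<Longrightarrow> f x \<le> f y" using f(1) by (rule monoD)
  have Icc: "emeasure ?\<mu> {a..b} = ennreal (f b - f a)" if "a \<le> b" for a b
    using emeasure_interval_measure_Icc[of a b f] that mono f(2) by auto
  \<comment> \<open>Candidate intervals are stored as centre and radius to suit the Vitali theorem
    for closed balls: the segment between \<open>x\<close> and \<open>x + h\<close> has centre
    \<open>x + h/2\<close> and radius \<open>|h|/2\<close>, and its increment is at least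
    \<open>q\<close> times its length.\<close>
  define K where "K = {(a, r). 0 < r \<and> c < a - r \<and> a + r < d \<and> q * (2 * r) \<le> f (a + r) - f (a - r)}"
  have ex: "\<exists>i. i \<in> K \<and> x \<in> cball (fst i) (snd i) \<and> snd i < e" if xE: "x \<in> E \<inter> ?I" and e0: "0 < e" for x e
  proof -
    define \<delta> where "\<delta> = Min {e, x - c, d - x}"
    have \<delta>: "0 < \<delta>" "\<delta> \<le> e" "\<delta> \<le> x - c" "\<delta> \<le> d - x"
      using xE e0 unfolding \<delta>_def by auto
    obtain h where h: "h \<noteq> 0" "\<bar>h\<bar> < \<delta>" "q < (f (x + h) - f x) / h"
      using slope[of x \<delta>] xE \<delta>(1) by blast
    show ?thesis
    proof (cases "h > 0")
      case True
      then have "q * h \<le> f (x + h) - f x" using h by (simp add: field_simps)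
      moreover have "x + h/2 + h/2 = x + h" "x + h/2 - h/2 = x" "2 * (h/2) = h" by simp_all
      ultimately have "(x + h/2, h/2) \<in> K"
        using True h(2) \<delta> xE unfolding K_def mem_Collect_eq prod.case by (simp only:) simp
      then show ?thesis
        using True h \<delta> by (intro exI[of _ "(x + h/2, h/2)"]) (auto simp: dist_real_def)
    next
      case False
      then have "h < 0" using h by simp
      then have "q * (-h) \<le> f x - f (x + h)" using h by (simp add: field_simps)
      moreover have "x + h/2 + -h/2 = x" "x + h/2 - -h/2 = x + h" "2 * (-h/2) = - h" by simp_all
      ultimately have "(x + h/2, -h/2) \<in> K"
        using \<open>h < 0\<close> h(2) \<delta> xE unfolding K_def mem_Collect_eq prod.case by (simp only:) simp
      then show ?thesis
        using \<open>h < 0\<close> h \<delta> by (intro exI[of _ "(x + h/2, -h/2)"]) (auto simp: dist_real_def)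
    qed
  qed
  \<comment> \<open>Every point of \<open>E\<close> in the open interval lies in candidate balls of
    arbitrarily small radius, so countably many disjoint ones cover it up to a null set.\<close>
  obtain C where C: "countable C" "C \<subseteq> K"
     "pairwise (\<lambda>i j. disjnt (cball (fst i) (snd i)) (cball (fst j) (snd j))) C"
     "negligible (E \<inter> ?I - (\<Union>i\<in>C. cball (fst i) (snd i)))"
  proof (rule Vitali_covering_theorem_cballs[of K snd "E \<inter> ?I" fst])
    show "0 < snd i" if "i \<in> K" for i using that by (simp add: K_def case_prod_unfold)
    show "\<exists>i. i \<in> K \<and> x \<in> cball (fst i) (snd i) \<and> snd i < e" if "x \<in> E \<inter> ?I" "0 < e" for x e
      using ex[OF that] .
  qed blast
  let ?B = "\<lambda>i. cball (fst i) (snd i)"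
  let ?U = "\<Union>i\<in>C. ?B i"
  have disj: "disjoint_family_on ?B C"
    using C(3) by (auto simp: disjoint_family_on_def pairwise_def disjnt_def)
  have null: "E \<inter> ?I - ?U \<in> null_sets lborel"
  proof -
    have "E \<inter> ?I - ?U \<in> sets borel" using E C(1)
      by (intro sets.Diff sets.Int sets.countable_UN') auto
    then show ?thesis using C(4) unfolding negligible_iff_null_sets by (simp add: null_sets_completion_iff)
  qed
  have Umeas: "?U \<in> sets borel" using C(1) by (intro sets.countable_UN') auto
  have "ennreal q * emeasure lborel (E \<inter> ?I) \<le> ennreal q * emeasure lborel (?U \<union> (E \<inter> ?I - ?U))"
    using E Umeas by (intro mult_left_mono emeasure_mono) auto
  also have "\<dots> = ennreal q * emeasure lborel ?U"
    using emeasure_Un_null_set[of ?U lborel, OF _ null] Umeas by simp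
  also have "emeasure lborel ?U = (\<integral>\<^sup>+i. emeasure lborel (?B i) \<partial>count_space C)"
    using C(1) disj by (intro emeasure_UN_countable) auto
  also have "ennreal q * \<dots> = (\<integral>\<^sup>+i. ennreal q * emeasure lborel (?B i) \<partial>count_space C)"
    by (intro nn_integral_cmult[symmetric]) auto
  also have "\<dots> \<le> (\<integral>\<^sup>+i. emeasure ?\<mu> (?B i) \<partial>count_space C)"
  proof (intro nn_integral_mono)
    fix i assume "i \<in> space (count_space C)"
    then have i: "i \<in> K" using C by auto
    then have "q * (2 * snd i) \<le> f (fst i + snd i) - f (fst i - snd i)" "0 < snd i"
      by (simp_all add: K_def case_prod_unfold)
    then show "ennreal q * emeasure lborel (?B i) \<le> emeasure ?\<mu> (?B i)"
      using q by (simp add: cball_eq_atLeastAtMost Icc ennreal_mult[symmetric] ennreal_leI)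
  qed
  also have "\<dots> = emeasure ?\<mu> ?U"
    using C(1) disj by (intro emeasure_UN_countable[symmetric]) auto
  also have "\<dots> \<le> emeasure ?\<mu> {c..d}"
  proof (rule emeasure_mono)
    have "?B i \<subseteq> {c..d}" if "i \<in> K" for i
      using that by (cases i) (simp add: K_def cball_eq_atLeastAtMost)
    then show "?U \<subseteq> {c..d}" using C(2) by blast
  qed simp
  also have "\<dots> = ennreal (f d - f c)" using Icc cd by simp
  finally have *: "ennreal q * emeasure lborel (E \<inter> ?I) \<le> ennreal (f d - f c)" .
  have "emeasure lborel (E \<inter> ?I) \<le> emeasure lborel ?I" using E by (intro emeasure_mono) auto
  also have "\<dots> < \<infinity>" using cd by simp
  finally have "emeasure lborel (E \<inter> ?I) = ennreal (measure lborel (E \<inter> ?I))"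
    by (intro emeasure_eq_ennreal_measure) auto
  then show ?thesis
    using * q mono[OF cd] by (simp add: ennreal_mult[symmetric])
qed

text \<open>By Lebesgue differentiation the averages of the indicator over \<open>[x, x + h]\<close>
  tend to 1 at almost every point of \<open>E\<close>. A uniform bound \<open>\<theta> < 1\<close>
  on these averages leaves no such point.\<close>

lemma null_of_interval_density_less_one:
  fixes E :: "real set"
  assumes E: "E \<in> sets borel" and \<theta>: "\<theta> < 1"
    and le: "\<And>c d. c \<le> d \<Longrightarrow> measure lborel (E \<inter> {c<..<d}) \<le> \<theta> * (d - c)"
  shows "E \<in> null_sets lborel"
proof -
  let ?f = "indicat_real E"
  have int: "?f integrable_on cbox a b" and eq: "integral (cbox a b) ?f = measure lborel (E \<inter> {a<..<b})" if "a \<le> b" for a b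
  proof -
    have fin: "E \<inter> {a..b} \<in> lmeasurable"
      using E by (intro bounded_set_imp_lmeasurable) (auto intro: bounded_subset[of "{a..b}"])
    have 1: "(?f has_integral measure lebesgue (E \<inter> {a..b})) {a..b}"
      using lmeasure_integral[OF fin] integrable_on_const[OF fin, of "1::real"] unfolding indicator_def of_bool_def
      by (simp add: has_integral_restrict_Int has_integral_iff)
    then show "?f integrable_on cbox a b" by auto
    have "measure lebesgue (E \<inter> {a<..<b}) = measure lebesgue (E \<inter> {a..b})"
      by (rule measure_negligible_symdiff[OF fin], rule negligible_subset[of "{a, b}"]) auto
    with 1 E show "integral (cbox a b) ?f = measure lborel (E \<inter> {a<..<b})" by auto
  qed
  obtain N where N: "negligible N"
    "\<And>x e. \<lbrakk>x \<notin> N; 0 < e\<rbrakk> \<Longrightarrow> \<exists>d>0. \<forall>h. 0 < h \<and> h < d \<longrightarrow>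
       norm (integral (cbox x (x + h *\<^sub>R One)) ?f /\<^sub>R h ^ DIM(real) - ?f x) < e"
  proof (rule integrable_ccontinuous_explicit[of ?f])
    show "?f integrable_on cbox a b" for a b
      using int[of a b] by (cases "a \<le> b") (auto simp: integrable_on_empty)
  qed blast
  have "E \<subseteq> N"
  proof
    fix x assume "x \<in> E"
    show "x \<in> N"
    proof (rule ccontr)
      assume "x \<notin> N"
      have "0 < 1 - \<theta>" using \<theta> by simp
      from N(2)[OF \<open>x \<notin> N\<close> this] obtain d where d: "d > 0"
        "\<forall>h. 0 < h \<and> h < d \<longrightarrow> norm (integral (cbox x (x + h *\<^sub>R One)) ?f /\<^sub>R h ^ DIM(real) - ?f x) < 1 - \<theta>"
        by blast
      have "norm (integral (cbox x (x + (d/2) *\<^sub>R One)) ?f /\<^sub>R (d/2) ^ DIM(real) - ?f x) < 1 - \<theta>"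
        by (rule d(2)[rule_format]) (use d(1) in simp)
      moreover have "x + (d/2) *\<^sub>R One = x + d/2" "(d/2) ^ DIM(real) = d/2" "?f x = 1"
        using \<open>x \<in> E\<close> by simp_all
      ultimately have "\<bar>inverse (d/2) * measure lborel (E \<inter> {x<..<x+d/2}) - 1\<bar> < 1 - \<theta>"
        using d(1) eq[of x "x + d/2"] by (simp only: real_scaleR_def real_norm_def)
      moreover have "inverse (d/2) * measure lborel (E \<inter> {x<..<x+d/2}) \<le> \<theta>"
        using le[of x "x + d/2"] d(1) by (simp add: field_simps)
      ultimately show False by linarith
    qed
  qed
  then have "negligible E" using N(1) negligible_subset by blast
  then show ?thesis using E by (simp add: negligible_iff_null_sets null_sets_def)
qed

text \<open>Both \<open>f x + L x\<close> and \<open>L x - f x\<close> are increasing, and at the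
  points of \<open>E\<close> they frequently have slopes above \<open>q + L\<close> and
  \<open>L - p\<close>. Adding the two increment estimates cancels \<open>f\<close> and bounds the
  share of \<open>E\<close> in any interval by \<open>2 L / (2 L + q - p) < 1\<close>.\<close>

lemma null_of_lipschitz_slope_gap:
  fixes f :: "real \<Rightarrow> real"
  assumes f: "L-lipschitz_on UNIV f" and pq: "p < q" and E: "E \<in> sets borel"
    and gt: "\<And>x \<delta>. x \<in> E \<Longrightarrow> 0 < \<delta> \<Longrightarrow> \<exists>h. h \<noteq> 0 \<and> \<bar>h\<bar> < \<delta> \<and> q < (f (x + h) - f x) / h"
    and lt: "\<And>x \<delta>. x \<in> E \<Longrightarrow> 0 < \<delta> \<Longrightarrow> \<exists>h. h \<noteq> 0 \<and> \<bar>h\<bar> < \<delta> \<and> (f (x + h) - f x) / h < p"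
  shows "E \<in> null_sets lborel"
proof (cases "E = {}")
  case False
  then obtain z where z: "z \<in> E" by auto
  have L: "0 \<le> L" using f by (rule lipschitz_on_nonneg)
  have lip: "\<bar>f x - f y\<bar> \<le> L * \<bar>x - y\<bar>" for x y
    using lipschitz_onD[OF f, of x y] by (simp add: dist_real_def)
  have slope: "\<bar>(f (x + h) - f x) / h\<bar> \<le> L" if "h \<noteq> 0" for x h
    using lip[of "x + h" x] that by (simp add: abs_divide divide_le_eq)
  \<comment> \<open>Secant slopes lie in \<open>[-L, L]\<close>. One slope above \<open>q\<close>
    and one below \<open>p\<close> therefore give \<open>q < L\<close> and \<open>- L < p\<close>,
    which makes both shifted thresholds positive.\<close>
  obtain h where "h \<noteq> 0" "q < (f (z + h) - f z) / h" using gt[OF z zero_less_one] by blast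
  with slope[of h z] have qL: "q < L" by linarith
  obtain h where "h \<noteq> 0" "(f (z + h) - f z) / h < p" using lt[OF z zero_less_one] by blast
  with slope[of h z] have pL: "- L < p" by linarith
  have cont: "continuous_on UNIV f" using f by (rule lipschitz_on_continuous_on)
  have inc: "(q + L) * measure lborel (E \<inter> {c<..<d}) \<le> f d + L * d - (f c + L * c)" if "c \<le> d" for c d
  proof (rule increment_ge_of_frequently_slope_gt[where f = "\<lambda>x. f x + L * x"])
    show "mono (\<lambda>x. f x + L * x)"
    proof (rule monoI)
      fix x y :: real assume "x \<le> y"
      then show "f x + L * x \<le> f y + L * y" using lip[of x y] by (auto simp: abs_le_iff algebra_simps)
    qed
    fix x \<delta> :: real assume "x \<in> E" "0 < \<delta>"
    then obtain h where "h \<noteq> 0" "\<bar>h\<bar> < \<delta>" "q < (f (x + h) - f x) / h" using gt by blast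
    then show "\<exists>h. h \<noteq> 0 \<and> \<bar>h\<bar> < \<delta> \<and> q + L < (f (x + h) + L * (x + h) - (f x + L * x)) / h"
      using add_divide_distrib[of "f (x + h) - f x" "L * h" h] by (intro exI[of _ h]) (simp add: algebra_simps)
  qed (use pL pq that E cont in \<open>auto intro!: continuous_intros\<close>)
  have dec: "(L - p) * measure lborel (E \<inter> {c<..<d}) \<le> L * d - f d - (L * c - f c)" if "c \<le> d" for c d
  proof (rule increment_ge_of_frequently_slope_gt[where f = "\<lambda>x. L * x - f x"])
    show "mono (\<lambda>x. L * x - f x)"
    proof (rule monoI)
      fix x y :: real assume "x \<le> y"
      then show "L * x - f x \<le> L * y - f y" using lip[of x y] by (auto simp: abs_le_iff algebra_simps)
    qed
    fix x \<delta> :: real assume "x \<in> E" "0 < \<delta>"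
    then obtain h where "h \<noteq> 0" "\<bar>h\<bar> < \<delta>" "(f (x + h) - f x) / h < p" using lt by blast
    then show "\<exists>h. h \<noteq> 0 \<and> \<bar>h\<bar> < \<delta> \<and> L - p < (L * (x + h) - f (x + h) - (L * x - f x)) / h"
      using diff_divide_distrib[of "L * h" "f (x + h) - f x" h] by (intro exI[of _ h]) (simp add: algebra_simps)
  qed (use qL pq that E cont in \<open>auto intro!: continuous_intros\<close>)
  show ?thesis
  proof (rule null_of_interval_density_less_one[OF E])
    have pos: "0 < 2 * L + q - p" using L pq by simp
    show "2 * L / (2 * L + q - p) < 1" using pos pq by simp
    fix c d :: real assume cd: "c \<le> d"
    have "(2 * L + q - p) * measure lborel (E \<inter> {c<..<d}) \<le> 2 * L * (d - c)"
      using inc[OF cd] dec[OF cd] by (simp add: algebra_simps)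
    then show "measure lborel (E \<inter> {c<..<d}) \<le> 2 * L / (2 * L + q - p) * (d - c)"
      using pos by (simp add: field_simps)
  qed
qed simp

section \<open>From lines to the whole space\<close>

text \<open>Translation invariance allows \<open>N\<close> to be averaged over its translates by
  \<open>t v\<close> with \<open>t\<close> in \<open>[0, 1]\<close>. After exchanging the integrals,
  the inner one in \<open>t\<close> sees only a slice of \<open>N\<close> along
  \<open>v\<close>.\<close>

lemma null_of_null_slices:
  fixes N :: "'a::euclidean_space set"
  assumes N: "N \<in> sets borel" and slice: "\<And>x. {t. x + t *\<^sub>R v \<in> N} \<in> null_sets lborel"
  shows "N \<in> null_sets lborel"
proof -
  let ?g = "\<lambda>(x, t). indicator {0..1::real} t * indicator N (x + t *\<^sub>R v) :: ennreal"
  have [measurable]: "N \<in> sets borel" by fact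
  have meas: "?g \<in> borel_measurable (lborel \<Otimes>\<^sub>M lborel)"
    by measurable
  have "emeasure lborel N = (\<integral>\<^sup>+t. indicator {0..1::real} t * emeasure lborel N \<partial>lborel)"
    by (simp add: nn_integral_multc)
  also have "\<dots> = (\<integral>\<^sup>+t. \<integral>\<^sup>+x. ?g (x, t) \<partial>lborel \<partial>lborel)"
  proof (rule nn_integral_cong)
    fix t :: real
    have "emeasure lborel N = emeasure (distr lborel borel ((+) (t *\<^sub>R v))) N"
      by (simp add: lborel_distr_plus)
    also have "\<dots> = (\<integral>\<^sup>+x. indicator N (x + t *\<^sub>R v) \<partial>lborel)"
      using nn_integral_distr[of "(+) (t *\<^sub>R v)" lborel borel "indicator N"]
      by (simp add: add.commute)
    finally show "indicator {0..1} t * emeasure lborel N = (\<integral>\<^sup>+x. ?g (x, t) \<partial>lborel)"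
      by (simp add: nn_integral_cmult)
  qed
  also have "\<dots> = (\<integral>\<^sup>+x. \<integral>\<^sup>+t. ?g (x, t) \<partial>lborel \<partial>lborel)"
    using lborel_pair.Fubini'[of "\<lambda>x t. ?g (x, t)"] meas by (simp add: case_prod_unfold)
  also have "\<dots> = (\<integral>\<^sup>+x. 0 \<partial>(lborel :: 'a measure))"
  proof (rule nn_integral_cong)
    fix x :: 'a
    have "AE t in lborel. t \<notin> {t. x + t *\<^sub>R v \<in> N}" using slice by (rule AE_not_in)
    then have "(\<integral>\<^sup>+t. ?g (x, t) \<partial>lborel) = (\<integral>\<^sup>+t. 0 \<partial>(lborel :: real measure))"
      by (intro nn_integral_cong_AE) (auto simp: indicator_def)
    then show "(\<integral>\<^sup>+t. ?g (x, t) \<partial>lborel) = 0" by simp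
  qed
  finally show ?thesis using N by (simp add: null_sets_def)
qed

text \<open>The candidate limit is the limes superior, written as the infimum of the eventual upper
  bounds. For \<open>y\<close> below it choose rationals \<open>y < p < q\<close> still below it:
  \<open>q\<close> is no eventual upper bound, so the hypothesis on gaps makes \<open>p\<close> an
  eventual lower bound.\<close>

lemma tendsto_of_no_slope_gap:
  fixes Q :: "'a \<Rightarrow> real"
  assumes F: "F \<noteq> bot" and bdd: "\<And>h. \<bar>Q h\<bar> \<le> L"
    and gap: "\<And>p q. p \<in> \<rat> \<Longrightarrow> q \<in> \<rat> \<Longrightarrow> p < q \<Longrightarrow> eventually (\<lambda>h. p \<le> Q h) F \<or> eventually (\<lambda>h. Q h \<le> q) F"
  shows "\<exists>l. (Q \<longlongrightarrow> l) F"
proof -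
  let ?S = "{r. eventually (\<lambda>h. Q h \<le> r) F}"
  have ne: "L \<in> ?S" using bdd by (auto intro!: always_eventually) (meson abs_le_D1)
  have lb: "- L \<le> r" if "r \<in> ?S" for r
  proof -
    have "eventually (\<lambda>h. Q h \<le> r) F" using that by simp
    then obtain h where "Q h \<le> r" using eventually_happens[of _ F] F by blast
    then show ?thesis using bdd[of h] by linarith
  qed
  have bb: "bdd_below ?S" using lb by (intro bdd_belowI)
  have "(Q \<longlongrightarrow> Inf ?S) F"
  proof (rule order_tendstoI)
    fix y assume y: "y < Inf ?S"
    obtain p where p: "p \<in> \<rat>" "y < p" "p < Inf ?S" using Rats_dense_in_real[OF y] by auto
    obtain q where q: "q \<in> \<rat>" "p < q" "q < Inf ?S" using Rats_dense_in_real[OF p(3)] by auto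
    have "q \<notin> ?S" using cInf_lower[OF _ bb, of q] q by auto
    then have "eventually (\<lambda>h. p \<le> Q h) F" using gap[OF p(1) q(1,2)] by simp
    then show "eventually (\<lambda>h. y < Q h) F" by eventually_elim (use p in simp)
  next
    fix y assume "Inf ?S < y"
    then obtain r where "r \<in> ?S" "r < y" using cInf_less_iff[OF _ bb] ne by auto
    then have "eventually (\<lambda>h. Q h \<le> r) F" by simp
    then show "eventually (\<lambda>h. Q h < y) F" by eventually_elim (use \<open>r < y\<close> in simp)
  qed
  then show ?thesis ..
qed

text \<open>
  The points where two rational slopes \<open>p < q\<close> are both crossed frequently form a \<open>G\<^sub>\<delta>\<close>-set that
  meets every line parallel to \<open>v\<close> in a null set, by the Vitali covering argument above.
\<close>
lemma AE_lipschitz_directional_derivative: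
  fixes f :: "'a::euclidean_space \<Rightarrow> real"
  assumes f: "L-lipschitz_on UNIV f"
  shows "AE x in lborel. \<exists>D. ((\<lambda>t. f (x + t *\<^sub>R v)) has_vector_derivative D) (at 0)"
proof -
  have cont: "continuous_on UNIV f" using f by (rule lipschitz_on_continuous_on)
  define Q where "Q x h = (f (x + h *\<^sub>R v) - f x) / h" for x h
  define G where "G p q = (\<Inter>n::nat. \<Union>h\<in>{h. h \<noteq> 0 \<and> \<bar>h\<bar> < inverse (Suc n)}. {x. q < Q x h})
      \<inter> (\<Inter>n::nat. \<Union>h\<in>{h. h \<noteq> 0 \<and> \<bar>h\<bar> < inverse (Suc n)}. {x. Q x h < p})" for p q
  have fv: "continuous_on UNIV (\<lambda>x. f (x + h *\<^sub>R v))" for h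
    by (rule continuous_on_compose2[OF cont]) (auto intro!: continuous_intros)
  have opn: "open {x. q < Q x h}" "open {x. Q x h < q}" if "h \<noteq> 0" for q h
    using that unfolding Q_def
    by (auto intro!: open_Collect_less continuous_intros fv cont)
  have Gm: "G p q \<in> sets borel" for p q
    unfolding G_def by (intro sets.Int sets.countable_INT'' borel_open open_UN) (use opn in auto)
  have slice: "{t. x + t *\<^sub>R v \<in> G p q} \<in> null_sets lborel" if pq: "p < q" for p q x
  proof (rule null_of_lipschitz_slope_gap[OF _ pq])
    let ?g = "\<lambda>t. f (x + t *\<^sub>R v)"
    have "(L * norm v)-lipschitz_on UNIV ?g"
    proof (rule lipschitz_onI)
      fix s t :: real
      have "dist (?g s) (?g t) \<le> L * dist (x + s *\<^sub>R v) (x + t *\<^sub>R v)" by (rule lipschitz_onD[OF f]) auto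
      also have "dist (x + s *\<^sub>R v) (x + t *\<^sub>R v) = norm v * dist s t"
        by (simp add: dist_norm scaleR_diff_left[symmetric])
      finally show "dist (?g s) (?g t) \<le> L * norm v * dist s t" by simp
    qed (use lipschitz_on_nonneg[OF f] in simp)
    then show "(L * norm v)-lipschitz_on UNIV ?g" .
    have "(\<lambda>t. x + t *\<^sub>R v) \<in> borel_measurable borel" by measurable
    from measurable_sets[OF this Gm[of p q]] show "{t. x + t *\<^sub>R v \<in> G p q} \<in> sets borel"
      by (simp add: vimage_def)
    fix t \<delta> :: real assume t: "t \<in> {t. x + t *\<^sub>R v \<in> G p q}" and \<delta>: "0 < \<delta>"
    obtain n where n: "inverse (real (Suc n)) < \<delta>" using reals_Archimedean[OF \<delta>] by auto
    have "x + t *\<^sub>R v \<in> (\<Union>h\<in>{h. h \<noteq> 0 \<and> \<bar>h\<bar> < inverse (Suc n)}. {x. q < Q x h})"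
      using t unfolding G_def by blast
    then obtain h where "h \<noteq> 0" "\<bar>h\<bar> < inverse (Suc n)" "q < Q (x + t *\<^sub>R v) h" by blast
    then show "\<exists>h. h \<noteq> 0 \<and> \<bar>h\<bar> < \<delta> \<and> q < (?g (t + h) - ?g t) / h"
      using n by (intro exI[of _ h]) (simp add: Q_def algebra_simps)
    have "x + t *\<^sub>R v \<in> (\<Union>h\<in>{h. h \<noteq> 0 \<and> \<bar>h\<bar> < inverse (Suc n)}. {x. Q x h < p})"
      using t unfolding G_def by blast
    then obtain h where "h \<noteq> 0" "\<bar>h\<bar> < inverse (Suc n)" "Q (x + t *\<^sub>R v) h < p" by blast
    then show "\<exists>h. h \<noteq> 0 \<and> \<bar>h\<bar> < \<delta> \<and> (?g (t + h) - ?g t) / h < p"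
      using n by (intro exI[of _ h]) (simp add: Q_def algebra_simps)
  qed
  \<comment> \<open>Rational thresholds keep the number of exceptional sets countable.\<close>
  have "AE x in lborel. \<forall>p\<in>\<rat>. \<forall>q\<in>\<rat>. p < q \<longrightarrow> x \<notin> G p q"
  proof (intro AE_ball_countable' countable_rat)
    fix p q :: real
    show "AE x in lborel. p < q \<longrightarrow> x \<notin> G p q"
    proof (cases "p < q")
      case True
      then show ?thesis using AE_not_in[OF null_of_null_slices[OF Gm slice]] by simp
    qed simp
  qed
  then show ?thesis
  proof eventually_elim
    case (elim x)
    have "\<exists>l. (Q x \<longlongrightarrow> l) (at (0::real))"
    proof (rule tendsto_of_no_slope_gap)
      \<comment> \<open>At \<open>h = 0\<close> the quotient is 0 by the convention for division by
        zero, so the bound holds for every \<open>h\<close>.\<close>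
      show "\<bar>Q x h\<bar> \<le> L * norm v" for h
      proof (cases "h = 0")
        case False
        have "\<bar>f (x + h *\<^sub>R v) - f x\<bar> \<le> L * norm v * \<bar>h\<bar>"
          using lipschitz_onD[OF f, of "x + h *\<^sub>R v" x] by (simp add: dist_norm mult_ac)
        then show ?thesis using False by (simp add: Q_def abs_divide pos_divide_le_eq)
      qed (use lipschitz_on_nonneg[OF f] in \<open>simp add: Q_def\<close>)
      fix p q :: real assume pq: "p \<in> \<rat>" "q \<in> \<rat>" "p < q"
      have G: "x \<in> G p q \<longleftrightarrow> (\<forall>n::nat. \<exists>h. h \<noteq> 0 \<and> \<bar>h\<bar> < inverse (Suc n) \<and> q < Q x h) \<and>
          (\<forall>n::nat. \<exists>h. h \<noteq> 0 \<and> \<bar>h\<bar> < inverse (Suc n) \<and> Q x h < p)"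
        unfolding G_def Int_iff INT_iff UN_iff mem_Collect_eq Bex_def
        by (simp only: conj_assoc simp_thms ball_UNIV)
      have "x \<notin> G p q" using elim pq by simp
      then have "(\<exists>n::nat. \<forall>h. h \<noteq> 0 \<and> \<bar>h\<bar> < inverse (Suc n) \<longrightarrow> Q x h \<le> q) \<or>
          (\<exists>n::nat. \<forall>h. h \<noteq> 0 \<and> \<bar>h\<bar> < inverse (Suc n) \<longrightarrow> p \<le> Q x h)"
        unfolding G by (simp only: de_Morgan_conj not_all not_ex not_less imp_conv_disj simp_thms disj_assoc disj_commute)
          (metis not_less)
      then obtain n :: nat where n: "(\<forall>h. h \<noteq> 0 \<and> \<bar>h\<bar> < inverse (Suc n) \<longrightarrow> Q x h \<le> q) \<or>
          (\<forall>h. h \<noteq> 0 \<and> \<bar>h\<bar> < inverse (Suc n) \<longrightarrow> p \<le> Q x h)"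
        by blast
      then show "eventually (\<lambda>h. p \<le> Q x h) (at 0) \<or> eventually (\<lambda>h. Q x h \<le> q) (at 0)"
      proof (elim disjE)
        assume "\<forall>h. h \<noteq> 0 \<and> \<bar>h\<bar> < inverse (Suc n) \<longrightarrow> Q x h \<le> q"
        then have "eventually (\<lambda>h. Q x h \<le> q) (at 0)"
          unfolding eventually_at by (intro exI[of _ "inverse (real (Suc n))"]) simp
        then show ?thesis ..
      next
        assume "\<forall>h. h \<noteq> 0 \<and> \<bar>h\<bar> < inverse (Suc n) \<longrightarrow> p \<le> Q x h"
        then have "eventually (\<lambda>h. p \<le> Q x h) (at 0)"
          unfolding eventually_at by (intro exI[of _ "inverse (real (Suc n))"]) simp
        then show ?thesis ..
      qed
    qed simp
    then obtain l where "(Q x \<longlongrightarrow> l) (at 0)" ..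
    then have "((\<lambda>t. f (x + t *\<^sub>R v)) has_field_derivative l) (at 0)"
      unfolding DERIV_def Q_def[abs_def] by simp
    then show ?case
      using has_real_derivative_iff_has_vector_derivative by blast
  qed
qed

section \<open>Polynomial spaces\<close>

definition monom_fun :: "('n \<Rightarrow> nat) \<Rightarrow> real^'n \<Rightarrow> real" where
  "monom_fun \<alpha> x = (\<Prod>i\<in>UNIV. (x $ i) ^ \<alpha> i)"

lemma poly_space_iff:
  "f \<in> poly_space k \<longleftrightarrow> (\<exists>c. f = (\<lambda>x. \<Sum>\<alpha>\<in>{\<alpha>. sum \<alpha> UNIV \<le> k}. c \<alpha> * monom_fun \<alpha> x))"
  by (simp add: poly_space_def monom_fun_def)

lemma finite_multi_index: "finite {\<alpha> :: 'n::finite \<Rightarrow> nat. sum \<alpha> UNIV \<le> k}"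
proof (rule finite_subset)
  show "{\<alpha> :: 'n \<Rightarrow> nat. sum \<alpha> UNIV \<le> k} \<subseteq> PiE UNIV (\<lambda>_. {..k})"
  proof
    fix \<alpha> :: "'n \<Rightarrow> nat" assume "\<alpha> \<in> {\<alpha>. sum \<alpha> UNIV \<le> k}"
    moreover have "\<alpha> i \<le> sum \<alpha> UNIV" for i by (rule member_le_sum) auto
    ultimately show "\<alpha> \<in> PiE UNIV (\<lambda>_. {..k})" by (auto intro: order_trans)
  qed
qed (simp add: finite_PiE)

lemma poly_space_add: "f \<in> poly_space k \<Longrightarrow> g \<in> poly_space k \<Longrightarrow> (\<lambda>x. f x + g x) \<in> poly_space k"
  unfolding poly_space_iff
proof (elim exE)
  fix c d assume "f = (\<lambda>x. \<Sum>\<alpha>\<in>{\<alpha>. sum \<alpha> UNIV \<le> k}. c \<alpha> * monom_fun \<alpha> x)"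
    "g = (\<lambda>x. \<Sum>\<alpha>\<in>{\<alpha>. sum \<alpha> UNIV \<le> k}. d \<alpha> * monom_fun \<alpha> x)"
  then show "\<exists>c. (\<lambda>x. f x + g x) = (\<lambda>x. \<Sum>\<alpha>\<in>{\<alpha>. sum \<alpha> UNIV \<le> k}. c \<alpha> * monom_fun \<alpha> x)"
    by (intro exI[of _ "\<lambda>\<alpha>. c \<alpha> + d \<alpha>"]) (simp add: distrib_right sum.distrib)
qed

lemma poly_space_cmul: "f \<in> poly_space k \<Longrightarrow> (\<lambda>x. a * f x) \<in> poly_space k"
  unfolding poly_space_iff
proof (elim exE)
  fix c assume "f = (\<lambda>x. \<Sum>\<alpha>\<in>{\<alpha>. sum \<alpha> UNIV \<le> k}. c \<alpha> * monom_fun \<alpha> x)"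
  then show "\<exists>c. (\<lambda>x. a * f x) = (\<lambda>x. \<Sum>\<alpha>\<in>{\<alpha>. sum \<alpha> UNIV \<le> k}. c \<alpha> * monom_fun \<alpha> x)"
    by (intro exI[of _ "\<lambda>\<alpha>. a * c \<alpha>"]) (simp add: sum_distrib_left mult.assoc)
qed

lemma poly_space_zero: "(\<lambda>x. 0) \<in> poly_space k"
  unfolding poly_space_iff by (intro exI[of _ "\<lambda>_. 0"]) simp

lemma poly_space_sum: "(\<And>i. i \<in> I \<Longrightarrow> f i \<in> poly_space k) \<Longrightarrow> (\<lambda>x. \<Sum>i\<in>I. f i x) \<in> poly_space k"
  by (induction I rule: infinite_finite_induct) (auto intro: poly_space_zero poly_space_add)

lemma poly_space_monom: 
  fixes \<alpha> :: "'n::finite \<Rightarrow> nat"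
  assumes "sum \<alpha> UNIV \<le> k" shows "monom_fun \<alpha> \<in> poly_space k"
  unfolding poly_space_iff
proof (intro exI ext)
  fix x :: "real^'n"
  have "(\<Sum>\<beta>\<in>{\<beta>. sum \<beta> UNIV \<le> k}. of_bool (\<beta> = \<alpha>) * monom_fun \<beta> x) =
      (\<Sum>\<beta>\<in>{\<beta>. sum \<beta> UNIV \<le> k}. if \<alpha> = \<beta> then monom_fun \<beta> x else 0)"
    by (intro sum.cong) auto
  then show "monom_fun \<alpha> x = (\<Sum>\<beta>\<in>{\<beta>. sum \<beta> UNIV \<le> k}. of_bool (\<beta> = \<alpha>) * monom_fun \<beta> x)"
    using assms by (simp add: finite_multi_index)
qed

lemma pd_eqI: "((\<lambda>t. f (x + t *\<^sub>R axis j 1)) has_vector_derivative D) (at 0) \<Longrightarrow> pd j f x = D"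
  unfolding pd_def by (rule vector_derivative_at)

text \<open>Along the \<open>j\<close>-th axis only the factor in \<open>x $ j\<close> varies. If
  \<open>\<alpha> j = 0\<close>, the truncated exponent \<open>\<alpha> j - 1\<close> is again 0 and
  the factor \<open>real (\<alpha> j)\<close> removes the term.\<close>

lemma monom_fun_has_pd:
  "((\<lambda>t. monom_fun \<alpha> (x + t *\<^sub>R axis j 1)) has_vector_derivative
     (real (\<alpha> j) * monom_fun (\<alpha>(j := \<alpha> j - 1)) x)) (at 0)"
proof -
  define P where "P = (\<Prod>i\<in>UNIV - {j}. (x $ i) ^ \<alpha> i)"
  have "monom_fun \<alpha> (x + t *\<^sub>R axis j 1) = (x $ j + t) ^ \<alpha> j * P" for t
    unfolding monom_fun_def P_def
    by (subst prod.remove[of UNIV j]) (auto simp: axis_def intro!: prod.cong)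
  moreover have "monom_fun (\<alpha>(j := \<alpha> j - 1)) x = (x $ j) ^ (\<alpha> j - 1) * P"
    unfolding monom_fun_def P_def
    by (subst prod.remove[of UNIV j]) (auto intro!: prod.cong)
  moreover have "((\<lambda>t. (x $ j + t) ^ \<alpha> j * P) has_real_derivative (real (\<alpha> j) * ((x $ j) ^ (\<alpha> j - 1) * P))) (at 0)"
    by (auto intro!: derivative_eq_intros)
  ultimately show ?thesis by (simp add: has_real_derivative_iff_has_vector_derivative)
qed

lemma monom_fun_combination_has_pd:
  "((\<lambda>t. \<Sum>\<alpha>\<in>A. c \<alpha> * monom_fun \<alpha> (x + t *\<^sub>R axis j 1)) has_vector_derivative
     (\<Sum>\<alpha>\<in>A. c \<alpha> * (real (\<alpha> j) * monom_fun (\<alpha>(j := \<alpha> j - 1)) x))) (at 0)"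
  using monom_fun_has_pd by (intro has_vector_derivative_sum has_vector_derivative_mult_right)

lemma poly_space_has_pd:
  assumes "f \<in> poly_space k"
  shows "((\<lambda>t. f (x + t *\<^sub>R axis j 1)) has_vector_derivative pd j f x) (at 0)"
proof -
  obtain c where f: "f = (\<lambda>x. \<Sum>\<alpha>\<in>{\<alpha>. sum \<alpha> UNIV \<le> k}. c \<alpha> * monom_fun \<alpha> x)"
    using assms unfolding poly_space_iff by blast
  show ?thesis
    using monom_fun_combination_has_pd[where A = "{\<alpha>. sum \<alpha> UNIV \<le> k}" and c = c and x = x and j = j] pd_eqI[of f x j] unfolding f by simp
qed

lemma pd_monom_fun_combination:
  "pd j (\<lambda>x. \<Sum>\<alpha>\<in>A. c \<alpha> * monom_fun \<alpha> x) =
    (\<lambda>x. \<Sum>\<alpha>\<in>A. (c \<alpha> * real (\<alpha> j)) * monom_fun (\<alpha>(j := \<alpha> j - 1)) x)"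
proof
  fix x
  show "pd j (\<lambda>x. \<Sum>\<alpha>\<in>A. c \<alpha> * monom_fun \<alpha> x) x =
      (\<Sum>\<alpha>\<in>A. (c \<alpha> * real (\<alpha> j)) * monom_fun (\<alpha>(j := \<alpha> j - 1)) x)"
    unfolding mult.assoc by (rule pd_eqI) (rule monom_fun_combination_has_pd)
qed

text \<open>Lowering an exponent never raises the total degree. The bound \<open>k\<close> is kept,
  instead of \<open>k - 1\<close>, so that derivatives of discrete fields stay in the test space,
  also for \<open>k = 0\<close>.\<close>

lemma poly_space_pd:
  assumes "f \<in> poly_space k"
  shows "pd j f \<in> poly_space k"
proof -
  obtain c where f: "f = (\<lambda>x. \<Sum>\<alpha>\<in>{\<alpha>. sum \<alpha> UNIV \<le> k}. c \<alpha> * monom_fun \<alpha> x)"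
    using assms unfolding poly_space_iff by blast
  have "sum (\<alpha>(j := \<alpha> j - 1)) UNIV \<le> k" if "sum \<alpha> UNIV \<le> k" for \<alpha> :: "'a \<Rightarrow> nat"
    by (rule order_trans[OF sum_mono that]) auto
  then show ?thesis
    unfolding f pd_monom_fun_combination
    by (intro poly_space_sum poly_space_cmul poly_space_monom) auto
qed

lemma pd_commute:
  assumes "f \<in> poly_space k"
  shows "pd i (pd j f) x = pd j (pd i f) x"
proof -
  obtain c where f: "f = (\<lambda>x. \<Sum>\<alpha>\<in>{\<alpha>. sum \<alpha> UNIV \<le> k}. c \<alpha> * monom_fun \<alpha> x)"
    using assms unfolding poly_space_iff by blast
  have *: "pd i (pd j f) x = (\<Sum>\<alpha>\<in>{\<alpha>. sum \<alpha> UNIV \<le> k}. (c \<alpha> * real (\<alpha> j)) *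
     (real ((\<alpha>(j := \<alpha> j - 1)) i) * monom_fun (\<alpha>(j := \<alpha> j - 1, i := (\<alpha>(j := \<alpha> j - 1)) i - 1)) x))" for i j
    unfolding f pd_monom_fun_combination
    by (intro pd_eqI has_vector_derivative_sum has_vector_derivative_mult_right monom_fun_has_pd)
  show ?thesis
  proof (cases "i = j")
    case False
    then show ?thesis unfolding * by (intro sum.cong) (auto simp: fun_upd_twist)
  qed simp
qed

lemma real_polynomial_function_monom_fun: "real_polynomial_function (monom_fun \<alpha>)"
  unfolding monom_fun_def
  by (intro real_polynomial_function_prod real_polynomial_function_power real_polynomial_function.intros(1)
      bounded_linear_vec_nth) simp

lemma real_polynomial_function_poly_space: "f \<in> poly_space k \<Longrightarrow> real_polynomial_function f"
  unfolding poly_space_iff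
  using finite_multi_index[of k] real_polynomial_function_monom_fun
  by (auto intro!: real_polynomial_function_sum real_polynomial_function.intros(4) real_polynomial_function.intros(2))

text \<open>On the line from \<open>a\<close> to \<open>y\<close> the function is a polynomial in
  one variable with infinitely many zeros near the parameter 0. It vanishes identically, in
  particular at the parameter 1, which is the point \<open>y\<close>.\<close>

lemma real_polynomial_function_zero_of_open:
  fixes f :: "'a::euclidean_space \<Rightarrow> real"
  assumes f: "real_polynomial_function f" and S: "open S" "a \<in> S" and zero: "\<And>x. x \<in> S \<Longrightarrow> f x = 0"
  shows "f y = 0"
proof -
  have "polynomial_function (\<lambda>t::real. a + t *\<^sub>R (y - a))"
    by (intro polynomial_function_add polynomial_function_const polynomial_function_mult
       polynomial_function_id)
  then have "real_polynomial_function (f \<circ> (\<lambda>t::real. a + t *\<^sub>R (y - a)))"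
    using f by (intro real_polynomial_function_compose)
  then obtain c :: "nat \<Rightarrow> real" and n where c: "\<And>t. f (a + t *\<^sub>R (y - a)) = (\<Sum>i\<le>n. c i * t ^ i)"
    by (auto dest!: real_polynomial_function_imp_sum simp: fun_eq_iff)
  have "eventually (\<lambda>t::real. a + t *\<^sub>R (y - a) \<in> S) (at 0)"
  proof -
    have "((\<lambda>t::real. a + t *\<^sub>R (y - a)) \<longlongrightarrow> a + 0 *\<^sub>R (y - a)) (at 0)"
      by (intro tendsto_intros)
    then show ?thesis using S by (auto dest: topological_tendstoD)
  qed
  then obtain d where d: "d > 0" "\<And>t. t \<noteq> 0 \<Longrightarrow> \<bar>t\<bar> < d \<Longrightarrow> a + t *\<^sub>R (y - a) \<in> S"
    unfolding eventually_at by auto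
  have "infinite {0<..<d}" using d(1) by (simp add: infinite_Ioo)
  moreover have "{0<..<d} \<subseteq> {t. (\<Sum>i\<le>n. c i * t ^ i) = 0}"
    using d(2) zero by (auto simp flip: c)
  ultimately have "infinite {t. (\<Sum>i\<le>n. c i * t ^ i) = 0}" using finite_subset by blast
  then have "\<forall>i\<le>n. c i = 0" using polyfun_rootbound by blast
  then have "f (a + 1 *\<^sub>R (y - a)) = 0" unfolding c by simp
  then show ?thesis by simp
qed

section \<open>Fields with values in a Euclidean space\<close>

text \<open>The components are differentiated separately, so the result agrees with the entries of
  \<open>gradV\<close>, \<open>divV\<close> and the curls at every point, even where a derivative
  fails to exist.\<close>

definition pdv :: "'n \<Rightarrow> ((real^'n) \<Rightarrow> 'a::euclidean_space) \<Rightarrow> real^'n \<Rightarrow> 'a" where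
  "pdv j f x = (\<Sum>b\<in>Basis. pd j (\<lambda>y. f y \<bullet> b) x *\<^sub>R b)"

lemma pdv_inner_Basis: "b \<in> Basis \<Longrightarrow> pdv j f x \<bullet> b = pd j (\<lambda>y. f y \<bullet> b) x"
  unfolding pdv_def by (simp add: inner_sum_left inner_Basis if_distrib sum.delta cong: if_cong)

lemma pdv_real [simp]: "pdv j (f :: real^'n \<Rightarrow> real) x = pd j f x"
  by (simp add: pdv_def)

lemma pdv_nth: "pdv j (f :: real^'n \<Rightarrow> real^'m) x $ i = pd j (\<lambda>y. f y $ i) x"
  using pdv_inner_Basis[of "axis i 1" j f x] by (simp add: inner_axis axis_in_Basis_iff)

lemma vpoly_space_real [simp]: "(f :: real^'n \<Rightarrow> real) \<in> vpoly_space k \<longleftrightarrow> f \<in> poly_space k"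
  by (simp add: vpoly_space_def)

lemma vpoly_space_add: "f \<in> vpoly_space k \<Longrightarrow> g \<in> vpoly_space k \<Longrightarrow> (\<lambda>x. f x + g x) \<in> vpoly_space k"
  by (simp add: vpoly_space_def inner_add_left poly_space_add)

lemma vpoly_space_scaleR: "f \<in> vpoly_space k \<Longrightarrow> (\<lambda>x. a *\<^sub>R f x) \<in> vpoly_space k"
  by (simp add: vpoly_space_def poly_space_cmul)

lemma vpoly_space_sum: "(\<And>i. i \<in> I \<Longrightarrow> f i \<in> vpoly_space k) \<Longrightarrow> (\<lambda>x. \<Sum>i\<in>I. f i x) \<in> vpoly_space k"
  by (simp add: vpoly_space_def inner_sum_left poly_space_sum)

lemma vpoly_space_zero: "(\<lambda>x. 0) \<in> vpoly_space k"
  by (simp add: vpoly_space_def poly_space_zero)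

lemma vpoly_space_linear:
  fixes f :: "real^'n \<Rightarrow> 'a::euclidean_space" and T :: "'a \<Rightarrow> 'b::euclidean_space"
  assumes f: "f \<in> vpoly_space k" and T: "linear T"
  shows "(\<lambda>x. T (f x)) \<in> vpoly_space k"
  unfolding vpoly_space_def
proof (intro CollectI ballI)
  fix b :: 'b assume "b \<in> Basis"
  have "T (f x) \<bullet> b = (\<Sum>i\<in>Basis. (T i \<bullet> b) * (f x \<bullet> i))" for x
  proof -
    have "T (f x) = T (\<Sum>i\<in>Basis. (f x \<bullet> i) *\<^sub>R i)" by (simp only: euclidean_representation)
    then show ?thesis
      by (simp add: linear_sum[OF T] linear_cmul[OF T] inner_sum_left mult.commute)
  qed
  then show "(\<lambda>x. T (f x) \<bullet> b) \<in> poly_space k"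
    using f by (simp add: vpoly_space_def poly_space_sum poly_space_cmul)
qed

lemma vpoly_space_pdv: "f \<in> vpoly_space k \<Longrightarrow> pdv j f \<in> vpoly_space k"
  using poly_space_pd unfolding vpoly_space_def by (fastforce simp: pdv_inner_Basis)

lemma vpoly_space_eq_zero_of_open:
  assumes f: "f \<in> vpoly_space k" and S: "open S" "a \<in> S" and zero: "\<And>x. x \<in> S \<Longrightarrow> f x = 0"
  shows "f y = 0"
proof (rule euclidean_eqI)
  fix b :: 'b assume "b \<in> Basis"
  then have "real_polynomial_function (\<lambda>x. f x \<bullet> b)"
    using f real_polynomial_function_poly_space by (auto simp: vpoly_space_def)
  then have "f y \<bullet> b = 0"
    by (rule real_polynomial_function_zero_of_open[OF _ S]) (simp add: zero)
  then show "f y \<bullet> b = 0 \<bullet> b" by simp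
qed

section \<open>The divergence theorem for Lipschitz functions\<close>

definition lip_on :: "'a::metric_space set \<Rightarrow> ('a \<Rightarrow> 'b::metric_space) \<Rightarrow> bool" where
  "lip_on K f \<longleftrightarrow> (\<exists>C. C-lipschitz_on K f)"

lemma lip_on_const: "lip_on K (\<lambda>x. c)"
  unfolding lip_on_def by (blast intro: lipschitz_on_constant)

lemma lip_on_add:
  fixes f g :: "'a::metric_space \<Rightarrow> 'b::real_normed_vector"
  shows "lip_on K f \<Longrightarrow> lip_on K g \<Longrightarrow> lip_on K (\<lambda>x. f x + g x)"
  unfolding lip_on_def by (blast intro: lipschitz_on_add)

lemma lip_on_diff:
  fixes f g :: "'a::metric_space \<Rightarrow> 'b::real_normed_vector"
  shows "lip_on K f \<Longrightarrow> lip_on K g \<Longrightarrow> lip_on K (\<lambda>x. f x - g x)"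
  unfolding lip_on_def by (blast intro: lipschitz_on_diff)

lemma lip_on_continuous: "lip_on K f \<Longrightarrow> continuous_on K f"
  unfolding lip_on_def by (blast intro: lipschitz_on_continuous_on)

lemma lip_on_linear:
  assumes T: "bounded_linear T" and f: "lip_on K f"
  shows "lip_on K (\<lambda>x. T (f x))"
proof -
  obtain C where C: "C-lipschitz_on K f" using f lip_on_def by blast
  obtain B where B: "B-lipschitz_on (f ` K) T" using bounded_linear.lipschitz_boundE[OF T] by blast
  show ?thesis using lipschitz_on_compose2[OF C B] unfolding lip_on_def by blast
qed

text \<open>The difference splits as \<open>h (f x) (g x - g y) + h (f x - f y) (g y)\<close>.
  Compactness bounds the two undifferenced factors, by \<open>a\<close> and \<open>b\<close>
  below.\<close>

lemma lip_on_bilinear: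
  assumes h: "bounded_bilinear h" and K: "compact K" and f: "lip_on K f" and g: "lip_on K g"
  shows "lip_on K (\<lambda>x. h (f x) (g x))"
proof -
  interpret bounded_bilinear h by fact
  obtain C where C: "C-lipschitz_on K f" using f lip_on_def by blast
  obtain D where D: "D-lipschitz_on K g" using g lip_on_def by blast
  obtain B where B: "B \<ge> 0" "\<And>x y. norm (h x y) \<le> norm x * norm y * B"
    using nonneg_bounded by blast
  have "bounded (f ` K)" "bounded (g ` K)"
    using compact_continuous_image[OF lip_on_continuous K] f g compact_imp_bounded by blast+
  then obtain a b where a: "\<And>x. x \<in> K \<Longrightarrow> norm (f x) \<le> a" and b: "\<And>x. x \<in> K \<Longrightarrow> norm (g x) \<le> b"
    unfolding bounded_iff by auto
  have "((\<bar>a\<bar> * D + C * \<bar>b\<bar>) * B)-lipschitz_on K (\<lambda>x. h (f x) (g x))"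
  proof (rule lipschitz_onI)
    fix x y assume xy: "x \<in> K" "y \<in> K"
    have "h (f x) (g x) - h (f y) (g y) = h (f x) (g x - g y) + h (f x - f y) (g y)"
      by (simp add: diff_left diff_right)
    also have "norm \<dots> \<le> norm (f x) * norm (g x - g y) * B + norm (f x - f y) * norm (g y) * B"
      by (rule norm_triangle_le) (intro add_mono B)
    also have "\<dots> \<le> \<bar>a\<bar> * (D * dist x y) * B + (C * dist x y) * \<bar>b\<bar> * B"
    proof (intro add_mono mult_right_mono mult_mono)
      show "norm (f x) \<le> \<bar>a\<bar>" "norm (g y) \<le> \<bar>b\<bar>" using a[OF xy(1)] b[OF xy(2)] by linarith+
      show "norm (g x - g y) \<le> D * dist x y" "norm (f x - f y) \<le> C * dist x y"
        using lipschitz_onD[OF C xy] lipschitz_onD[OF D xy] by (simp_all add: dist_norm)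
    qed (use B(1) lipschitz_on_nonneg[OF C] in auto)
    finally show "dist (h (f x) (g x)) (h (f y) (g y)) \<le> (\<bar>a\<bar> * D + C * \<bar>b\<bar>) * B * dist x y"
      by (simp add: dist_norm algebra_simps)
  qed (use B(1) lipschitz_on_nonneg[OF C] lipschitz_on_nonneg[OF D] in simp)
  then show ?thesis unfolding lip_on_def by blast
qed

lemma lip_on_sum:
  fixes f :: "'i \<Rightarrow> 'a::metric_space \<Rightarrow> 'b::real_normed_vector"
  shows "(\<And>i. i \<in> I \<Longrightarrow> lip_on K (f i)) \<Longrightarrow> lip_on K (\<lambda>x. \<Sum>i\<in>I. f i x)"
  by (induction I rule: infinite_finite_induct) (auto intro: lip_on_const lip_on_add)

lemma lip_on_id: "lip_on K (\<lambda>x. x)"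
  unfolding lip_on_def by (blast intro: lipschitz_on_id)

lemma lip_on_real_polynomial_function:
  assumes "real_polynomial_function f" "compact K"
  shows "lip_on K f"
  using assms(1)
proof induction
  case (linear f)
  then show ?case using lip_on_linear[OF _ lip_on_id] by blast
qed (auto intro: lip_on_const lip_on_add lip_on_bilinear[OF bounded_bilinear_mult assms(2)])

lemma lip_on_vpoly_space:
  assumes f: "f \<in> vpoly_space k" and K: "compact K"
  shows "lip_on K f"
proof -
  have "lip_on K (\<lambda>x. f x \<bullet> b)" if "b \<in> Basis" for b
    using f that unfolding vpoly_space_def
    by (intro lip_on_real_polynomial_function[OF _ K] real_polynomial_function_poly_space[of _ k]) simp
  then have "lip_on K (\<lambda>x. \<Sum>b\<in>Basis. (f x \<bullet> b) *\<^sub>R b)"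
    by (intro lip_on_sum lip_on_linear[OF bounded_linear_scaleR_left])
  then show ?thesis by (simp only: euclidean_representation)
qed

text \<open>Projection onto a closed convex set does not increase distances, so this extension keeps
  both the Lipschitz constant and the range of \<open>F\<close>; the range matters for bounds in the
  supremum norm.\<close>

lemma lipschitz_extension_closest_point:
  fixes F :: "'a::euclidean_space \<Rightarrow> 'b::metric_space"
  assumes F: "C-lipschitz_on K F" and K: "convex K" "closed K" "K \<noteq> {}"
  shows "C-lipschitz_on UNIV (\<lambda>x. F (closest_point K x))"
proof (rule lipschitz_onI)
  fix x y :: 'a
  have "dist (F (closest_point K x)) (F (closest_point K y)) \<le> C * dist (closest_point K x) (closest_point K y)"
    using K by (intro lipschitz_onD[OF F] closest_point_in_set)
  also have "\<dots> \<le> C * dist x y"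
    using closest_point_lipschitz[OF K] lipschitz_on_nonneg[OF F] by (intro mult_left_mono)
  finally show "dist (F (closest_point K x)) (F (closest_point K y)) \<le> C * dist x y" .
qed (rule lipschitz_on_nonneg[OF F])

section \<open>Partial derivatives almost everywhere\<close>

text \<open>Only differentiability along the axes is asked for. This is what the argument on lines
  delivers, and it suffices for the product rule in each \<open>pdv j\<close>.\<close>

definition has_pdv :: "((real^'n) \<Rightarrow> 'a::euclidean_space) \<Rightarrow> real^'n \<Rightarrow> bool" where
  "has_pdv f x \<longleftrightarrow> (\<forall>j. ((\<lambda>t. f (x + t *\<^sub>R axis j 1)) has_vector_derivative pdv j f x) (at 0))"

lemma pdv_eqI:
  fixes f :: "real^'n \<Rightarrow> 'a::euclidean_space"
  assumes "((\<lambda>t. f (x + t *\<^sub>R axis j 1)) has_vector_derivative D) (at 0)"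
  shows "pdv j f x = D"
proof (rule euclidean_eqI)
  fix b :: 'a assume b: "b \<in> Basis"
  have "((\<lambda>t. f (x + t *\<^sub>R axis j 1) \<bullet> b) has_vector_derivative D \<bullet> b) (at 0)"
    by (rule bounded_linear.has_vector_derivative[OF bounded_linear_inner_left assms])
  then show "pdv j f x \<bullet> b = D \<bullet> b"
    using pd_eqI b by (auto simp: pdv_inner_Basis)
qed

lemma has_pdv_iff_components:
  fixes f :: "real^'n \<Rightarrow> 'a::euclidean_space"
  shows "has_pdv f x \<longleftrightarrow> (\<forall>b\<in>Basis. has_pdv (\<lambda>y. f y \<bullet> b) x)"
proof safe
  fix b :: 'a assume b: "b \<in> Basis" and f: "has_pdv f x"
  show "has_pdv (\<lambda>y. f y \<bullet> b) x"
    unfolding has_pdv_def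
  proof
    fix j
    have "((\<lambda>t. f (x + t *\<^sub>R axis j 1) \<bullet> b) has_vector_derivative pdv j f x \<bullet> b) (at 0)"
      using f unfolding has_pdv_def
      by (intro bounded_linear.has_vector_derivative[OF bounded_linear_inner_left]) blast
    then show "((\<lambda>t. f (x + t *\<^sub>R axis j 1) \<bullet> b) has_vector_derivative pdv j (\<lambda>y. f y \<bullet> b) x) (at 0)"
      using pdv_eqI[of "\<lambda>y. f y \<bullet> b" x j] by simp
  qed
next
  assume *: "\<forall>b\<in>Basis. has_pdv (\<lambda>y. f y \<bullet> b) x"
  show "has_pdv f x"
    unfolding has_pdv_def
  proof
    fix j
    have "((\<lambda>t. \<Sum>b\<in>Basis. (f (x + t *\<^sub>R axis j 1) \<bullet> b) *\<^sub>R b) has_vector_derivative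
        (\<Sum>b\<in>Basis. pdv j (\<lambda>y. f y \<bullet> b) x *\<^sub>R b)) (at 0)"
      using * unfolding has_pdv_def
      by (intro has_vector_derivative_sum bounded_linear.has_vector_derivative[OF bounded_linear_scaleR_left]) blast
    then show "((\<lambda>t. f (x + t *\<^sub>R axis j 1)) has_vector_derivative pdv j f x) (at 0)"
      by (simp only: euclidean_representation pdv_def[of j f] pdv_real)
  qed
qed

lemma has_pdv_vpoly_space:
  assumes "f \<in> vpoly_space k"
  shows "has_pdv f x"
  unfolding has_pdv_iff_components[of f]
proof
  fix b :: 'b assume "b \<in> Basis"
  then have "(\<lambda>y. f y \<bullet> b) \<in> poly_space k" using assms by (simp add: vpoly_space_def)
  then show "has_pdv (\<lambda>y. f y \<bullet> b) x"
    unfolding has_pdv_def pdv_real by (intro allI poly_space_has_pd)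
qed

lemma pdv_linear:
  assumes T: "bounded_linear T" and f: "has_pdv f x"
  shows "pdv j (\<lambda>y. T (f y)) x = T (pdv j f x)"
  using f unfolding has_pdv_def
  by (intro pdv_eqI bounded_linear.has_vector_derivative[OF T]) blast

lemma pdv_add:
  assumes "has_pdv f x" "has_pdv g x"
  shows "pdv j (\<lambda>y. f y + g y) x = pdv j f x + pdv j g x"
  using assms unfolding has_pdv_def by (intro pdv_eqI has_vector_derivative_add) blast+

lemma pdv_diff:
  assumes "has_pdv f x" "has_pdv g x"
  shows "pdv j (\<lambda>y. f y - g y) x = pdv j f x - pdv j g x"
  using assms unfolding has_pdv_def by (intro pdv_eqI has_vector_derivative_diff) blast+

lemma has_vector_derivative_bilinear_line:
  assumes h: "bounded_bilinear h" and f: "has_pdv f x" and g: "has_pdv g x"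
  shows "((\<lambda>t. h (f (x + t *\<^sub>R axis j 1)) (g (x + t *\<^sub>R axis j 1))) has_vector_derivative
    h (f x) (pdv j g x) + h (pdv j f x) (g x)) (at 0)"
  using bounded_bilinear.has_vector_derivative[OF h, of "\<lambda>t. f (x + t *\<^sub>R axis j 1)" _ 0 UNIV "\<lambda>t. g (x + t *\<^sub>R axis j 1)"]
    f g unfolding has_pdv_def by simp

lemma pdv_bilinear:
  assumes h: "bounded_bilinear h" and f: "has_pdv f x" and g: "has_pdv g x"
  shows "pdv j (\<lambda>y. h (f y) (g y)) x = h (f x) (pdv j g x) + h (pdv j f x) (g x)"
  by (rule pdv_eqI) (rule has_vector_derivative_bilinear_line[OF assms])

lemma has_pdv_linear:
  assumes T: "bounded_linear T" and f: "has_pdv f x"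
  shows "has_pdv (\<lambda>y. T (f y)) x"
  unfolding has_pdv_def pdv_linear[OF assms]
  using f bounded_linear.has_vector_derivative[OF T] unfolding has_pdv_def by blast

text \<open>Outside \<open>K\<close> the values of \<open>f\<close> are arbitrary, so
  differentiability on the whole space is applied to the extension by projection. Near an interior
  point both functions agree, and the frontier of a convex set is null.\<close>

lemma AE_lip_on_has_pdv:
  fixes f :: "real^'n \<Rightarrow> 'a::euclidean_space"
  assumes f: "lip_on K f" and K: "convex K" "closed K"
  shows "AE x in lebesgue. x \<in> K \<longrightarrow> has_pdv f x"
proof (cases "K = {}")
  case False
  have "AE x in lebesgue. x \<in> K \<longrightarrow> has_pdv (\<lambda>y. f y \<bullet> b) x" if b: "b \<in> Basis" for b
  proof -
    obtain C where C: "C-lipschitz_on K (\<lambda>y. f y \<bullet> b)"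
      using lip_on_linear[OF bounded_linear_inner_left f] unfolding lip_on_def by blast
    let ?F = "\<lambda>x. f (closest_point K x) \<bullet> b"
    have "C-lipschitz_on UNIV ?F"
      using lipschitz_extension_closest_point[OF C K False] .
    then have "AE x in lborel. \<exists>D. ((\<lambda>t. ?F (x + t *\<^sub>R axis j 1)) has_vector_derivative D) (at 0)" for j
      by (rule AE_lipschitz_directional_derivative)
    then have "AE x in lebesgue. \<exists>D. ((\<lambda>t. ?F (x + t *\<^sub>R axis j 1)) has_vector_derivative D) (at 0)" for j
      by (rule AE_completion)
    then have "AE x in lebesgue. \<forall>j\<in>UNIV. \<exists>D. ((\<lambda>t. ?F (x + t *\<^sub>R axis j 1)) has_vector_derivative D) (at 0)"
      by (intro AE_finite_allI) auto
    moreover have "AE x in lebesgue. x \<notin> frontier K"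
      using negligible_convex_frontier[OF K(1)] by (intro AE_not_in) (simp add: negligible_iff_null_sets)
    ultimately show ?thesis
    proof eventually_elim
      case (elim x)
      show ?case
      proof
        assume "x \<in> K"
        then have "x \<in> interior K" using elim closure_subset[of K] by (auto simp: frontier_def)
        then obtain e where e: "e > 0" "ball x e \<subseteq> K" using mem_interior by blast
        show "has_pdv (\<lambda>y. f y \<bullet> b) x"
          unfolding has_pdv_def
        proof
          fix j
          obtain D where D: "((\<lambda>t. ?F (x + t *\<^sub>R axis j 1)) has_vector_derivative D) (at 0)"
            using elim by blast
          have "((\<lambda>t. f (x + t *\<^sub>R axis j 1) \<bullet> b) has_vector_derivative D) (at 0)"
          proof (rule has_vector_derivative_transform_within[OF D e(1)])
            fix t :: real assume "dist t 0 < e"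
            then have "x + t *\<^sub>R axis j 1 \<in> ball x e" by (simp add: dist_norm norm_axis_1)
            then show "?F (x + t *\<^sub>R axis j 1) = f (x + t *\<^sub>R axis j 1) \<bullet> b"
              using e(2) by (simp add: subset_iff closest_point_self)
          qed simp
          then show "((\<lambda>t. f (x + t *\<^sub>R axis j 1) \<bullet> b) has_vector_derivative pdv j (\<lambda>y. f y \<bullet> b) x) (at 0)"
            using pdv_eqI[of "\<lambda>y. f y \<bullet> b" x j D] by simp
        qed
      qed
    qed
  qed
  then have "AE x in lebesgue. \<forall>b\<in>Basis. x \<in> K \<longrightarrow> has_pdv (\<lambda>y. f y \<bullet> b) x"
    by (intro AE_finite_allI) auto
  then show ?thesis unfolding has_pdv_iff_components[of f] by eventually_elim blast
qed simp

section \<open>Integral of a partial derivative, bounded by the supremum norm\<close>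

text \<open>A convex function lies below its chord; \<open>2 ^ n - 1\<close> is the slope of the
  chord from \<open>t = 0\<close> to \<open>t = 1\<close>. It makes the growth of volume under
  dilation linear in \<open>t\<close>.\<close>

lemma one_add_power_le:
  fixes t :: real
  assumes "0 \<le> t" "t \<le> 1"
  shows "(1 + t) ^ n \<le> 1 + (2 ^ n - 1) * t"
proof (induction n)
  case (Suc n)
  have "(1 + t) ^ Suc n \<le> (1 + t) * (1 + (2 ^ n - 1) * t)"
    using Suc assms by (simp add: mult_left_mono)
  also have "\<dots> = 1 + 2 ^ n * t + (2 ^ n - 1) * (t * t)" by (simp add: algebra_simps)
  also have "\<dots> \<le> 1 + 2 ^ n * t + (2 ^ n - 1) * t"
    using assms by (intro add_left_mono mult_left_mono) (auto simp: mult_left_le one_le_power)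
  finally show ?case by (simp add: algebra_simps)
qed simp

text \<open>After a change of variables the two integrals differ only on the symmetric difference of
  \<open>K\<close> and its translate. Both sets lie in the dilation of \<open>K\<close> about
  \<open>c\<close> by the factor \<open>1 + t\<close>, so this difference has volume at most
  \<open>2 ((1 + t)^d - 1) |K|\<close>. Only the bound \<open>s\<close> on \<open>F\<close> enters,
  not its modulus of continuity.\<close>

lemma integral_translated_convex_diff_bound:
  fixes K :: "'a::euclidean_space set" and F :: "'a \<Rightarrow> real"
  assumes K: "compact K" "convex K" and ball: "cball c r \<subseteq> K" "0 < r"
    and F: "continuous_on UNIV F" "\<And>x. \<bar>F x\<bar> \<le> s" and e: "norm e = 1" and t: "0 \<le> t" "t \<le> 1"
  shows "\<bar>\<integral>x. indicator K x * (F (x + (t * r) *\<^sub>R e) - F x) \<partial>lborel\<bar> \<le> s * (2 * (2 ^ DIM('a) - 1) * measure lborel K) * t"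
proof -
  define v where "v = (t * r) *\<^sub>R e"
  define T where "T = (\<lambda>x. (1 + t) *\<^sub>R x + (- t *\<^sub>R c)) ` K"
  define K' where "K' = (\<lambda>x. v + x) ` K"
  have s: "0 \<le> s" using F(2)[of undefined] by linarith
  have nz: "1 + t \<noteq> 0" using t by simp
  have tt: "(1 + t) * (1 / (1 + t)) = 1" "(1 + t) * (t / (1 + t)) = t"
    "0 \<le> 1 / (1 + t)" "0 \<le> t / (1 + t)" "1 / (1 + t) + t / (1 + t) = 1"
    using t by (simp_all add: add_divide_distrib[symmetric])
  have inT: "x \<in> T" if "z \<in> K" "x = (1 + t) *\<^sub>R z - t *\<^sub>R c" for x z
    using that unfolding T_def by auto
  have KT: "K \<subseteq> T"
  proof
    fix x assume x: "x \<in> K"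
    have "c \<in> K" using ball by auto
    \<comment> \<open>The point of \<open>K\<close> whose dilate is \<open>x\<close>: a convex
      combination of \<open>x\<close> and the fixed point \<open>c\<close>.\<close>
    then have "(1 / (1 + t)) *\<^sub>R x + (t / (1 + t)) *\<^sub>R c \<in> K"
      using x tt by (intro convexD[OF K(2)])
    then show "x \<in> T" by (rule inT) (simp only: scaleR_add_right scaleR_scaleR tt scaleR_one add_diff_cancel)
  qed
  have KT': "K' \<subseteq> T"
  proof
    fix y assume "y \<in> K'"
    then obtain x where x: "x \<in> K" "y = v + x" unfolding K'_def by auto
    have "c + r *\<^sub>R e \<in> K" using ball e by (intro subsetD[OF ball(1)]) (simp add: dist_norm)
    \<comment> \<open>The translate \<open>x + t r e\<close> is the dilate of a convex combination
      of \<open>x\<close> and \<open>c + r e\<close>; the inner ball guarantees that the latter lies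
      in \<open>K\<close>.\<close>
    then have "(1 / (1 + t)) *\<^sub>R x + (t / (1 + t)) *\<^sub>R (c + r *\<^sub>R e) \<in> K"
      using x tt by (intro convexD[OF K(2)])
    then show "y \<in> T"
      by (rule inT) (simp only: scaleR_add_right scaleR_scaleR tt scaleR_one x v_def, use nz in simp)
  qed
  have cT: "compact T" unfolding T_def by (intro compact_continuous_image K continuous_intros)
  have cK': "compact K'" unfolding K'_def by (intro compact_continuous_image K continuous_intros)
  have meas: "K \<in> sets borel" "K' \<in> sets borel" "T \<in> sets borel"
    using K cK' cT by (auto intro: borel_compact)
  have int: "integrable lborel (\<lambda>x. indicator S x * F x)" "integrable lborel (indicat_real S)" if "compact S" for S
  proof -
    show "integrable lborel (\<lambda>x. indicator S x * F x)"
      using borel_integrable_compact[OF that continuous_on_subset[OF F(1)]] by (simp add: mult.commute)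
    show "integrable lborel (indicat_real S)"
      using borel_integrable_compact[OF that, of "\<lambda>_. 1 :: real"] by simp
  qed
  have mT: "measure lborel T = (1 + t) ^ DIM('a) * measure lborel K"
    using measure_lebesgue_affine[of "1 + t" "- t *\<^sub>R c" K] t meas by (simp add: T_def)
  have mK': "measure lborel K' = measure lborel K"
    using measure_translation[of v K] meas by (simp add: K'_def)
  have indK': "indicat_real K' (v + x) = indicator K x" for x
    unfolding K'_def indicator_def by auto
  have Fm: "F \<in> borel_measurable borel" using F(1) by (rule borel_measurable_continuous_onI)
  have shift: "integrable lborel (\<lambda>x. indicator K x * F (x + v))"
    "(\<integral>x. indicator K' x * F x \<partial>lborel) = (\<integral>x. indicator K x * F (x + v) \<partial>lborel)"
  proof -
    have "integrable (distr lborel borel ((+) v)) (\<lambda>x. indicator K' x * F x)"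
      using int(1)[OF cK'] by (simp add: lborel_distr_plus)
    then show "integrable lborel (\<lambda>x. indicator K x * F (x + v))"
      by (subst (asm) integrable_distr_eq) (use meas Fm indK' in \<open>auto simp: add.commute\<close>)
    have "(\<integral>x. indicator K' x * F x \<partial>lborel) = (\<integral>x. indicator K' x * F x \<partial>distr lborel borel ((+) v))"
      by (simp add: lborel_distr_plus)
    also have "\<dots> = (\<integral>x. indicator K x * F (x + v) \<partial>lborel)"
      by (subst integral_distr) (use meas Fm indK' in \<open>auto simp: add.commute\<close>)
    finally show "(\<integral>x. indicator K' x * F x \<partial>lborel) = (\<integral>x. indicator K x * F (x + v) \<partial>lborel)" .
  qed
  have "(\<integral>x. indicator K x * (F (x + v) - F x) \<partial>lborel) =
      (\<integral>x. indicator K' x * F x \<partial>lborel) - (\<integral>x. indicator K x * F x \<partial>lborel)"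
    unfolding shift(2) using shift(1) int(1)[OF K(1)] by (simp add: right_diff_distrib)
  also have "\<dots> = (\<integral>x. indicator K' x * F x - indicator K x * F x \<partial>lborel)"
    using int(1)[OF K(1)] int(1)[OF cK'] by simp
  also have "\<bar>\<dots>\<bar> \<le> (\<integral>x. s * ((indicator T x - indicator K' x) + (indicator T x - indicator K x)) \<partial>lborel)"
  proof (rule integral_abs_bound[THEN order_trans], rule integral_mono)
    fix x
    have "\<bar>indicator K' x * F x - indicator K x * F x\<bar> = \<bar>indicator K' x - indicator K x\<bar> * \<bar>F x\<bar>"
      by (simp add: left_diff_distrib[symmetric] abs_mult)
    also have "\<dots> \<le> \<bar>indicator K' x - indicator K x\<bar> * s"
      using F(2) by (intro mult_left_mono) auto
    also have "\<dots> \<le> ((indicator T x - indicator K' x) + (indicator T x - indicator K x)) * s"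
      using KT KT' s by (intro mult_right_mono) (auto simp: indicator_def)
    finally show "\<bar>indicator K' x * F x - indicator K x * F x\<bar> \<le>
      s * ((indicator T x - indicator K' x) + (indicator T x - indicator K x))" by (simp add: mult.commute)
  qed (use int K cK' cT in auto)
  also have "\<dots> = s * (2 * ((1 + t) ^ DIM('a) - 1) * measure lborel K)"
    using int(2)[OF K(1)] int(2)[OF cK'] int(2)[OF cT] mT mK' by (simp add: algebra_simps)
  also have "\<dots> \<le> s * (2 * ((2 ^ DIM('a) - 1) * t) * measure lborel K)"
    using one_add_power_le[OF t, of "DIM('a)"] s
    by (intro mult_left_mono mult_right_mono) auto
  finally show ?thesis by (simp add: v_def mult_ac)
qed

text \<open>Difference quotients are dominated by the Lipschitz constant, which gives convergence of
  their integrals. The final estimate comes instead from the translation bound and depends on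
  \<open>F\<close> only through \<open>s\<close>, so it survives uniform approximation.\<close>

lemma set_integrable_pd_and_bound:
  fixes K :: "(real^'n) set" and F :: "real^'n \<Rightarrow> real"
  assumes K: "compact K" "convex K" and ball: "cball c r \<subseteq> K" "0 < r"
    and F: "lip_on K F" and s: "\<And>x. x \<in> K \<Longrightarrow> \<bar>F x\<bar> \<le> s"
  shows "set_integrable lebesgue K (pd j F)"
    and "\<bar>vint K (pd j F)\<bar> \<le> s * (2 * (2 ^ CARD('n) - 1) * measure lborel K / r)"
proof -
  let ?e = "axis j 1 :: real^'n"
  have ne: "K \<noteq> {}" using ball by auto
  obtain C where C: "C-lipschitz_on K F" using F lip_on_def by blast
  define G where "G x = F (closest_point K x)" for x
  have lipG: "C-lipschitz_on UNIV G"
    unfolding G_def using lipschitz_extension_closest_point[OF C K(2) compact_imp_closed[OF K(1)] ne] .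
  have contG: "continuous_on UNIV G" using lipG by (rule lipschitz_on_continuous_on)
  have Gs: "\<bar>G x\<bar> \<le> s" for x
    unfolding G_def using s closest_point_in_set[OF compact_imp_closed[OF K(1)] ne] by blast
  have Gm[measurable]: "G \<in> borel_measurable borel" using contG by (rule borel_measurable_continuous_onI)
  have Km[measurable]: "K \<in> sets borel" using K by (auto intro: borel_compact)
  \<comment> \<open>The step is \<open>r / (n + 1)\<close>, which corresponds to
    \<open>t = 1 / (n + 1)\<close> in the translation bound and respects its restriction
    \<open>t \<le> 1\<close>.\<close>
  define h :: "nat \<Rightarrow> real" where "h n = inverse (real (Suc n)) * r" for n
  have h: "h n > 0" "h n \<noteq> 0" for n unfolding h_def using ball(2) by auto
  \<comment> \<open>The quotient uses the extension \<open>G\<close>, because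
    \<open>x + h n e\<close> may leave \<open>K\<close>.\<close>
  define q where "q n x = indicator K x * ((G (x + h n *\<^sub>R ?e) - G x) / h n)" for n x
  have qm: "q n \<in> borel_measurable borel" for n unfolding q_def by measurable
  have qm': "q n \<in> borel_measurable lebesgue" for n using qm[of n] by (simp add: measurable_completion)
  have h0: "h \<longlonglongrightarrow> 0"
    unfolding h_def using tendsto_mult_right[OF LIMSEQ_inverse_real_of_nat, of r] by simp
  have lim: "AE x in lebesgue. (\<lambda>n. q n x) \<longlonglongrightarrow> indicator K x * pd j F x"
  proof -
    have "AE x in lebesgue. x \<in> K \<longrightarrow> has_pdv F x"
      using AE_lip_on_has_pdv[OF F K(2) compact_imp_closed[OF K(1)]] .
    moreover have "AE x in lebesgue. x \<notin> frontier K"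
      using negligible_convex_frontier[OF K(2)] by (intro AE_not_in) (simp add: negligible_iff_null_sets)
    ultimately show ?thesis
    proof eventually_elim
      case (elim x)
      show ?case
      proof (cases "x \<in> K")
        case True
        then have "x \<in> interior K" using elim closure_subset[of K] by (auto simp: frontier_def)
        then obtain d where d: "d > 0" "ball x d \<subseteq> K" using mem_interior by blast
        have "((\<lambda>t. F (x + t *\<^sub>R ?e)) has_real_derivative pd j F x) (at 0)"
          using elim True by (auto simp: has_pdv_def has_real_derivative_iff_has_vector_derivative)
        then have "((\<lambda>t. (F (x + t *\<^sub>R ?e) - F x) / t) \<longlongrightarrow> pd j F x) (at 0)"
          by (simp add: DERIV_def)
        moreover have "filterlim h (at 0) sequentially"
          using h0 h by (simp add: filterlim_at)
        ultimately have "(\<lambda>n. (F (x + h n *\<^sub>R ?e) - F x) / h n) \<longlonglongrightarrow> pd j F x"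
          by (rule filterlim_compose)
        moreover have "eventually (\<lambda>n. (F (x + h n *\<^sub>R ?e) - F x) / h n = q n x) sequentially"
        proof -
          have "eventually (\<lambda>n. h n < d) sequentially"
            using order_tendstoD(2)[OF h0 d(1)] .
          then show ?thesis
          proof eventually_elim
            case (elim n)
            then have "x + h n *\<^sub>R ?e \<in> ball x d" using h[of n] by (simp add: dist_norm norm_axis_1)
            then show ?case using d(2) True by (simp add: q_def G_def subset_iff closest_point_self)
          qed
        qed
        ultimately show ?thesis using True by (simp add: Lim_transform_eventually)
      qed (simp add: q_def)
    qed
  qed
  \<comment> \<open>For the complete Lebesgue measure an almost everywhere limit of measurable
    quotients is measurable.\<close>
  have mlim: "(\<lambda>x. indicator K x * pd j F x) \<in> borel_measurable lebesgue"
  proof (rule borel_measurable_AE)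
    show "(\<lambda>x. lim (\<lambda>n. q n x)) \<in> borel_measurable lebesgue"
      using qm' by (rule borel_measurable_lim_metric)
    show "AE x in lebesgue. lim (\<lambda>n. q n x) = indicator K x * pd j F x"
      using lim by eventually_elim (rule limI)
  qed
  have bnd: "norm (q n x) \<le> indicator K x * C" for n x
  proof -
    have "\<bar>G (x + h n *\<^sub>R ?e) - G x\<bar> \<le> C * h n"
      using lipschitz_onD[OF lipG, of "x + h n *\<^sub>R ?e" x] h[of n] by (simp add: dist_norm norm_axis_1)
    then show ?thesis using h[of n] by (auto simp: q_def indicator_def pos_divide_le_eq)
  qed
  have bnd': "AE x in lebesgue. norm (q n x) \<le> indicator K x * C" for n using bnd by simp
  have dom: "integrable lebesgue (\<lambda>x. indicator K x * C)"
    using borel_integrable_compact[OF K(1), of "\<lambda>_. C"] by (simp add: integrable_completion mult.commute)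
  have int: "integrable lebesgue (\<lambda>x. indicator K x * pd j F x)"
    and conv: "(\<lambda>n. \<integral>x. q n x \<partial>lebesgue) \<longlonglongrightarrow> (\<integral>x. indicator K x * pd j F x \<partial>lebesgue)"
    using integrable_dominated_convergence[OF mlim qm' dom lim bnd'] integral_dominated_convergence[OF mlim qm' dom lim bnd']
    by simp_all
  show "set_integrable lebesgue K (pd j F)" using int by (simp add: set_integrable_def)
  have "\<bar>\<integral>x. q n x \<partial>lebesgue\<bar> \<le> s * (2 * (2 ^ CARD('n) - 1) * measure lborel K / r)" for n
  proof -
    have "\<bar>\<integral>x. indicator K x * (G (x + h n *\<^sub>R ?e) - G x) \<partial>lborel\<bar> \<le>
        s * (2 * (2 ^ CARD('n) - 1) * measure lborel K) * inverse (real (Suc n))"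
      using integral_translated_convex_diff_bound[OF K ball contG Gs, of ?e "inverse (real (Suc n))"]
      by (simp add: h_def norm_axis_1 inverse_le_1_iff)
    then have "\<bar>\<integral>x. indicator K x * (G (x + h n *\<^sub>R ?e) - G x) \<partial>lborel\<bar> / h n \<le>
        s * (2 * (2 ^ CARD('n) - 1) * measure lborel K) * inverse (real (Suc n)) / h n"
      using h(1)[of n] by (intro divide_right_mono) auto
    also have "\<dots> = s * (2 * (2 ^ CARD('n) - 1) * measure lborel K / r)"
      unfolding h_def by (simp add: divide_inverse mult_ac)
    finally have "\<bar>\<integral>x. indicator K x * (G (x + h n *\<^sub>R ?e) - G x) \<partial>lborel\<bar> / h n \<le>
        s * (2 * (2 ^ CARD('n) - 1) * measure lborel K / r)" .
    moreover have "(\<integral>x. q n x \<partial>lebesgue) = (\<integral>x. indicator K x * (G (x + h n *\<^sub>R ?e) - G x) \<partial>lborel) / h n"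
      using integral_completion[OF qm[of n, folded measurable_lborel2]] unfolding q_def by simp
    ultimately show ?thesis using h[of n] by (simp add: abs_divide)
  qed
  then have "\<bar>\<integral>x. indicator K x * pd j F x \<partial>lebesgue\<bar> \<le> s * (2 * (2 ^ CARD('n) - 1) * measure lborel K / r)"
    using conv by (intro LIMSEQ_le_const2[OF tendsto_rabs[OF conv]]) auto
  then show "\<bar>vint K (pd j F)\<bar> \<le> s * (2 * (2 ^ CARD('n) - 1) * measure lborel K / r)"
    by (simp add: vint_def set_lebesgue_integral_def)
qed

section \<open>Integrals over a compact convex set\<close>

lemma set_integrable_mult_continuous:
  fixes f g :: "'a::euclidean_space \<Rightarrow> real"
  assumes f: "set_integrable lebesgue K f" and K: "compact K" and g: "continuous_on K g"
  shows "set_integrable lebesgue K (\<lambda>x. f x * g x)"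
proof -
  obtain B where B: "\<And>x. x \<in> K \<Longrightarrow> \<bar>g x\<bar> \<le> B"
    using compact_imp_bounded[OF compact_continuous_image[OF g K]] by (auto simp: bounded_iff)
  have "integrable lebesgue (\<lambda>x. \<bar>B\<bar> * (indicator K x * f x))"
    using f by (intro integrable_mult_right) (simp add: set_integrable_def)
  moreover have "(\<lambda>x. indicator K x * f x) \<in> borel_measurable lebesgue"
    using f by (auto simp: set_integrable_def)
  moreover have "(\<lambda>x. indicator K x * g x) \<in> borel_measurable lebesgue"
    using borel_measurable_continuous_on_indicator[OF borel_compact[OF K] g]
    by (simp add: measurable_completion)
  ultimately have "integrable lebesgue (\<lambda>x. (indicator K x * f x) * (indicator K x * g x))"
  proof (elim Bochner_Integration.integrable_bound)
    assume "(\<lambda>x. indicator K x * f x) \<in> borel_measurable lebesgue" "(\<lambda>x. indicator K x * g x) \<in> borel_measurable lebesgue"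
    then show "(\<lambda>x. (indicator K x * f x) * (indicator K x * g x)) \<in> borel_measurable lebesgue"
      by (rule borel_measurable_times)
    show "AE x in lebesgue. norm ((indicator K x * f x) * (indicator K x * g x)) \<le> norm (\<bar>B\<bar> * (indicator K x * f x))"
    proof (rule AE_I2)
      fix x
      have "x \<in> K \<Longrightarrow> \<bar>f x\<bar> * \<bar>g x\<bar> \<le> \<bar>f x\<bar> * \<bar>B\<bar>"
        using B[of x] by (intro mult_left_mono) auto
      then show "norm ((indicator K x * f x) * (indicator K x * g x)) \<le> norm (\<bar>B\<bar> * (indicator K x * f x))"
        by (auto simp: indicator_def abs_mult mult.commute)
    qed
  qed
  moreover have "(\<lambda>x. (indicator K x * f x) * (indicator K x * g x)) = (\<lambda>x. indicator K x *\<^sub>R (f x * g x))"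
    by (auto simp: indicator_def)
  ultimately show ?thesis unfolding set_integrable_def by simp
qed

lemma set_integrable_lborel_continuous:
  fixes f :: "'a::euclidean_space \<Rightarrow> real"
  shows "compact K \<Longrightarrow> continuous_on K f \<Longrightarrow> set_integrable lborel K f"
  unfolding set_integrable_def using borel_integrable_compact[of K f] by (simp add: indicator_times_eq_if)

lemma set_integrable_continuous:
  fixes f :: "'a::euclidean_space \<Rightarrow> real"
  assumes "compact K" "continuous_on K f"
  shows "set_integrable lebesgue K f"
  using set_integrable_lborel_continuous[OF assms] unfolding set_integrable_def
  by (subst integrable_completion) auto

lemma vint_cong_AE:
  assumes f: "set_integrable lebesgue K f" and eq: "AE x in lebesgue. x \<in> K \<longrightarrow> f x = g x"
  shows "set_integrable lebesgue K g" "vint K f = vint K g"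
proof -
  have eq': "AE x in lebesgue. indicator K x *\<^sub>R f x = indicator K x *\<^sub>R g x"
    using eq by eventually_elim (auto simp: indicator_def)
  have g: "(\<lambda>x. indicator K x *\<^sub>R g x) \<in> borel_measurable lebesgue"
    using f by (intro borel_measurable_AE[OF _ eq']) (auto simp: set_integrable_def)
  show "set_integrable lebesgue K g"
    using f integrable_cong_AE_imp[OF _ g eq'] unfolding set_integrable_def by simp
  show "vint K f = vint K g"
    unfolding vint_def set_lebesgue_integral_def
    using f by (intro integral_cong_AE g eq') (auto simp: set_integrable_def)
qed

lemma vint_add: "set_integrable lebesgue K f \<Longrightarrow> set_integrable lebesgue K g \<Longrightarrow>
    vint K (\<lambda>x. f x + g x) = vint K f + vint K g"
  unfolding vint_def by (rule set_integral_add)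

lemma vint_diff: "set_integrable lebesgue K f \<Longrightarrow> set_integrable lebesgue K g \<Longrightarrow>
    vint K (\<lambda>x. f x - g x) = vint K f - vint K g"
  unfolding vint_def by (rule set_integral_diff)

lemma vint_cmul: "vint K (\<lambda>x. c * f x) = c * vint K f"
  unfolding vint_def by (rule set_integral_mult_right)

lemma vint_minus: "vint K (\<lambda>x. - f x) = - vint K f"
  using vint_cmul[of K "-1" f] by simp

lemma vint_zero [simp]: "vint K (\<lambda>x. 0) = 0"
  by (simp add: vint_def)

lemma set_integrable_sum:
  fixes f :: "'i \<Rightarrow> 'a \<Rightarrow> real"
  shows "(\<And>i. i \<in> I \<Longrightarrow> set_integrable M K (f i)) \<Longrightarrow> set_integrable M K (\<lambda>x. \<Sum>i\<in>I. f i x)"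
  unfolding set_integrable_def by (simp add: sum_distrib_left)

lemma vint_sum:
  assumes "\<And>i. i \<in> I \<Longrightarrow> set_integrable lebesgue K (f i)"
  shows "vint K (\<lambda>x. \<Sum>i\<in>I. f i x) = (\<Sum>i\<in>I. vint K (f i))"
  using assms by (induction I rule: infinite_finite_induct) (auto simp: vint_add set_integrable_sum)

lemma vint_cong: "(\<And>x. x \<in> K \<Longrightarrow> f x = g x) \<Longrightarrow> vint K f = vint K g"
  unfolding vint_def set_lebesgue_integral_def
  by (intro Bochner_Integration.integral_cong) (auto simp: indicator_def)

lemma vint_eq_lborel:
  assumes "compact K" "continuous_on K f"
  shows "vint K f = (LINT x:K|lborel. f x)"
  unfolding vint_def set_lebesgue_integral_def
  using borel_measurable_continuous_on_indicator[OF borel_compact[OF assms(1)] assms(2)]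
  by (intro integral_completion) simp

text \<open>A nonnegative function with zero integral vanishes almost everywhere. Were it nonzero at
  an interior point, continuity would give a nonempty open set of such points, which is not null.
  The remaining points are limits of interior ones, as \<open>T\<close> is closed and convex with
  nonempty interior.\<close>

lemma zero_of_set_integral_zero:
  fixes f :: "'a::euclidean_space \<Rightarrow> real"
  assumes T: "compact T" "convex T" "interior T \<noteq> {}" and f: "continuous_on T f" "\<And>x. x \<in> T \<Longrightarrow> 0 \<le> f x"
    and zero: "(LINT x:T|lborel. f x) = 0" and x: "x \<in> T"
  shows "f x = 0"
proof -
  have int: "integrable lborel (\<lambda>x. indicator T x * f x)"
    using set_integrable_lborel_continuous[OF T(1) f(1)] by (simp add: set_integrable_def)
  have "AE x in lborel. indicator T x * f x = 0"
    using zero f(2) by (subst integral_nonneg_eq_0_iff_AE[OF int, symmetric])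
      (auto simp: set_lebesgue_integral_def indicator_def)
  then have ae: "AE x in lebesgue. indicator T x * f x = 0" by (rule AE_completion)
  have "f y = 0" if y: "y \<in> interior T" for y
  proof (rule ccontr)
    assume ny: "f y \<noteq> 0"
    have "continuous_on (interior T) f" using f(1) interior_subset continuous_on_subset by blast
    then have "open (interior T \<inter> f -` (-{0}))"
      by (intro continuous_open_preimage) auto
    moreover have "negligible (interior T \<inter> f -` (-{0}))"
    proof -
      obtain N where N: "{x \<in> space lebesgue. indicator T x * f x \<noteq> 0} \<subseteq> N" "N \<in> null_sets lebesgue"
        using ae by (rule AE_E3) blast
      then have "negligible N" by (simp add: negligible_iff_null_sets)
      then have "negligible {x. indicator T x * f x \<noteq> 0}"
        by (rule negligible_subset) (use N(1) in simp)
      then show ?thesis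
        by (rule negligible_subset) (use interior_subset[of T] in \<open>auto simp: indicator_def\<close>)
    qed
    moreover have "y \<in> interior T \<inter> f -` (-{0})" using ny y by simp
    ultimately show False using open_not_negligible by blast
  qed
  moreover have "closure (interior T) = T"
    using convex_closure_interior[OF T(2,3)] compact_imp_closed[OF T(1)] by simp
  ultimately show ?thesis
    using continuous_constant_on_closure[of "interior T" f 0 x] f(1) x by simp
qed

lemma vint_zero_imp_zero:
  assumes "compact K" "convex K" "interior K \<noteq> {}" "continuous_on K f" "\<And>x. x \<in> K \<Longrightarrow> 0 \<le> f x"
    and "vint K f = 0" "x \<in> K"
  shows "f x = 0"
  using zero_of_set_integral_zero[of K f x] assms vint_eq_lborel by metis

lemma vint_nonneg: "(\<And>x. x \<in> K \<Longrightarrow> 0 \<le> f x) \<Longrightarrow> 0 \<le> vint K f"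
  unfolding vint_def set_lebesgue_integral_def
  by (intro Bochner_Integration.integral_nonneg) (auto simp: indicator_def)

section \<open>The divergence theorem on a cell with flat faces\<close>

definition param_int :: "real \<Rightarrow> 'q::euclidean_space set \<Rightarrow> ('q \<Rightarrow> 'v) \<Rightarrow> ('v \<Rightarrow> real) \<Rightarrow> real" where
  "param_int a T \<psi> \<phi> = a * (LINT q:T|lborel. \<phi> (\<psi> q))"

text \<open>
  \<open>ctr\<close> is a point with respect to which \<open>K\<close> is strictly star-shaped; face \<open>e\<close> is parametrised by \<open>\<psi> e\<close> on
  \<open>T\<close> with the constant surface element \<open>a e\<close>.
\<close>
locale gauss_cell =
  fixes K :: "(real^'n) set" and Fs :: "'f set" and a :: "'f \<Rightarrow> real"
    and T :: "'q::euclidean_space set" and \<psi> :: "'f \<Rightarrow> 'q \<Rightarrow> real^'n" and nr :: "'f \<Rightarrow> real^'n"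
    and ctr :: "real^'n"
  assumes K: "compact K" "convex K" "interior K \<noteq> {}"
    and T: "compact T" "convex T" "interior T \<noteq> {}"
    and Fs: "finite Fs" "Fs \<noteq> {}"
    and a_pos: "\<And>e. e \<in> Fs \<Longrightarrow> 0 < a e"
    and \<psi>_cont: "\<And>e. e \<in> Fs \<Longrightarrow> continuous_on T (\<psi> e)"
    and \<psi>_K: "\<And>e. e \<in> Fs \<Longrightarrow> \<psi> e ` T \<subseteq> K"
    and nr_unit: "\<And>e. e \<in> Fs \<Longrightarrow> norm (nr e) = 1"
    and nr_ctr: "\<And>e x. e \<in> Fs \<Longrightarrow> x \<in> \<psi> e ` T \<Longrightarrow> 0 < (x - ctr) \<bullet> nr e"
    and gauss_poly: "\<And>g j. real_polynomial_function g \<Longrightarrow>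
       vint K (pd j g) = (\<Sum>e\<in>Fs. param_int (a e) T (\<psi> e) (\<lambda>x. g x * nr e $ j))"
begin

definition bnd :: "('f \<Rightarrow> real^'n \<Rightarrow> real) \<Rightarrow> real" where
  "bnd \<Phi> = (\<Sum>e\<in>Fs. param_int (a e) T (\<psi> e) (\<Phi> e))"

definition bcont :: "('f \<Rightarrow> real^'n \<Rightarrow> real) \<Rightarrow> bool" where
  "bcont \<Phi> \<longleftrightarrow> (\<forall>e\<in>Fs. continuous_on (\<psi> e ` T) (\<Phi> e))"

lemma bcontI: "(\<And>e. e \<in> Fs \<Longrightarrow> continuous_on K (\<Phi> e)) \<Longrightarrow> bcont \<Phi>"
  unfolding bcont_def using \<psi>_K continuous_on_subset by blast

lemma bcont_integrable: "bcont \<Phi> \<Longrightarrow> e \<in> Fs \<Longrightarrow> set_integrable lborel T (\<lambda>q. \<Phi> e (\<psi> e q))"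
  unfolding bcont_def
  by (intro set_integrable_lborel_continuous T continuous_on_compose2[OF _ \<psi>_cont]) auto

lemma bnd_add: "bcont \<Phi> \<Longrightarrow> bcont \<Psi> \<Longrightarrow> bnd (\<lambda>e x. \<Phi> e x + \<Psi> e x) = bnd \<Phi> + bnd \<Psi>"
  unfolding bnd_def param_int_def sum.distrib[symmetric]
  by (intro sum.cong refl) (simp add: set_integral_add bcont_integrable distrib_left)

lemma bnd_cmul: "bnd (\<lambda>e x. c * \<Phi> e x) = c * bnd \<Phi>"
  unfolding bnd_def param_int_def by (simp add: sum_distrib_left mult_ac)

lemma bnd_minus: "bnd (\<lambda>e x. - \<Phi> e x) = - bnd \<Phi>"
  using bnd_cmul[of "-1" \<Phi>] by simp

lemma bnd_diff: "bcont \<Phi> \<Longrightarrow> bcont \<Psi> \<Longrightarrow> bnd (\<lambda>e x. \<Phi> e x - \<Psi> e x) = bnd \<Phi> - bnd \<Psi>"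
  unfolding bnd_def param_int_def sum_subtractf[symmetric]
  by (intro sum.cong refl) (simp add: set_integral_diff bcont_integrable right_diff_distrib)

lemma bnd_zero [simp]: "bnd (\<lambda>e x. 0) = 0"
  unfolding bnd_def param_int_def by simp

lemma bcont_sum: "(\<And>i. i \<in> I \<Longrightarrow> bcont (\<Phi> i)) \<Longrightarrow> bcont (\<lambda>e x. \<Sum>i\<in>I. \<Phi> i e x)"
  unfolding bcont_def by (auto intro!: continuous_on_sum)

lemma bnd_sum:
  assumes "\<And>i. i \<in> I \<Longrightarrow> bcont (\<Phi> i)"
  shows "bnd (\<lambda>e x. \<Sum>i\<in>I. \<Phi> i e x) = (\<Sum>i\<in>I. bnd (\<Phi> i))"
  using assms by (induction I rule: infinite_finite_induct) (auto simp: bnd_add bcont_sum)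

lemma bnd_cong: "(\<And>e x. e \<in> Fs \<Longrightarrow> x \<in> \<psi> e ` T \<Longrightarrow> \<Phi> e x = \<Psi> e x) \<Longrightarrow> bnd \<Phi> = bnd \<Psi>"
  unfolding bnd_def param_int_def set_lebesgue_integral_def
  by (intro sum.cong refl arg_cong2[where f = "(*)"] Bochner_Integration.integral_cong)
    (auto simp: indicator_def)

lemma param_int_nonneg:
  "e \<in> Fs \<Longrightarrow> (\<And>x. x \<in> \<psi> e ` T \<Longrightarrow> 0 \<le> \<phi> x) \<Longrightarrow> 0 \<le> param_int (a e) T (\<psi> e) \<phi>"
  unfolding param_int_def set_lebesgue_integral_def using a_pos[of e]
  by (intro mult_nonneg_nonneg Bochner_Integration.integral_nonneg) (auto simp: indicator_def)

lemma bnd_nonneg: "(\<And>e x. e \<in> Fs \<Longrightarrow> x \<in> \<psi> e ` T \<Longrightarrow> 0 \<le> \<Phi> e x) \<Longrightarrow> 0 \<le> bnd \<Phi>"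
  unfolding bnd_def by (intro sum_nonneg param_int_nonneg)

lemma bnd_zero_imp_zero:
  assumes \<Phi>: "bcont \<Phi>" "\<And>e x. e \<in> Fs \<Longrightarrow> x \<in> \<psi> e ` T \<Longrightarrow> 0 \<le> \<Phi> e x" and zero: "bnd \<Phi> = 0"
    and e: "e \<in> Fs" and x: "x \<in> \<psi> e ` T"
  shows "\<Phi> e x = 0"
proof -
  have "param_int (a e) T (\<psi> e) (\<Phi> e) = 0"
    using zero e \<Phi>(2) Fs(1) unfolding bnd_def
    by (subst (asm) sum_nonneg_eq_0_iff) (auto intro!: param_int_nonneg)
  then have z: "(LINT q:T|lborel. \<Phi> e (\<psi> e q)) = 0" using a_pos[OF e] by (simp add: param_int_def)
  obtain q where q: "q \<in> T" "x = \<psi> e q" using x by auto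
  have "\<Phi> e (\<psi> e q) = 0"
    using \<Phi> e unfolding bcont_def
    by (intro zero_of_set_integral_zero[OF T _ _ z q(1)] continuous_on_compose2[OF _ \<psi>_cont[OF e]]) auto
  then show ?thesis using q by simp
qed

lemma bnd_bound:
  assumes \<Phi>: "bcont \<Phi>" "\<And>e x. e \<in> Fs \<Longrightarrow> x \<in> \<psi> e ` T \<Longrightarrow> \<bar>\<Phi> e x\<bar> \<le> s"
  shows "\<bar>bnd \<Phi>\<bar> \<le> s * bnd (\<lambda>e x. 1)"
proof -
  have c: "bcont (\<lambda>e x. s)" "bcont (\<lambda>e x. s + \<Phi> e x)" "bcont (\<lambda>e x. s - \<Phi> e x)"
    using \<Phi>(1) unfolding bcont_def by (auto intro!: continuous_intros)
  have "0 \<le> bnd (\<lambda>e x. s + \<Phi> e x)" "0 \<le> bnd (\<lambda>e x. s - \<Phi> e x)"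
    using \<Phi>(2) by (auto intro!: bnd_nonneg simp: abs_le_iff) (smt (verit) \<Phi>(2) imageI)+
  then have "\<bar>bnd \<Phi>\<bar> \<le> bnd (\<lambda>e x. s * 1)"
    using bnd_add[OF c(1) \<Phi>(1)] bnd_diff[OF c(1) \<Phi>(1)] by simp
  then show ?thesis unfolding bnd_cmul .
qed

lemma set_integrable_kcont: "continuous_on K (f :: real^'n \<Rightarrow> real) \<Longrightarrow> set_integrable lebesgue K f"
  using set_integrable_continuous[OF K(1)] .

lemma AE_has_pdv: "lip_on K f \<Longrightarrow> AE x in lebesgue. x \<in> K \<longrightarrow> has_pdv f x"
  using AE_lip_on_has_pdv[OF _ K(2) compact_imp_closed[OF K(1)]] by blast

lemma cball_K: obtains c r where "cball c r \<subseteq> K" "0 < r"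
proof -
  obtain c where "c \<in> interior K" using K(3) by blast
  then show ?thesis using that mem_interior_cball by blast
qed

lemma set_integrable_pd:
  fixes F :: "real^'n \<Rightarrow> real"
  assumes "lip_on K F" shows "set_integrable lebesgue K (pd j F)"
proof -
  obtain c r where cr: "cball c r \<subseteq> K" "0 < r" by (rule cball_K)
  obtain s where "\<And>x. x \<in> K \<Longrightarrow> \<bar>F x\<bar> \<le> s"
    using compact_imp_bounded[OF compact_continuous_image[OF lip_on_continuous[OF assms] K(1)]]
    by (auto simp: bounded_iff)
  then show ?thesis by (rule set_integrable_pd_and_bound(1)[OF K(1,2) cr assms])
qed

theorem gauss:
  fixes F :: "real^'n \<Rightarrow> real"
  assumes F: "lip_on K F"
  shows "vint K (pd j F) = bnd (\<lambda>e x. F x * nr e $ j)"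
proof -
  obtain c r where cr: "cball c r \<subseteq> K" "0 < r" by (rule cball_K)
  define M where "M = 2 * (2 ^ CARD('n) - 1) * measure lborel K / r"
  define B where "B = bnd (\<lambda>e x. 1)"
  let ?d = "\<bar>vint K (pd j F) - bnd (\<lambda>e x. F x * nr e $ j)\<bar>"
  have M: "0 \<le> M" unfolding M_def using cr(2) by simp
  have B: "0 \<le> B" unfolding B_def by (rule bnd_nonneg) simp
  have "?d \<le> 0 + \<epsilon>" if \<epsilon>: "0 < \<epsilon>" for \<epsilon>
  proof -
    \<comment> \<open>\<open>M\<close> and \<open>B\<close> are the norms of the volume and the
      surface functional up to constants already absorbed in them, so the total error is at most
      \<open>\<delta> (M + B)\<close>. The summand 1 keeps the denominator positive.\<close>
    define \<delta> where "\<delta> = \<epsilon> / (M + B + 1)"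
    have "0 < \<delta>" "\<delta> * (M + B + 1) = \<epsilon>"
      using \<epsilon> M B by (simp_all add: \<delta>_def)
    then have \<delta>: "0 < \<delta>" "\<delta> * M + \<delta> * B \<le> \<epsilon>"
      by (simp_all add: algebra_simps)
    \<comment> \<open>Stone-Weierstrass gives closeness of values only and says nothing about
      derivatives; the supremum-norm bound on the derivative integral makes this sufficient.\<close>
    obtain g where g: "real_polynomial_function g" "\<And>x. x \<in> K \<Longrightarrow> \<bar>F x - g x\<bar> < \<delta>"
      using Stone_Weierstrass_real_polynomial_function[OF K(1) lip_on_continuous[OF F] \<delta>(1)] by blast
    have lg: "lip_on K g" using g(1) K(1) by (rule lip_on_real_polynomial_function)
    have ld: "lip_on K (\<lambda>x. F x - g x)" by (rule lip_on_diff[OF F lg])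
    have 1: "vint K (pd j F) - vint K (pd j g) = vint K (pd j (\<lambda>x. F x - g x))"
    proof -
      have "vint K (\<lambda>x. pd j F x - pd j g x) = vint K (pd j (\<lambda>x. F x - g x))"
      proof (rule vint_cong_AE(2))
        show "set_integrable lebesgue K (\<lambda>x. pd j F x - pd j g x)"
          using set_integrable_pd[OF F] set_integrable_pd[OF lg] by simp
        show "AE x in lebesgue. x \<in> K \<longrightarrow> pd j F x - pd j g x = pd j (\<lambda>x. F x - g x) x"
          using AE_has_pdv[OF F] AE_has_pdv[OF lg]
          by eventually_elim (simp add: pdv_diff flip: pdv_real)
      qed
      then show ?thesis using vint_diff[OF set_integrable_pd[OF F] set_integrable_pd[OF lg]] by simp
    qed
    have "\<bar>vint K (pd j (\<lambda>x. F x - g x))\<bar> \<le> \<delta> * M"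
      unfolding M_def using g(2)
      by (intro set_integrable_pd_and_bound(2)[OF K(1,2) cr ld] less_imp_le)
    moreover have "\<bar>bnd (\<lambda>e x. F x * nr e $ j) - bnd (\<lambda>e x. g x * nr e $ j)\<bar> \<le> \<delta> * B"
    proof -
      have bc: "bcont (\<lambda>e x. F x * nr e $ j)" "bcont (\<lambda>e x. g x * nr e $ j)"
        using lip_on_continuous[OF F] lip_on_continuous[OF lg]
        by (auto intro!: bcontI continuous_intros)
      have bcd: "bcont (\<lambda>e x. F x * nr e $ j - g x * nr e $ j)"
        using lip_on_continuous[OF F] lip_on_continuous[OF lg]
        by (auto intro!: bcontI continuous_intros)
      have "\<bar>bnd (\<lambda>e x. F x * nr e $ j - g x * nr e $ j)\<bar> \<le> \<delta> * B"
        unfolding B_def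
      proof (rule bnd_bound[OF bcd])
        fix e x assume ex: "e \<in> Fs" "x \<in> \<psi> e ` T"
        have "\<bar>F x * nr e $ j - g x * nr e $ j\<bar> = \<bar>F x - g x\<bar> * \<bar>nr e $ j\<bar>"
          by (simp add: left_diff_distrib[symmetric] abs_mult)
        also have "\<dots> \<le> \<delta> * 1"
        proof (rule mult_mono)
          have "x \<in> K" using \<psi>_K ex by blast
          then show "\<bar>F x - g x\<bar> \<le> \<delta>" using g(2)[of x] by simp
          show "\<bar>nr e $ j\<bar> \<le> 1" using component_le_norm_cart[of "nr e" j] nr_unit[OF ex(1)] by simp
        qed (use \<delta> in auto)
        finally show "\<bar>F x * nr e $ j - g x * nr e $ j\<bar> \<le> \<delta>" by simp
      qed
      then show ?thesis using bnd_diff[OF bc] by simp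
    qed
    moreover have "vint K (pd j g) = bnd (\<lambda>e x. g x * nr e $ j)"
      unfolding bnd_def by (rule gauss_poly[OF g(1)])
    ultimately show ?thesis using 1 \<delta>(2) by linarith
  qed
  then have "?d \<le> 0" by (rule field_le_epsilon)
  then show ?thesis by simp
qed

lemma set_integrable_pdv_inner:
  fixes A :: "real^'n \<Rightarrow> 'e::euclidean_space"
  assumes A: "lip_on K A" and B: "continuous_on K B"
  shows "set_integrable lebesgue K (\<lambda>x. pdv j A x \<bullet> B x)"
proof -
  have "set_integrable lebesgue K (\<lambda>x. \<Sum>b\<in>Basis. pd j (\<lambda>y. A y \<bullet> b) x * (b \<bullet> B x))"
    using lip_on_linear[OF bounded_linear_inner_left A] B
    by (intro set_integrable_sum set_integrable_mult_continuous K set_integrable_pd continuous_intros) auto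
  then show ?thesis by (simp add: pdv_def inner_sum_left)
qed

text \<open>This is the divergence theorem for the Lipschitz function
  \<open>A x \<bullet> B x\<close>. The product rule is available only where both factors have
  partial derivatives, so the integrands are compared almost everywhere.\<close>

theorem integration_by_parts:
  fixes A B :: "real^'n \<Rightarrow> 'e::euclidean_space"
  assumes A: "lip_on K A" and B: "lip_on K B"
  shows "vint K (\<lambda>x. pdv j A x \<bullet> B x) + vint K (\<lambda>x. A x \<bullet> pdv j B x) = bnd (\<lambda>e x. (A x \<bullet> B x) * nr e $ j)"
proof -
  have AB: "lip_on K (\<lambda>x. A x \<bullet> B x)"
    by (rule lip_on_bilinear[OF bounded_bilinear_inner K(1) A B])
  have i1: "set_integrable lebesgue K (\<lambda>x. pdv j A x \<bullet> B x)"
    by (rule set_integrable_pdv_inner[OF A lip_on_continuous[OF B]])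
  have i2: "set_integrable lebesgue K (\<lambda>x. A x \<bullet> pdv j B x)"
    using set_integrable_pdv_inner[OF B lip_on_continuous[OF A]] by (simp add: inner_commute)
  have "vint K (\<lambda>x. pdv j A x \<bullet> B x) + vint K (\<lambda>x. A x \<bullet> pdv j B x) =
      vint K (\<lambda>x. pdv j A x \<bullet> B x + A x \<bullet> pdv j B x)"
    using vint_add[OF i1 i2] by simp
  also have "\<dots> = vint K (pd j (\<lambda>x. A x \<bullet> B x))"
  proof (rule vint_cong_AE(2))
    show "set_integrable lebesgue K (\<lambda>x. pdv j A x \<bullet> B x + A x \<bullet> pdv j B x)"
      using i1 i2 by simp
    show "AE x in lebesgue. x \<in> K \<longrightarrow> pdv j A x \<bullet> B x + A x \<bullet> pdv j B x = pd j (\<lambda>x. A x \<bullet> B x) x"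
      using AE_has_pdv[OF A] AE_has_pdv[OF B]
      by eventually_elim (simp add: pdv_bilinear[OF bounded_bilinear_inner] flip: pdv_real)
  qed
  also have "\<dots> = bnd (\<lambda>e x. (A x \<bullet> B x) * nr e $ j)" by (rule gauss[OF AB])
  finally show ?thesis .
qed

end

section \<open>Curl-free and divergence-free polynomial fields\<close>

lemma linear_matrix_vector_mul_left: "linear (\<lambda>A :: real^'n^'m. A *v y)"
  by (rule linearI) (simp_all add: matrix_vector_mult_add_rdistrib scaleR_matrix_vector_assoc)

lemma linear_outerp_left: "linear (\<lambda>a. outerp a y)"
  by (rule linearI) (simp_all add: outerp_def vec_eq_iff algebra_simps)

text \<open>This and the following rewritings express each operator as a sum over \<open>j\<close>
  of a linear map applied to a derivative in direction \<open>j\<close>. All Green formulas then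
  reduce to integration by parts in one direction.\<close>

lemma gradV_eq: "gradV v x = (\<Sum>j\<in>UNIV. outerp (pdv j v x) (axis j 1))"
  by (simp add: vec_eq_iff gradV_def outerp_def pdv_nth axis_def if_distrib sum.delta cong: if_cong)

lemma inner_gradV: "G \<bullet> gradV v x = (\<Sum>j\<in>UNIV. (G *v axis j 1) \<bullet> pdv j v x)"
proof -
  have "G \<bullet> gradV v x = (\<Sum>i\<in>UNIV. \<Sum>j\<in>UNIV. G $ i $ j * pdv j v x $ i)"
    by (simp add: inner_vec_def gradV_def pdv_nth)
  also have "\<dots> = (\<Sum>j\<in>UNIV. \<Sum>i\<in>UNIV. G $ i $ j * pdv j v x $ i)" by (rule sum.swap)
  finally show ?thesis by (simp add: inner_vec_def matrix_vector_mul_component inner_axis[unfolded inner_vec_def, simplified] axis_def if_distrib sum.delta cong: if_cong)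
qed

lemma divV_eq: "divV v x = (\<Sum>j\<in>UNIV. pdv j v x $ j)"
  by (simp add: divV_def pdv_nth)

lemma divM_eq: "divM G x = (\<Sum>j\<in>UNIV. pdv j (\<lambda>y. G y *v axis j 1) x)"
proof -
  have "(G y *v axis j 1) $ i = G y $ i $ j" for y i j
    by (simp add: matrix_vector_mul_component inner_axis)
  then show ?thesis by (simp add: divM_def vec_eq_iff pdv_nth)
qed

lemma outerp_mult_axis: "outerp a c *v axis j 1 = (c $ j) *\<^sub>R a"
  by (simp add: vec_eq_iff matrix_vector_mul_component inner_axis outerp_def mult.commute)

lemma vec_expand_axis: "(y :: real^'n) = (\<Sum>j\<in>UNIV. (y $ j) *\<^sub>R axis j 1)"
  by (simp add: vec_eq_iff axis_def if_distrib sum.delta cong: if_cong)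

lemma vpoly_space_gradV: "v \<in> vpoly_space k \<Longrightarrow> gradV v \<in> vpoly_space k"
proof -
  assume v: "v \<in> vpoly_space k"
  have "(\<lambda>x. \<Sum>j\<in>UNIV. outerp (pdv j v x) (axis j 1)) \<in> vpoly_space k"
    by (intro vpoly_space_sum vpoly_space_linear[OF _ linear_outerp_left] vpoly_space_pdv v)
  then show ?thesis by (simp add: gradV_eq[abs_def])
qed

lemma gradS_eq: "gradS q x = (\<Sum>j\<in>UNIV. pd j q x *\<^sub>R axis j 1)"
  by (simp add: gradS_def vec_eq_iff axis_def if_distrib sum.delta cong: if_cong)

lemma vpoly_space_gradS:
  assumes q: "q \<in> vpoly_space k" shows "gradS q \<in> vpoly_space k"
proof -
  have "(\<lambda>x. \<Sum>j\<in>UNIV. pdv j q x *\<^sub>R (axis j 1 :: real^'a)) \<in> vpoly_space k"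
    by (intro vpoly_space_sum vpoly_space_linear[where T = "\<lambda>t. t *\<^sub>R _", OF vpoly_space_pdv[OF q]] linearI)
      (simp_all add: scaleR_add_left)
  then show ?thesis by (simp add: gradS_eq[abs_def])
qed

lemma vpoly_space_nth: "v \<in> vpoly_space k \<Longrightarrow> (\<lambda>x. v x $ j) \<in> vpoly_space k"
  by (erule vpoly_space_linear) (simp add: linear_iff)

lemma vpoly_space_divV: "v \<in> vpoly_space k \<Longrightarrow> divV v \<in> vpoly_space k"
  unfolding divV_eq[abs_def]
  by (intro vpoly_space_sum vpoly_space_nth vpoly_space_pdv)

lemma vpoly_space_continuous: "f \<in> vpoly_space k \<Longrightarrow> continuous_on S f"
proof -
  assume "f \<in> vpoly_space k"
  then have "continuous_on S (\<lambda>x. \<Sum>b\<in>Basis. (f x \<bullet> b) *\<^sub>R b)"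
    by (intro continuous_on_sum continuous_on_scaleR continuous_on_const)
      (auto simp: vpoly_space_def real_polynomial_function_eq intro!: continuous_on_polymonial_function
        dest!: bspec real_polynomial_function_poly_space)
  then show ?thesis by (simp only: euclidean_representation)
qed

lemma poly_space_constant_of_pd_zero:
  assumes f: "f \<in> poly_space k" and zero: "\<And>j x. pd j f x = 0"
  shows "f x = f y"
proof -
  have "(f has_derivative (\<lambda>h. 0)) (at z)" for z
  proof -
    have "f differentiable at z"
      by (rule differentiable_at_real_polynomial_function[OF real_polynomial_function_poly_space[OF f]])
    then obtain D where D: "(f has_derivative D) (at z)" unfolding differentiable_def by blast
    have lin: "linear D" using D by (rule has_derivative_linear)
    have "D (axis j 1) = 0" for j
    proof -
      have "((\<lambda>t. z + t *\<^sub>R axis j 1) has_vector_derivative axis j 1) (at (0::real))"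
        by (auto intro!: derivative_eq_intros)
      then have "((\<lambda>t. f (z + t *\<^sub>R axis j 1)) has_vector_derivative D (axis j 1)) (at 0)"
        using vector_derivative_diff_chain_within[of "\<lambda>t. z + t *\<^sub>R axis j 1" "axis j 1" 0 UNIV f D] D
        by (simp add: o_def has_derivative_at_withinI)
      then show ?thesis using pd_eqI zero by fastforce
    qed
    then have "D h = 0" for h
      using linear_sum[OF lin, of "\<lambda>j. (h $ j) *\<^sub>R axis j 1" UNIV] 
      by (simp add: vec_expand_axis[of h, symmetric] linear_cmul[OF lin])
    then have "D = (\<lambda>h. 0)" by (rule ext)
    then show ?thesis using D by simp
  qed
  then show ?thesis
    using has_derivative_zero_unique[of UNIV f] by (metis UNIV_I convex_UNIV has_derivative_at_withinI)
qed

lemma vpoly_space_constant_of_pdv_zero: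
  assumes f: "f \<in> vpoly_space k" and zero: "\<And>j x. pdv j f x = 0"
  shows "f x = f y"
proof (rule euclidean_eqI)
  fix b :: 'b assume b: "b \<in> Basis"
  have "pd j (\<lambda>y. f y \<bullet> b) z = 0" for j z
    using zero[of j z] by (simp add: pdv_inner_Basis[OF b, symmetric])
  then show "f x \<bullet> b = f y \<bullet> b"
    using f b poly_space_constant_of_pd_zero[of "\<lambda>y. f y \<bullet> b" k x y] by (auto simp: vpoly_space_def)
qed

section \<open>Green formulas and vanishing results on a cell\<close>

context gauss_cell
begin

lemma lip_vpoly: "f \<in> vpoly_space k \<Longrightarrow> lip_on K f"
  using lip_on_vpoly_space K(1) by blast

text \<open>The field vanishes on \<open>K\<close> by continuity and then everywhere, being
  polynomial. The global conclusion is what uniqueness requires, since the unknowns are functions on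
  the whole space.\<close>

lemma vpoly_zero_of_vint:
  assumes f: "f \<in> vpoly_space k" and zero: "vint K (\<lambda>x. f x \<bullet> f x) = 0"
  shows "f x = 0"
proof -
  have c: "continuous_on K f" by (rule vpoly_space_continuous[OF f])
  have "f y \<bullet> f y = 0" if "y \<in> K" for y
    by (rule vint_zero_imp_zero[OF K _ _ zero that]) (auto intro!: continuous_intros c)
  then show ?thesis
    using vpoly_space_eq_zero_of_open[OF f open_interior, of _ K x] K(3) interior_subset
    by (metis all_not_in_conv inner_eq_zero_iff subsetD)
qed

text \<open>A common template: the factors may depend on the direction \<open>j\<close>, so
  gradients, divergences, curls and the convective term are all instances.\<close>

lemma ibp_sum:
  fixes A :: "'n \<Rightarrow> real^'n \<Rightarrow> 'e::euclidean_space" and B :: "'n \<Rightarrow> real^'n \<Rightarrow> 'e"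
  assumes A: "\<And>j. lip_on K (A j)" and B: "\<And>j. lip_on K (B j)"
  shows "vint K (\<lambda>x. \<Sum>j\<in>UNIV. pdv j (A j) x \<bullet> B j x) + vint K (\<lambda>x. \<Sum>j\<in>UNIV. A j x \<bullet> pdv j (B j) x) =
     bnd (\<lambda>e x. \<Sum>j\<in>UNIV. (A j x \<bullet> B j x) * nr e $ j)"
proof -
  have i1: "set_integrable lebesgue K (\<lambda>x. pdv j (A j) x \<bullet> B j x)" for j
    by (rule set_integrable_pdv_inner[OF A lip_on_continuous[OF B]])
  have i2: "set_integrable lebesgue K (\<lambda>x. A j x \<bullet> pdv j (B j) x)" for j
    using set_integrable_pdv_inner[OF B lip_on_continuous[OF A]] by (simp add: inner_commute)
  have i3: "bcont (\<lambda>e x. (A j x \<bullet> B j x) * nr e $ j)" for j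
    by (intro bcontI continuous_intros lip_on_continuous A B)
  show ?thesis
    unfolding vint_sum[OF i1] vint_sum[OF i2] bnd_sum[OF i3] sum.distrib[symmetric]
    by (intro sum.cong refl integration_by_parts A B)
qed

lemma ibp_gradV:
  assumes G: "lip_on K G" and v: "lip_on K v"
  shows "vint K (\<lambda>x. G x \<bullet> gradV v x) + vint K (\<lambda>x. v x \<bullet> divM G x) = bnd (\<lambda>e x. (G x *v nr e) \<bullet> v x)"
proof -
  have GA: "lip_on K (\<lambda>x. G x *v axis j 1)" for j
    using lip_on_linear[OF _ G] linear_matrix_vector_mul_left by (auto simp: linear_conv_bounded_linear)
  have n: "(\<Sum>j\<in>UNIV. ((G x *v axis j 1) \<bullet> v x) * nr e $ j) = (G x *v nr e) \<bullet> v x" for e x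
  proof -
    have "G x *v nr e = (\<Sum>j\<in>UNIV. (nr e $ j) *\<^sub>R (G x *v axis j 1))"
      using vec_expand_axis[of "nr e"] linear_sum[OF matrix_vector_mul_linear[of "G x"], of "\<lambda>j. (nr e $ j) *\<^sub>R axis j 1" UNIV]
      by (simp add: matrix_vector_mult_scaleR)
    then show ?thesis by (simp add: inner_sum_left mult.commute)
  qed
  show ?thesis
    using ibp_sum[of "\<lambda>j x. G x *v axis j 1" "\<lambda>j. v", OF GA v]
    unfolding n by (simp add: inner_gradV divM_eq inner_sum_right inner_commute add.commute)
qed

lemma ibp_divV:
  assumes p: "lip_on K p" and v: "lip_on K v"
  shows "vint K (\<lambda>x. p x * divV v x) + vint K (\<lambda>x. gradS p x \<bullet> v x) = bnd (\<lambda>e x. (p x *\<^sub>R nr e) \<bullet> v x)"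
proof -
  have va: "lip_on K (\<lambda>x. v x $ j)" for j by (rule lip_on_linear[OF bounded_linear_vec_nth v])
  have n: "(\<Sum>j\<in>UNIV. p x \<bullet> v x $ j * nr e $ j) = (p x *\<^sub>R nr e) \<bullet> v x" for e x
    by (simp add: inner_vec_def sum_distrib_left mult_ac)
  show ?thesis
    using ibp_sum[of "\<lambda>j. p" "\<lambda>j x. v x $ j", OF p va]
    unfolding n by (simp add: inner_vec_def gradS_def divV_def sum_distrib_left add.commute)
qed

text \<open>The integrand is \<open>w . grad (|u|^2 / 2)\<close>. With \<open>div w = 0\<close>
  almost everywhere only the boundary term survives, and the factor 2 clears the half.\<close>

lemma ibp_convection:
  assumes u: "u \<in> vpoly_space k" and w: "lip_on K w" and div: "AE x in lebesgue. x \<in> K \<longrightarrow> divV w x = 0"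
  shows "2 * vint K (\<lambda>x. outerp (u x) (w x) \<bullet> gradV u x) = bnd (\<lambda>e x. (w x \<bullet> nr e) * (u x \<bullet> u x))"
proof -
  have lu: "lip_on K (\<lambda>x. u x \<bullet> u x)"
    by (intro lip_on_bilinear[OF bounded_bilinear_inner K(1)] lip_vpoly[OF u])
  have wa: "lip_on K (\<lambda>x. w x $ j)" for j by (rule lip_on_linear[OF bounded_linear_vec_nth w])
  have n: "(\<Sum>j\<in>UNIV. (u x \<bullet> u x) \<bullet> w x $ j * nr e $ j) = (w x \<bullet> nr e) * (u x \<bullet> u x)" for e x
    by (simp add: inner_vec_def[of "w x"] sum_distrib_left mult_ac)
  have 1: "(\<Sum>j\<in>UNIV. pdv j (\<lambda>x. u x \<bullet> u x) x \<bullet> w x $ j) = 2 * (outerp (u x) (w x) \<bullet> gradV u x)" for x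
    using pdv_bilinear[OF bounded_bilinear_inner has_pdv_vpoly_space[OF u] has_pdv_vpoly_space[OF u]]
    unfolding inner_gradV outerp_mult_axis
    by (simp add: sum_distrib_left inner_commute mult_ac del: pdv_real)
  have "vint K (\<lambda>x. \<Sum>j\<in>UNIV. (u x \<bullet> u x) \<bullet> pdv j (\<lambda>x. w x $ j) x) = vint K (\<lambda>x. 0)"
  proof (rule vint_cong_AE(2)[symmetric])
    show "AE x in lebesgue. x \<in> K \<longrightarrow> 0 = (\<Sum>j\<in>UNIV. (u x \<bullet> u x) \<bullet> pdv j (\<lambda>x. w x $ j) x)"
      using div by eventually_elim (simp add: divV_def sum_distrib_left[symmetric])
  qed (simp add: set_integrable_def)
  then show ?thesis
    using ibp_sum[of "\<lambda>j x. u x \<bullet> u x" "\<lambda>j x. w x $ j", OF lu wa]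
    unfolding n 1 vint_cmul by simp
qed

text \<open>
  With \<open>Y x = x - ctr\<close>, integrating the divergence of \<open>|b|\<^sup>2 Y / 2 - (b \<bullet> Y) b\<close> gives
  \<open>(d/2 - 1) (b, b)\<^sub>K + \<langle>Y \<bullet> n, |b|\<^sup>2\<rangle> / 2 = 0\<close>, where both terms are nonnegative.
\<close>
lemma rellich:
  assumes b: "b \<in> vpoly_space k" and sym: "\<And>i j x. pdv j b x $ i = pdv i b x $ j"
    and div: "\<And>x. divV b x = 0"
    and face: "\<And>e x. e \<in> Fs \<Longrightarrow> x \<in> \<psi> e ` T \<Longrightarrow> b x = (b x \<bullet> nr e) *\<^sub>R nr e"
    and dim: "2 \<le> CARD('n)" and e: "e \<in> Fs" and x: "x \<in> \<psi> e ` T"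
  shows "b x = 0"
proof -
  let ?Y = "\<lambda>x. x - ctr"
  have cb: "continuous_on S b" for S by (rule vpoly_space_continuous[OF b])
  have lb: "lip_on K b" by (rule lip_vpoly[OF b])
  have lY: "lip_on K ?Y" by (intro lip_on_diff lip_on_id lip_on_const)
  have lbb: "lip_on K (\<lambda>x. b x \<bullet> b x)" by (rule lip_on_bilinear[OF bounded_bilinear_inner K(1) lb lb])
  have lbY: "lip_on K (\<lambda>x. b x \<bullet> ?Y x)" by (rule lip_on_bilinear[OF bounded_bilinear_inner K(1) lb lY])
  have lYj: "lip_on K (\<lambda>x. ?Y x $ j)" for j by (rule lip_on_linear[OF bounded_linear_vec_nth lY])
  have lbj: "lip_on K (\<lambda>x. b x $ j)" for j by (rule lip_on_linear[OF bounded_linear_vec_nth lb])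
  have pb: "has_pdv b x" for x by (rule has_pdv_vpoly_space[OF b])
  have dY: "((\<lambda>t. x + t *\<^sub>R axis j 1 - ctr) has_vector_derivative axis j 1) (at (0::real))" for x j
    by (auto intro!: derivative_eq_intros)
  have Y1: "pdv j ?Y x = axis j 1" for j x by (rule pdv_eqI[OF dY])
  have pY: "has_pdv ?Y x" for x unfolding has_pdv_def Y1 using dY by blast
  have dbb: "pdv j (\<lambda>x. b x \<bullet> b x) x = 2 * (b x \<bullet> pdv j b x)" for j x
    using pdv_bilinear[OF bounded_bilinear_inner pb pb] by (simp add: inner_commute)
  have dbY: "pdv j (\<lambda>x. b x \<bullet> ?Y x) x = b x $ j + pdv j b x \<bullet> ?Y x" for j x
    using pdv_bilinear[OF bounded_bilinear_inner pb pY] by (simp add: Y1 inner_axis del: pdv_real)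
  have Yjj: "pdv j (\<lambda>x. ?Y x $ j) x = 1" for j x
    using pdv_linear[OF bounded_linear_vec_nth pY, of j j x] by (simp add: Y1 del: pdv_real)
  have bjj: "pdv j (\<lambda>x. b x $ j) x = pdv j b x $ j" for j x by (simp add: pdv_nth)
  \<comment> \<open>The symmetric Jacobian gives \<open>y . (b . grad) b = b . (y . grad) b\<close>,
    so both divergence identities contain the same volume term.\<close>
  have swap: "(\<Sum>j\<in>UNIV. (pdv j b x \<bullet> y) * b x $ j) = (\<Sum>j\<in>UNIV. (b x \<bullet> pdv j b x) * y $ j)" for x y
  proof -
    have "(\<Sum>j\<in>UNIV. (pdv j b x \<bullet> y) * b x $ j) = (\<Sum>j\<in>UNIV. \<Sum>i\<in>UNIV. pdv i b x $ j * y $ i * b x $ j)"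
      using sym by (simp add: inner_vec_def sum_distrib_right)
    also have "\<dots> = (\<Sum>i\<in>UNIV. \<Sum>j\<in>UNIV. pdv i b x $ j * y $ i * b x $ j)" by (rule sum.swap)
    finally show ?thesis by (simp add: inner_vec_def sum_distrib_right sum_distrib_left mult_ac)
  qed
  have c1: "continuous_on K (\<lambda>x. pdv j b x)" for j by (rule vpoly_space_continuous[OF vpoly_space_pdv[OF b]])
  have A: "vint K (\<lambda>x. \<Sum>j\<in>UNIV. pdv j (\<lambda>x. b x \<bullet> b x) x \<bullet> ?Y x $ j) + vint K (\<lambda>x. \<Sum>j\<in>UNIV. (b x \<bullet> b x) \<bullet> pdv j (\<lambda>x. ?Y x $ j) x)
      = bnd (\<lambda>e x. \<Sum>j\<in>UNIV. ((b x \<bullet> b x) \<bullet> ?Y x $ j) * nr e $ j)"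
    by (rule ibp_sum[OF lbb lYj])
  have B: "vint K (\<lambda>x. \<Sum>j\<in>UNIV. pdv j (\<lambda>x. b x \<bullet> ?Y x) x \<bullet> b x $ j) + vint K (\<lambda>x. \<Sum>j\<in>UNIV. (b x \<bullet> ?Y x) \<bullet> pdv j (\<lambda>x. b x $ j) x)
      = bnd (\<lambda>e x. \<Sum>j\<in>UNIV. ((b x \<bullet> ?Y x) \<bullet> b x $ j) * nr e $ j)"
    by (rule ibp_sum[OF lbY lbj])
  define Z where "Z = vint K (\<lambda>x. \<Sum>j\<in>UNIV. (b x \<bullet> pdv j b x) * ?Y x $ j)"
  define N where "N = vint K (\<lambda>x. b x \<bullet> b x)"
  define W where "W = bnd (\<lambda>e x. (b x \<bullet> b x) * (?Y x \<bullet> nr e))"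
  have A1: "vint K (\<lambda>x. \<Sum>j\<in>UNIV. pdv j (\<lambda>x. b x \<bullet> b x) x \<bullet> ?Y x $ j) = 2 * Z"
    unfolding dbb Z_def vint_cmul[symmetric] by (simp add: sum_distrib_left mult_ac)
  have A2: "vint K (\<lambda>x. \<Sum>j\<in>UNIV. (b x \<bullet> b x) \<bullet> pdv j (\<lambda>x. ?Y x $ j) x) = real CARD('n) * N"
    unfolding Yjj N_def vint_cmul[symmetric] by simp
  have A3: "bnd (\<lambda>e x. \<Sum>j\<in>UNIV. ((b x \<bullet> b x) \<bullet> ?Y x $ j) * nr e $ j) = W"
    unfolding W_def inner_vec_def[of "x - ctr" for x] by (simp add: sum_distrib_left mult_ac)
  have B1: "vint K (\<lambda>x. \<Sum>j\<in>UNIV. pdv j (\<lambda>x. b x \<bullet> ?Y x) x \<bullet> b x $ j) = N + Z"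
  proof -
    have "(\<Sum>j\<in>UNIV. pdv j (\<lambda>x. b x \<bullet> ?Y x) x \<bullet> b x $ j) = b x \<bullet> b x + (\<Sum>j\<in>UNIV. (b x \<bullet> pdv j b x) * ?Y x $ j)" for x
      unfolding swap[of x "?Y x", symmetric] dbY
      by (simp add: distrib_right sum.distrib inner_vec_def[of "b x" "b x"])
    then show ?thesis unfolding Z_def N_def
      by (simp only:) (intro vint_add set_integrable_kcont continuous_intros cb c1)
  qed
  have B2: "vint K (\<lambda>x. \<Sum>j\<in>UNIV. (b x \<bullet> ?Y x) \<bullet> pdv j (\<lambda>x. b x $ j) x) = 0"
  proof -
    have "(\<Sum>j\<in>UNIV. (b x \<bullet> ?Y x) \<bullet> pdv j (\<lambda>x. b x $ j) x) = 0" for x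
      using div[of x] by (simp add: divV_def sum_distrib_left[symmetric])
    then show ?thesis by simp
  qed
  \<comment> \<open>On a face \<open>b\<close> is a multiple of the normal, so
    \<open>(b . Y) (b . n)\<close> equals \<open>|b|^2 (Y . n)\<close> and the two boundary terms
    coincide.\<close>
  have B3: "bnd (\<lambda>e x. \<Sum>j\<in>UNIV. ((b x \<bullet> ?Y x) \<bullet> b x $ j) * nr e $ j) = W"
    unfolding W_def
  proof (rule bnd_cong)
    fix e x assume ex: "e \<in> Fs" "x \<in> \<psi> e ` T"
    define s where "s = b x \<bullet> nr e"
    have bx: "b x = s *\<^sub>R nr e" using face[OF ex] by (simp add: s_def)
    have nn: "nr e \<bullet> nr e = 1" using nr_unit[OF ex(1)] by (simp add: dot_square_norm)
    have "(\<Sum>j\<in>UNIV. ((b x \<bullet> ?Y x) \<bullet> b x $ j) * nr e $ j) = (b x \<bullet> ?Y x) * (b x \<bullet> nr e)"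
      by (simp add: inner_vec_def[of "b x" "nr e"] sum_distrib_left mult_ac)
    also have "\<dots> = (b x \<bullet> b x) * (?Y x \<bullet> nr e)"
      unfolding bx using nn by (simp add: inner_commute mult_ac)
    finally show "(\<Sum>j\<in>UNIV. ((b x \<bullet> ?Y x) \<bullet> b x $ j) * nr e $ j) = (b x \<bullet> b x) * (?Y x \<bullet> nr e)" .
  qed
  \<comment> \<open>The identities read \<open>2 Z + d N = W\<close> and \<open>N + Z = W\<close>.
    Twice the second minus the first eliminates \<open>Z\<close>, the only term without a
    sign.\<close>
  have eq: "(real CARD('n) - 2) * N + W = 0"
    using A B unfolding A1 A2 A3 B1 B2 B3 by (simp add: algebra_simps)
  have N0: "0 \<le> N" unfolding N_def by (rule vint_nonneg) simp
  have Wpos: "0 \<le> (b x \<bullet> b x) * (?Y x \<bullet> nr e)" if "e \<in> Fs" "x \<in> \<psi> e ` T" for e x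
    using nr_ctr[OF that] by simp
  have "0 \<le> W" unfolding W_def by (rule bnd_nonneg[OF Wpos])
  moreover have "0 \<le> (real CARD('n) - 2) * N" using dim N0 by (intro mult_nonneg_nonneg) auto
  ultimately have "W = 0" using eq by linarith
  moreover have bc: "bcont (\<lambda>e x. (b x \<bullet> b x) * (?Y x \<bullet> nr e))"
    by (intro bcontI continuous_intros cb)
  ultimately have "(b x \<bullet> b x) * (?Y x \<bullet> nr e) = 0"
    unfolding W_def by (intro bnd_zero_imp_zero[OF bc Wpos _ e x])
  then show ?thesis using nr_ctr[OF e x] by simp
qed

text \<open>For fixed \<open>i\<close> integrate the divergence of \<open>b_i\<close> times the
  \<open>i\<close>-th derivative of \<open>b\<close>. One part contains the derivative of
  \<open>div b\<close> and vanishes; by symmetry of the Jacobian the other is the squared length of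
  the \<open>i\<close>-th derivative. The boundary term is zero, so \<open>b\<close> is constant,
  with a zero on the boundary.\<close>

lemma harmonic_field_zero:
  assumes b: "b \<in> vpoly_space k" and sym: "\<And>i j x. pdv j b x $ i = pdv i b x $ j"
    and div: "\<And>x. divV b x = 0"
    and face: "\<And>e x. e \<in> Fs \<Longrightarrow> x \<in> \<psi> e ` T \<Longrightarrow> b x = 0"
  shows "b x = 0"
proof -
  have lbi: "lip_on K (\<lambda>x. b x $ i)" for i by (rule lip_vpoly[OF vpoly_space_nth[OF b]])
  have bp: "(\<lambda>x. b x $ j) \<in> poly_space k" for j using vpoly_space_nth[OF b] by simp
  have ld: "lip_on K (\<lambda>x. pd i (\<lambda>y. b y $ j) x)" for i j
    using lip_vpoly[of "pd i (\<lambda>y. b y $ j)" k] poly_space_pd[OF bp] by simp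
  \<comment> \<open>Mixed derivatives of polynomials commute, so each derivative of \<open>b\<close>
    is again divergence free.\<close>
  have div2: "(\<Sum>j\<in>UNIV. pd j (\<lambda>x. pd i (\<lambda>y. b y $ j) x) x) = 0" for i x
  proof -
    have "(\<Sum>j\<in>UNIV. pd j (pd i (\<lambda>y. b y $ j)) x) = (\<Sum>j\<in>UNIV. pd i (pd j (\<lambda>y. b y $ j)) x)"
      by (intro sum.cong refl pd_commute[OF bp])
    also have "\<dots> = pd i (\<lambda>y. \<Sum>j\<in>UNIV. pd j (\<lambda>y. b y $ j) y) x"
      by (rule pd_eqI[symmetric]) (intro has_vector_derivative_sum poly_space_has_pd[of _ k] poly_space_pd bp)
    also have "\<dots> = pd i (\<lambda>y. 0) x" using div by (simp add: divV_def)
    also have "\<dots> = 0" by (rule pd_eqI) simp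
    finally show ?thesis by simp
  qed
  have cont: "continuous_on K (\<lambda>x. b x $ i)" "continuous_on K (pd i (\<lambda>y. b y $ j))" for i j
    using lip_on_continuous[OF lbi] lip_on_continuous[OF ld] by auto
  have z: "vint K (\<lambda>x. \<Sum>j\<in>UNIV. pdv j b x $ i * pdv i b x $ j) = 0" for i
  proof -
    have "bnd (\<lambda>e x. \<Sum>j\<in>UNIV. (b x $ i \<bullet> pd i (\<lambda>y. b y $ j) x) * nr e $ j) = bnd (\<lambda>e x. 0)"
      by (rule bnd_cong) (simp add: face)
    moreover have "(\<Sum>j\<in>UNIV. b x $ i \<bullet> pdv j (\<lambda>x. pd i (\<lambda>y. b y $ j) x) x) = 0" for x
      using div2[of i x] by (simp add: sum_distrib_left[symmetric])
    ultimately show ?thesis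
      using ibp_sum[of "\<lambda>j x. b x $ i" "\<lambda>j x. pd i (\<lambda>y. b y $ j) x", OF lbi ld]
      by (simp add: pdv_nth)
  qed
  have pz: "pdv i b x = 0" for i x
  proof -
    have "(\<Sum>j\<in>UNIV. pdv j b x $ i * pdv i b x $ j) = pdv i b x \<bullet> pdv i b x" for x
      using sym by (simp add: inner_vec_def)
    then have "vint K (\<lambda>x. pdv i b x \<bullet> pdv i b x) = 0" using z[of i] by simp
    then show ?thesis by (rule vpoly_zero_of_vint[OF vpoly_space_pdv[OF b]])
  qed
  obtain e q where "e \<in> Fs" "q \<in> T" using Fs(2) T(3) interior_subset by blast
  then have "b (\<psi> e q) = 0" using face by blast
  then show ?thesis using vpoly_space_constant_of_pdv_zero[OF b pz, of x "\<psi> e q"] by simp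
qed

end

section \<open>The homogeneous problem\<close>

text \<open>The type \<open>'h\<close> holds the values of the curl: scalars in the plane, vectors
  in space. \<open>cVH_inner\<close> is the cyclic rule for the triple product,
  \<open>cVH_cVV\<close> the double cross product with a unit vector, and
  \<open>curl_zero_sym\<close> turns a vanishing curl into a symmetric Jacobian.\<close>

locale hdg_cell = gauss_cell K Fs a T \<psi> nr ctr
  for K :: "(real^'n) set" and Fs :: "'f set" and a :: "'f \<Rightarrow> real"
    and T :: "'q::euclidean_space set" and \<psi> :: "'f \<Rightarrow> 'q \<Rightarrow> real^'n" and nr :: "'f \<Rightarrow> real^'n"
    and ctr :: "real^'n" +
  fixes cVV :: "real^'n \<Rightarrow> real^'n \<Rightarrow> 'h::euclidean_space" and cVH :: "real^'n \<Rightarrow> 'h \<Rightarrow> real^'n"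
    and curlV :: "(real^'n \<Rightarrow> real^'n) \<Rightarrow> real^'n \<Rightarrow> 'h" and curlH :: "(real^'n \<Rightarrow> 'h) \<Rightarrow> real^'n \<Rightarrow> real^'n"
  assumes dim: "2 \<le> CARD('n)"
    and bilinear_cVV: "bounded_bilinear cVV" and bilinear_cVH: "bounded_bilinear cVH"
    and cVH_inner: "\<And>c h v. cVH c h \<bullet> v = h \<bullet> cVV v c"
    and cVV_anti: "\<And>c v. cVV c v = - cVV v c"
    and cVH_cVV: "\<And>n v. norm n = 1 \<Longrightarrow> cVH n (cVV n v) = (v \<bullet> n) *\<^sub>R n - v"
    and curlV_eq: "\<And>v x. curlV v x = (\<Sum>j\<in>UNIV. cVV (axis j 1) (pdv j v x))"
    and curlH_eq: "\<And>h x. curlH h x = (\<Sum>j\<in>UNIV. cVH (axis j 1) (pdv j h x))"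
    and curl_zero_sym: "\<And>D :: 'n \<Rightarrow> real^'n. (\<Sum>j\<in>UNIV. cVV (axis j 1) (D j)) = 0 \<Longrightarrow> D j $ i = D i $ j"
begin

lemmas cVV_simps = bounded_bilinear.add_left[OF bilinear_cVV] bounded_bilinear.add_right[OF bilinear_cVV]
  bounded_bilinear.diff_left[OF bilinear_cVV] bounded_bilinear.diff_right[OF bilinear_cVV]
  bounded_bilinear.scaleR_left[OF bilinear_cVV] bounded_bilinear.scaleR_right[OF bilinear_cVV]
  bounded_bilinear.zero_left[OF bilinear_cVV] bounded_bilinear.zero_right[OF bilinear_cVV]
  bounded_bilinear.minus_left[OF bilinear_cVV] bounded_bilinear.minus_right[OF bilinear_cVV]

lemmas cVH_simps = bounded_bilinear.add_left[OF bilinear_cVH] bounded_bilinear.add_right[OF bilinear_cVH]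
  bounded_bilinear.diff_left[OF bilinear_cVH] bounded_bilinear.diff_right[OF bilinear_cVH]
  bounded_bilinear.scaleR_left[OF bilinear_cVH] bounded_bilinear.scaleR_right[OF bilinear_cVH]
  bounded_bilinear.zero_left[OF bilinear_cVH] bounded_bilinear.zero_right[OF bilinear_cVH]
  bounded_bilinear.minus_left[OF bilinear_cVH] bounded_bilinear.minus_right[OF bilinear_cVH]

lemmas cont_cVV = bounded_bilinear.continuous_on[OF bilinear_cVV]
lemmas cont_cVH = bounded_bilinear.continuous_on[OF bilinear_cVH]

lemma cVV_self: "cVV v v = 0"
proof -
  have "cVV v v + cVV v v = 0" using cVV_anti[of v v] by (simp add: eq_neg_iff_add_eq_0)
  then have "2 *\<^sub>R cVV v v = 0" unfolding scaleR_2 .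
  then show ?thesis by simp
qed

lemma tang_eq: "norm n = 1 \<Longrightarrow> tang cVH cVV n v = v - (v \<bullet> n) *\<^sub>R n"
  by (simp add: tang_def cVH_cVV)

lemma tang_inner: "norm n = 1 \<Longrightarrow> tang cVH cVV n v \<bullet> v = tang cVH cVV n v \<bullet> tang cVH cVV n v"
  using dot_square_norm[of n] by (simp add: tang_eq inner_diff_left inner_diff_right inner_commute)

lemma cVV_tang: "norm n = 1 \<Longrightarrow> cVV n (tang cVH cVV n v) = cVV n v"
  by (simp add: tang_eq cVV_simps cVV_self)

lemma continuous_on_tang: "continuous_on S f \<Longrightarrow> continuous_on S (\<lambda>x. tang cVH cVV n (f x))"
  unfolding tang_def by (intro continuous_intros cont_cVH cont_cVV)

lemma vpoly_space_curlV:
  assumes "v \<in> vpoly_space k" shows "curlV v \<in> vpoly_space k"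
  unfolding curlV_eq[abs_def]
  using bounded_bilinear.bounded_linear_right[OF bilinear_cVV]
  by (intro vpoly_space_sum vpoly_space_linear[where T = "cVV _", OF vpoly_space_pdv[OF assms]])
    (simp add: linear_conv_bounded_linear)

lemma vpoly_space_curlH:
  assumes "v \<in> vpoly_space k" shows "curlH v \<in> vpoly_space k"
  unfolding curlH_eq[abs_def]
  using bounded_bilinear.bounded_linear_right[OF bilinear_cVH]
  by (intro vpoly_space_sum vpoly_space_linear[where T = "cVH _", OF vpoly_space_pdv[OF assms]])
    (simp add: linear_conv_bounded_linear)

text \<open>\<open>A\<close> will be a product \<open>v x d\<close> with Lipschitz \<open>d\<close>,
  so integrability of its curl needs its own statement. The cross product with a fixed axis is
  linear and commutes with the derivative wherever that exists.\<close>

lemma ibp_curl: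
  assumes A: "lip_on K A" and b: "lip_on K b"
  shows "set_integrable lebesgue K (\<lambda>x. b x \<bullet> curlH A x)"
    and "vint K (\<lambda>x. b x \<bullet> curlH A x) - vint K (\<lambda>x. A x \<bullet> curlV b x) = bnd (\<lambda>e x. cVH (nr e) (A x) \<bullet> b x)"
proof -
  have lin: "bounded_linear (cVH c)" for c by (rule bounded_bilinear.bounded_linear_right[OF bilinear_cVH])
  have LA: "lip_on K (\<lambda>x. cVH (axis j 1) (A x))" for j by (rule lip_on_linear[OF lin A])
  have i: "set_integrable lebesgue K (\<lambda>x. \<Sum>j\<in>UNIV. pdv j (\<lambda>x. cVH (axis j 1) (A x)) x \<bullet> b x)"
    by (intro set_integrable_sum set_integrable_pdv_inner LA lip_on_continuous[OF b])
  have ae: "AE x in lebesgue. x \<in> K \<longrightarrow> (\<Sum>j\<in>UNIV. pdv j (\<lambda>x. cVH (axis j 1) (A x)) x \<bullet> b x) = b x \<bullet> curlH A x"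
    using AE_has_pdv[OF A]
    by eventually_elim (simp add: pdv_linear[OF lin] curlH_eq inner_sum_right inner_commute)
  show "set_integrable lebesgue K (\<lambda>x. b x \<bullet> curlH A x)" by (rule vint_cong_AE(1)[OF i ae])
  \<comment> \<open>The sign comes from reversing the cross product after the cyclic rule; it
    produces the minus in the Green formula.\<close>
  have 2: "(\<Sum>j\<in>UNIV. cVH (axis j 1) (A x) \<bullet> pdv j b x) = - (A x \<bullet> curlV b x)" for x
    using cVV_anti[of _ "axis _ 1"] by (simp add: cVH_inner curlV_eq inner_sum_right sum_negf[symmetric])
  have n: "(\<Sum>j\<in>UNIV. (cVH (axis j 1) (A x) \<bullet> b x) * nr e $ j) = cVH (nr e) (A x) \<bullet> b x" for e x
  proof -
    have "cVH (nr e) (A x) = (\<Sum>j\<in>UNIV. (nr e $ j) *\<^sub>R cVH (axis j 1) (A x))"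
      using bounded_bilinear.sum_left[OF bilinear_cVH, of "\<lambda>j. (nr e $ j) *\<^sub>R axis j 1" UNIV "A x"]
      by (simp add: vec_expand_axis[symmetric] cVH_simps)
    then show ?thesis by (simp add: inner_sum_left mult.commute)
  qed
  show "vint K (\<lambda>x. b x \<bullet> curlH A x) - vint K (\<lambda>x. A x \<bullet> curlV b x) = bnd (\<lambda>e x. cVH (nr e) (A x) \<bullet> b x)"
    using ibp_sum[of "\<lambda>j x. cVH (axis j 1) (A x)" "\<lambda>j. b", OF LA b]
    unfolding n 2 vint_cong_AE(2)[OF i ae] vint_minus by simp
qed

abbreviation "hdg_system k \<equiv> hdg_local_system cVV cVH curlV curlH k K Fs (\<lambda>e. param_int (a e) T (\<psi> e)) nr"

text \<open>Inside \<open>K\<close> the energy identity controls only \<open>L\<close>,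
  \<open>H\<close> and the mean of \<open>p\<close>; the other fields are reached by testing with
  derivatives of the solution. The order matters: \<open>u = 0\<close> and \<open>curl b = 0\<close>
  clear the second equation before the test with \<open>grad p\<close>, and \<open>r = 0\<close>
  precedes the test with \<open>div b\<close>, whose boundary term is then exactly the one produced
  by parts.\<close>

lemma homogeneous_solution_zero:
  assumes pos: "Rey > 0" "Rm > 0" "\<kappa> > 0" "\<alpha>2 > 0" "\<alpha>3 > 0"
    and dd: "lip_on K dd" and w: "lip_on K w" and div: "AE x in lebesgue. x \<in> K \<longrightarrow> divV w x = 0"
    and \<alpha>1: "\<And>x. x \<in> K \<Longrightarrow> norm (w x) < 2 * \<alpha>1"
    and L: "L \<in> vpoly_space k" and u: "u \<in> vpoly_space k" and p: "p \<in> vpoly_space k"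
    and H: "H \<in> vpoly_space k" and b: "b \<in> vpoly_space k" and r: "r \<in> vpoly_space k"
    and sys: "hdg_system k Rey Rm \<kappa> dd w \<alpha>1 \<alpha>2 \<alpha>3 (\<lambda>e x. 0) (\<lambda>e x. 0) (\<lambda>e x. 0) (\<lambda>x. 0) (\<lambda>x. 0) 0 L u p H b r"
  shows "L x = 0 \<and> u x = 0 \<and> p x = 0 \<and> H x = 0 \<and> b x = 0 \<and> r x = 0"
proof -
  let ?tn = "\<lambda>e v. tang cVH cVV (nr e) v"
  let ?vol = "measure lebesgue K"
  have cL: "continuous_on S L" and cu: "continuous_on S u" and cp: "continuous_on S p"
    and cH: "continuous_on S H" and cb: "continuous_on S b" and cr: "continuous_on S r" for S
    using L u p H b r by (auto intro: vpoly_space_continuous)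
  have cdd: "continuous_on K dd" and cw: "continuous_on K w"
    using dd w by (auto intro: lip_on_continuous)
  have lL: "lip_on K L" and lu: "lip_on K u" and lp: "lip_on K p" and lH: "lip_on K H"
    and lb: "lip_on K b" and lr: "lip_on K r"
    using L u p H b r by (auto intro: lip_vpoly)
  have cmv: "continuous_on S (\<lambda>x. L x *v y)" for S y
    using linear_continuous_on_compose[OF cL linear_matrix_vector_mul_left] by simp
  have out0: "outerp 0 y = 0" for y :: "real^'n" by (simp add: outerp_def vec_eq_iff)
  note E = sys[unfolded hdg_local_system_def Let_def, folded bnd_def, simplified out0 inner_zero_left inner_zero_right
     add_0_right diff_0_right mult_zero_left mult_zero_right scaleR_zero_left scaleR_zero_right cVV_simps cVH_simps vint_zero bnd_zero]
  have E1: "Rey * vint K (\<lambda>x. L x \<bullet> G x) + vint K (\<lambda>x. u x \<bullet> divM G x) = 0" if "G \<in> vpoly_space k" for G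
    using E that by (simp add: out0)
  have E2: "vint K (\<lambda>x. L x \<bullet> gradV v x) - vint K (\<lambda>x. p x * divV v x)
      - vint K (\<lambda>x. outerp (u x) (w x) \<bullet> gradV v x)
      + \<kappa> * vint K (\<lambda>x. b x \<bullet> curlH (\<lambda>y. cVV (v y) (dd y)) x)
      + bnd (\<lambda>e x. (- (L x *v nr e) + (w x \<bullet> nr e) *\<^sub>R u x + p x *\<^sub>R nr e
            + (1/2 * \<kappa>) *\<^sub>R cVH (dd x) (cVV (nr e) (?tn e (b x)))
            + \<alpha>1 *\<^sub>R u x) \<bullet> v x) = 0" if "v \<in> vpoly_space k" for v
    using E that by simp
  have E3: "- vint K (\<lambda>x. u x \<bullet> gradS q x) + vint K (\<lambda>x. p x * (vint K q / ?vol)) = 0"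
    if "q \<in> vpoly_space k" for q
    using E that by simp
  have E4: "(Rm / \<kappa>) * vint K (\<lambda>x. H x \<bullet> J x) - vint K (\<lambda>x. b x \<bullet> curlH J x) = 0"
    if "J \<in> vpoly_space k" for J
    using E that by simp
  have E5: "vint K (\<lambda>x. H x \<bullet> curlV c x) - vint K (\<lambda>x. r x * divV c x)
      - \<kappa> * vint K (\<lambda>x. u x \<bullet> cVH (dd x) (curlV c x))
      + bnd (\<lambda>e x. (cVH (nr e) (H x) - (1/2 * \<kappa>) *\<^sub>R cVH (nr e) (cVV (u x) (dd x))
            + \<alpha>2 *\<^sub>R ?tn e (b x)) \<bullet> c x) = 0" if "c \<in> vpoly_space k" for c
    using E that by simp
  have E6: "- vint K (\<lambda>x. b x \<bullet> gradS s x) + bnd (\<lambda>e x. (b x \<bullet> nr e + \<alpha>3 * r x) * s x) = 0"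
    if "s \<in> vpoly_space k" for s
    using E that by simp
  \<comment> \<open>The field \<open>u x d\<close> is merely Lipschitz; every magnetic coupling
    between \<open>u\<close> and \<open>b\<close> is expressed through it.\<close>
  define A where "A x = cVV (u x) (dd x)" for x
  have lA: "lip_on K A" unfolding A_def by (rule lip_on_bilinear[OF bilinear_cVV K(1) lu dd])
  have cA: "continuous_on K A" by (rule lip_on_continuous[OF lA])
  \<comment> \<open>Because \<open>n x b\<close> depends only on the tangential part of
    \<open>b\<close>, both boundary couplings of \<open>u\<close> and \<open>b\<close> reduce to
    this one pairing.\<close>
  define X where "X = bnd (\<lambda>e x. A x \<bullet> cVV (nr e) (b x))"
  define Bm where "Bm = bnd (\<lambda>e x. (w x \<bullet> nr e) * (u x \<bullet> u x))"
  define Bu where "Bu = bnd (\<lambda>e x. u x \<bullet> u x)"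
  define Bt where "Bt = bnd (\<lambda>e x. ?tn e (b x) \<bullet> ?tn e (b x))"
  define Br where "Br = bnd (\<lambda>e x. r x * r x)"
  define BL where "BL = bnd (\<lambda>e x. (L x *v nr e) \<bullet> u x)"
  define Bp where "Bp = bnd (\<lambda>e x. (p x *\<^sub>R nr e) \<bullet> u x)"
  define BH where "BH = bnd (\<lambda>e x. cVH (nr e) (H x) \<bullet> b x)"
  define Bb where "Bb = bnd (\<lambda>e x. (r x *\<^sub>R nr e) \<bullet> b x)"
  have crossX: "cVH (nr e) (A x) \<bullet> b x = - (A x \<bullet> cVV (nr e) (b x))" for e x
    using cVV_anti[of "b x" "nr e"] by (simp add: cVH_inner)
  have split2: "bnd (\<lambda>e x. (- (L x *v nr e) + (w x \<bullet> nr e) *\<^sub>R u x + p x *\<^sub>R nr e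
            + (1/2 * \<kappa>) *\<^sub>R cVH (dd x) (cVV (nr e) (?tn e (b x)))
            + \<alpha>1 *\<^sub>R u x) \<bullet> u x) = - BL + Bm + Bp + (1/2 * \<kappa>) * X + \<alpha>1 * Bu"
  proof -
    have "bnd (\<lambda>e x. (- (L x *v nr e) + (w x \<bullet> nr e) *\<^sub>R u x + p x *\<^sub>R nr e
            + (1/2 * \<kappa>) *\<^sub>R cVH (dd x) (cVV (nr e) (?tn e (b x))) + \<alpha>1 *\<^sub>R u x) \<bullet> u x)
      = bnd (\<lambda>e x. - ((L x *v nr e) \<bullet> u x) + (w x \<bullet> nr e) * (u x \<bullet> u x) + (p x *\<^sub>R nr e) \<bullet> u x
            + (1/2 * \<kappa>) * (A x \<bullet> cVV (nr e) (b x)) + \<alpha>1 * (u x \<bullet> u x))"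
    proof (rule bnd_cong)
      fix e x assume "e \<in> Fs" "x \<in> \<psi> e ` T"
      then have "cVH (dd x) (cVV (nr e) (?tn e (b x))) \<bullet> u x = A x \<bullet> cVV (nr e) (b x)"
        using cVH_inner[of "dd x" "cVV (nr e) (b x)" "u x"] by (simp add: cVV_tang nr_unit A_def inner_commute)
      then show "(- (L x *v nr e) + (w x \<bullet> nr e) *\<^sub>R u x + p x *\<^sub>R nr e
            + (1/2 * \<kappa>) *\<^sub>R cVH (dd x) (cVV (nr e) (?tn e (b x))) + \<alpha>1 *\<^sub>R u x) \<bullet> u x
         = - ((L x *v nr e) \<bullet> u x) + (w x \<bullet> nr e) * (u x \<bullet> u x) + (p x *\<^sub>R nr e) \<bullet> u x
            + (1/2 * \<kappa>) * (A x \<bullet> cVV (nr e) (b x)) + \<alpha>1 * (u x \<bullet> u x)"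
        by (simp only: inner_add_left inner_minus_left inner_scaleR_left)
    qed
    also have "\<dots> = - BL + Bm + Bp + (1/2 * \<kappa>) * X + \<alpha>1 * Bu"
      unfolding BL_def Bm_def Bp_def X_def Bu_def
      by (subst bnd_add bnd_minus bnd_cmul; (intro bcontI continuous_intros cmv cu cp cw cA cb cont_cVV)?)+ simp
    finally show ?thesis .
  qed
  have split5: "bnd (\<lambda>e x. (cVH (nr e) (H x) - (1/2 * \<kappa>) *\<^sub>R cVH (nr e) (cVV (u x) (dd x))
            + \<alpha>2 *\<^sub>R ?tn e (b x)) \<bullet> b x) = BH + (1/2 * \<kappa>) * X + \<alpha>2 * Bt"
  proof -
    have "bnd (\<lambda>e x. (cVH (nr e) (H x) - (1/2 * \<kappa>) *\<^sub>R cVH (nr e) (cVV (u x) (dd x))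
            + \<alpha>2 *\<^sub>R ?tn e (b x)) \<bullet> b x)
      = bnd (\<lambda>e x. cVH (nr e) (H x) \<bullet> b x + (1/2 * \<kappa>) * (A x \<bullet> cVV (nr e) (b x))
            + \<alpha>2 * (?tn e (b x) \<bullet> ?tn e (b x)))"
    proof (rule bnd_cong)
      fix e x assume "e \<in> Fs" "x \<in> \<psi> e ` T"
      then show "(cVH (nr e) (H x) - (1/2 * \<kappa>) *\<^sub>R cVH (nr e) (cVV (u x) (dd x)) + \<alpha>2 *\<^sub>R ?tn e (b x)) \<bullet> b x
        = cVH (nr e) (H x) \<bullet> b x + (1/2 * \<kappa>) * (A x \<bullet> cVV (nr e) (b x)) + \<alpha>2 * (?tn e (b x) \<bullet> ?tn e (b x))"
        using crossX[of e x] tang_inner[OF nr_unit, of e "b x"]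
        by (simp add: inner_add_left inner_diff_left A_def)
    qed
    also have "\<dots> = BH + (1/2 * \<kappa>) * X + \<alpha>2 * Bt"
      unfolding BH_def X_def Bt_def
      by (subst bnd_add bnd_cmul; (intro bcontI continuous_intros cH cA cb cont_cVV cont_cVH continuous_on_tang)?)+ simp
    finally show ?thesis .
  qed
  have split6: "bnd (\<lambda>e x. (b x \<bullet> nr e + \<alpha>3 * r x) * r x) = Bb + \<alpha>3 * Br"
  proof -
    have "bnd (\<lambda>e x. (b x \<bullet> nr e + \<alpha>3 * r x) * r x) = bnd (\<lambda>e x. (r x *\<^sub>R nr e) \<bullet> b x + \<alpha>3 * (r x * r x))"
      by (rule bnd_cong) (simp add: algebra_simps inner_commute)
    also have "\<dots> = Bb + \<alpha>3 * Br"
      unfolding Bb_def Br_def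
      by (subst bnd_add bnd_cmul; (intro bcontI continuous_intros cb cr)?)+ simp
    finally show ?thesis .
  qed
  \<comment> \<open>Since \<open>u . (d x c) = (u x d) . c\<close>, the coupling of the fifth
    equation involves the same field \<open>A\<close> as that of the second.\<close>
  have curlcross: "vint K (\<lambda>x. u x \<bullet> cVH (dd x) (curlV b x)) = vint K (\<lambda>x. A x \<bullet> curlV b x)"
  proof (rule vint_cong)
    fix x
    show "u x \<bullet> cVH (dd x) (curlV b x) = A x \<bullet> curlV b x"
      using cVH_inner[of "dd x" "curlV b x" "u x"] by (simp add: A_def inner_commute)
  qed
  have crossXb: "bnd (\<lambda>e x. cVH (nr e) (A x) \<bullet> b x) = - X"
    unfolding crossX X_def by (rule bnd_minus)
  define VL where "VL = vint K (\<lambda>x. L x \<bullet> L x)"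
  define VH where "VH = vint K (\<lambda>x. H x \<bullet> H x)"
  define P where "P = vint K p"
  have vol: "?vol > 0"
  proof -
    have "negligible K \<Longrightarrow> False" using K(3) interior_subset[of K] negligible_subset open_not_negligible[OF open_interior] by blast
    then have "?vol \<noteq> 0" using negligible_iff_measure0[OF lmeasurable_compact[OF K(1)]] by blast
    then show ?thesis using measure_nonneg[of lebesgue K] by (simp add: less_le)
  qed
  have VP: "vint K (\<lambda>x. p x * (P / ?vol)) = P * P / ?vol"
    using vint_cmul[of K "P / ?vol" p] by (simp add: P_def mult.commute)
  have conv: "2 * vint K (\<lambda>x. outerp (u x) (w x) \<bullet> gradV u x) = Bm"
    unfolding Bm_def by (rule ibp_convection[OF u w div])
  have eqs: "Rey * VL + vint K (\<lambda>x. u x \<bullet> divM L x) = 0"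
    "vint K (\<lambda>x. L x \<bullet> gradV u x) + vint K (\<lambda>x. u x \<bullet> divM L x) = BL"
    "vint K (\<lambda>x. p x * divV u x) + vint K (\<lambda>x. u x \<bullet> gradS p x) = Bp"
    "vint K (\<lambda>x. r x * divV b x) + vint K (\<lambda>x. b x \<bullet> gradS r x) = Bb"
    "vint K (\<lambda>x. b x \<bullet> curlH H x) - vint K (\<lambda>x. H x \<bullet> curlV b x) = BH"
    "- vint K (\<lambda>x. u x \<bullet> gradS p x) + P * P / ?vol = 0"
    "(Rm / \<kappa>) * VH - vint K (\<lambda>x. b x \<bullet> curlH H x) = 0"
    using E1[OF L] ibp_gradV[OF lL lu] ibp_divV[OF lp lu] ibp_divV[OF lr lb] ibp_curl(2)[OF lH lb] E3[OF p] E4[OF H] VP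
    unfolding VL_def BL_def Bp_def Bb_def BH_def P_def VH_def by (simp_all add: inner_commute)
  have eA: "vint K (\<lambda>x. b x \<bullet> curlH A x) - vint K (\<lambda>x. A x \<bullet> curlV b x) = - X"
    using ibp_curl(2)[OF lA lb] crossXb by simp
  have eA': "\<kappa> * vint K (\<lambda>x. b x \<bullet> curlH A x) - \<kappa> * vint K (\<lambda>x. A x \<bullet> curlV b x) = - (\<kappa> * X)"
    using eA by (simp flip: right_diff_distrib)
  have e2: "vint K (\<lambda>x. L x \<bullet> gradV u x) - vint K (\<lambda>x. p x * divV u x)
      - vint K (\<lambda>x. outerp (u x) (w x) \<bullet> gradV u x)
      + \<kappa> * vint K (\<lambda>x. b x \<bullet> curlH A x) + (- BL + Bm + Bp + (1/2 * \<kappa>) * X + \<alpha>1 * Bu) = 0"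
    using E2[OF u] unfolding split2 A_def[abs_def] .
  have e5: "vint K (\<lambda>x. H x \<bullet> curlV b x) - vint K (\<lambda>x. r x * divV b x)
      - \<kappa> * vint K (\<lambda>x. A x \<bullet> curlV b x) + (BH + (1/2 * \<kappa>) * X + \<alpha>2 * Bt) = 0"
    using E5[OF b] unfolding split5 curlcross .
  have e6: "- vint K (\<lambda>x. b x \<bullet> gradS r x) + (Bb + \<alpha>3 * Br) = 0"
    using E6[OF r] unfolding split6 .
  \<comment> \<open>The volume couplings leave \<open>- \<kappa> X\<close>, balanced by
    \<open>\<kappa> X / 2\<close> from each of two boundary terms. Convection reduces
    \<open>Bm\<close> to \<open>Bm / 2\<close>, and the pressure contribution becomes
    \<open>P^2 / vol\<close> through the mean-value term of the third equation.\<close>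
  have energy: "Rey * VL + P * P / ?vol + (1/2 * Bm + \<alpha>1 * Bu) + (Rm / \<kappa>) * VH + \<alpha>2 * Bt + \<alpha>3 * Br = 0"
    using eqs eA' e2 e5 e6 conv by linarith
  have wpos: "0 < \<alpha>1 + (w x \<bullet> nr e) / 2" if "e \<in> Fs" "x \<in> \<psi> e ` T" for e x
  proof -
    have "\<bar>w x \<bullet> nr e\<bar> \<le> norm (w x) * norm (nr e)" by (rule Cauchy_Schwarz_ineq2)
    moreover have "x \<in> K" using \<psi>_K that by blast
    ultimately show ?thesis using \<alpha>1[of x] nr_unit[OF that(1)] by auto
  qed
  have bc: "bcont (\<lambda>e x. (\<alpha>1 + (w x \<bullet> nr e) / 2) * (u x \<bullet> u x))"
    by (intro bcontI continuous_intros cw cu) auto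
  have Bmu: "1/2 * Bm + \<alpha>1 * Bu = bnd (\<lambda>e x. (\<alpha>1 + (w x \<bullet> nr e) / 2) * (u x \<bullet> u x))"
  proof -
    have "bnd (\<lambda>e x. (\<alpha>1 + (w x \<bullet> nr e) / 2) * (u x \<bullet> u x)) =
        bnd (\<lambda>e x. 1/2 * ((w x \<bullet> nr e) * (u x \<bullet> u x)) + \<alpha>1 * (u x \<bullet> u x))"
      by (rule bnd_cong) (simp add: algebra_simps)
    also have "\<dots> = 1/2 * Bm + \<alpha>1 * Bu"
      unfolding Bm_def Bu_def
      by (subst bnd_add bnd_cmul; (intro bcontI continuous_intros cu cw)?)+ simp
    finally show ?thesis by simp
  qed
  have nonneg: "0 \<le> VL" "0 \<le> P * P / ?vol" "0 \<le> 1/2 * Bm + \<alpha>1 * Bu" "0 \<le> VH" "0 \<le> Bt" "0 \<le> Br"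
  proof -
    show "0 \<le> VL" "0 \<le> VH" unfolding VL_def VH_def by (rule vint_nonneg, simp)+
    show "0 \<le> Bt" "0 \<le> Br" unfolding Bt_def Br_def by (rule bnd_nonneg, simp)+
    show "0 \<le> P * P / ?vol" using vol by simp
    show "0 \<le> 1/2 * Bm + \<alpha>1 * Bu"
      unfolding Bmu by (intro bnd_nonneg mult_nonneg_nonneg less_imp_le[OF wpos]) auto
  qed
  have nn: "0 \<le> Rey * VL" "0 \<le> (Rm / \<kappa>) * VH" "0 \<le> \<alpha>2 * Bt" "0 \<le> \<alpha>3 * Br"
    using nonneg pos by simp_all
  have zero: "VL = 0" "P = 0" "1/2 * Bm + \<alpha>1 * Bu = 0" "VH = 0" "Bt = 0" "Br = 0"
  proof -
    have "Rey * VL = 0" "P * P / ?vol = 0" "(Rm / \<kappa>) * VH = 0" "\<alpha>2 * Bt = 0" "\<alpha>3 * Br = 0"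
      and "1/2 * Bm + \<alpha>1 * Bu = 0"
      using energy nn nonneg by linarith+
    then show "VL = 0" "P = 0" "1/2 * Bm + \<alpha>1 * Bu = 0" "VH = 0" "Bt = 0" "Br = 0"
      using pos vol by simp_all
  qed
  have L0: "L x = 0" for x using vpoly_zero_of_vint[OF L zero(1)[unfolded VL_def]] .
  have H0: "H x = 0" for x using vpoly_zero_of_vint[OF H zero(4)[unfolded VH_def]] .
  have uf: "u x = 0" if "e \<in> Fs" "x \<in> \<psi> e ` T" for e x
  proof -
    have "(\<alpha>1 + (w x \<bullet> nr e) / 2) * (u x \<bullet> u x) = 0"
    proof (rule bnd_zero_imp_zero[OF bc _ zero(3)[unfolded Bmu] that])
      show "0 \<le> (\<alpha>1 + (w x \<bullet> nr e) / 2) * (u x \<bullet> u x)" if "e \<in> Fs" "x \<in> \<psi> e ` T" for e x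
        by (intro mult_nonneg_nonneg less_imp_le[OF wpos[OF that]]) simp
    qed
    then show ?thesis using wpos[OF that] by simp
  qed
  have tf: "?tn e (b x) = 0" if "e \<in> Fs" "x \<in> \<psi> e ` T" for e x
  proof -
    have bct: "bcont (\<lambda>e x. ?tn e (b x) \<bullet> ?tn e (b x))"
      by (intro bcontI continuous_intros continuous_on_tang cb)
    have "?tn e (b x) \<bullet> ?tn e (b x) = 0"
      by (rule bnd_zero_imp_zero[OF bct _ zero(5)[unfolded Bt_def] that]) simp
    then show ?thesis by simp
  qed
  have nbf: "cVV (nr e) (b x) = 0" if "e \<in> Fs" "x \<in> \<psi> e ` T" for e x
    using tf[OF that] cVV_tang[OF nr_unit[OF that(1)], of "b x"] by (simp add: cVV_simps)
  have rf: "r x = 0" if "e \<in> Fs" "x \<in> \<psi> e ` T" for e x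
  proof -
    have bcr: "bcont (\<lambda>e x. r x * r x)" by (intro bcontI continuous_intros cr)
    have "r x * r x = 0"
      by (rule bnd_zero_imp_zero[OF bcr _ zero(6)[unfolded Br_def] that]) simp
    then show ?thesis by simp
  qed
  obtain e0 x0 where x0: "e0 \<in> Fs" "x0 \<in> \<psi> e0 ` T" using Fs(2) T(3) interior_subset by blast
  have const_scalar: "q x = q y" if q: "q \<in> vpoly_space k" and z: "\<And>x. gradS q x = 0" for q :: "real^'n \<Rightarrow> real" and x y
  proof (rule vpoly_space_constant_of_pdv_zero[OF q])
    show "pdv j q x = 0" for j x using z[of x] by (simp add: gradS_def vec_eq_iff)
  qed
  \<comment> \<open>With \<open>L = 0\<close> the first equation tested by \<open>gradV u\<close>
    reads \<open>(u, div grad u) = 0\<close>; the zero trace of \<open>u\<close> turns this into a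
    vanishing norm of the gradient.\<close>
  have u0: "u x = 0" for x
  proof -
    have gu: "gradV u \<in> vpoly_space k" by (rule vpoly_space_gradV[OF u])
    have "vint K (\<lambda>x. u x \<bullet> divM (gradV u) x) = 0" using E1[OF gu] L0 by simp
    moreover have "bnd (\<lambda>e x. (gradV u x *v nr e) \<bullet> u x) = bnd (\<lambda>e x. 0)"
      by (rule bnd_cong) (simp add: uf)
    ultimately have "vint K (\<lambda>x. gradV u x \<bullet> gradV u x) = 0"
      using ibp_gradV[OF lip_vpoly[OF gu] lu] by simp
    then have "gradV u x = 0" for x by (rule vpoly_zero_of_vint[OF gu])
    then have "pdv j u x = 0" for j x by (simp add: gradV_def vec_eq_iff pdv_nth)
    then have "u x = u x0" by (rule vpoly_space_constant_of_pdv_zero[OF u])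
    then show ?thesis using uf[OF x0] by simp
  qed
  \<comment> \<open>With \<open>H = 0\<close> the fourth equation gives
    \<open>(b, curl curl b) = 0\<close>. Shifting one curl costs only a pairing with
    \<open>n x b\<close>, which is zero on the faces.\<close>
  have curlb: "curlV b x = 0" for x
  proof -
    have c: "curlV b \<in> vpoly_space k" by (rule vpoly_space_curlV[OF b])
    have "vint K (\<lambda>x. b x \<bullet> curlH (curlV b) x) = 0" using E4[OF c] H0 by simp
    moreover have "bnd (\<lambda>e x. cVH (nr e) (curlV b x) \<bullet> b x) = bnd (\<lambda>e x. 0)"
      by (rule bnd_cong) (simp add: cVH_inner cVV_anti[of "b _"] nbf)
    ultimately have "vint K (\<lambda>x. curlV b x \<bullet> curlV b x) = 0"
      using ibp_curl(2)[OF lip_vpoly[OF c] lb] by simp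
    then show ?thesis by (rule vpoly_zero_of_vint[OF c])
  qed
  \<comment> \<open>By parts the magnetic term pairs \<open>grad p x d\<close> with
    \<open>curl b\<close> and with \<open>n x b\<close>, both zero. What remains gives
    \<open>grad p = 0\<close>, and the zero mean removes the constant.\<close>
  have p0: "p x = 0" for x
  proof -
    have g: "gradS p \<in> vpoly_space k" by (rule vpoly_space_gradS[OF p])
    have lgd: "lip_on K (\<lambda>y. cVV (gradS p y) (dd y))"
      by (rule lip_on_bilinear[OF bilinear_cVV K(1) lip_vpoly[OF g] dd])
    have "bnd (\<lambda>e x. cVH (nr e) (cVV (gradS p x) (dd x)) \<bullet> b x) = bnd (\<lambda>e x. 0)"
      by (rule bnd_cong) (simp add: cVH_inner cVV_anti[of "b _"] nbf)
    then have 1: "vint K (\<lambda>x. b x \<bullet> curlH (\<lambda>y. cVV (gradS p y) (dd y)) x) = 0"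
      using ibp_curl(2)[OF lgd lb] curlb by simp
    have 2: "bnd (\<lambda>e x. (- (L x *v nr e) + (w x \<bullet> nr e) *\<^sub>R u x + p x *\<^sub>R nr e
            + (1/2 * \<kappa>) *\<^sub>R cVH (dd x) (cVV (nr e) (?tn e (b x))) + \<alpha>1 *\<^sub>R u x) \<bullet> gradS p x)
      = bnd (\<lambda>e x. (p x *\<^sub>R nr e) \<bullet> gradS p x)"
      by (rule bnd_cong) (simp add: tf L0 u0 cVV_simps cVH_simps)
    have "vint K (\<lambda>x. gradS p x \<bullet> gradS p x) = 0"
      using E2[OF g] ibp_divV[OF lp lip_vpoly[OF g]] unfolding 1 2 by (simp add: L0 u0 out0)
    then have "gradS p x = 0" for x by (rule vpoly_zero_of_vint[OF g])
    then have "p y = p x" for y by (rule const_scalar[OF p])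
    then have "P = vint K (\<lambda>y. p x * 1)" unfolding P_def by (intro vint_cong) simp
    also have "\<dots> = p x * ?vol" unfolding vint_cmul by (simp add: vint_def set_lebesgue_integral_def)
    finally show ?thesis using zero(2) vol by simp
  qed
  \<comment> \<open>Tested with \<open>grad r\<close>, the fifth equation retains only
    \<open>(r, div grad r) = 0\<close>, and the zero trace of \<open>r\<close> finishes as for
    \<open>u\<close>.\<close>
  have r0: "r x = 0" for x
  proof -
    have g: "gradS r \<in> vpoly_space k" by (rule vpoly_space_gradS[OF r])
    have "bnd (\<lambda>e x. (cVH (nr e) (H x) - (1/2 * \<kappa>) *\<^sub>R cVH (nr e) (cVV (u x) (dd x))
            + \<alpha>2 *\<^sub>R ?tn e (b x)) \<bullet> gradS r x) = bnd (\<lambda>e x. 0)"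
      by (rule bnd_cong) (simp add: tf H0 u0 cVV_simps cVH_simps)
    then have "vint K (\<lambda>x. r x * divV (gradS r) x) = 0"
      using E5[OF g] by (simp add: H0 u0)
    moreover have "bnd (\<lambda>e x. (r x *\<^sub>R nr e) \<bullet> gradS r x) = bnd (\<lambda>e x. 0)"
      by (rule bnd_cong) (simp add: rf)
    ultimately have "vint K (\<lambda>x. gradS r x \<bullet> gradS r x) = 0"
      using ibp_divV[OF lr lip_vpoly[OF g]] by simp
    then have "gradS r x = 0" for x by (rule vpoly_zero_of_vint[OF g])
    then have "r x = r x0" by (rule const_scalar[OF r])
    then show ?thesis using rf[OF x0] by simp
  qed
  have divb: "divV b x = 0" for x
  proof -
    have d: "divV b \<in> vpoly_space k" by (rule vpoly_space_divV[OF b])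
    have "bnd (\<lambda>e x. (b x \<bullet> nr e + \<alpha>3 * r x) * divV b x) = bnd (\<lambda>e x. (divV b x *\<^sub>R nr e) \<bullet> b x)"
      by (rule bnd_cong) (simp add: r0 inner_commute mult.commute)
    then have "vint K (\<lambda>x. divV b x \<bullet> divV b x) = 0"
      using E6[OF d] ibp_divV[OF lip_vpoly[OF d] lb] by (simp add: inner_commute)
    then show ?thesis by (rule vpoly_zero_of_vint[OF d])
  qed
  have sym: "pdv j b x $ i = pdv i b x $ j" for i j x
    using curl_zero_sym[of "\<lambda>j. pdv j b x" j i] curlb[of x] by (simp add: curlV_eq)
  have bn: "b x = (b x \<bullet> nr e) *\<^sub>R nr e" if "e \<in> Fs" "x \<in> \<psi> e ` T" for e x
    using tf[OF that] tang_eq[OF nr_unit[OF that(1)], of "b x"] by simp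
  have "b x = 0" if "e \<in> Fs" "x \<in> \<psi> e ` T" for e x
    by (rule rellich[OF b sym divb bn dim that])
  then have b0: "b x = 0" for x by (rule harmonic_field_zero[OF b sym divb])
  show ?thesis using L0 u0 p0 H0 b0 r0 by simp
qed

end

section \<open>Existence from uniqueness\<close>

text \<open>Gaussian elimination, by induction on the number of equations: a row with a nonzero
  entry \<open>A i j0\<close> is solved for the unknown \<open>j0\<close>, and substitution removes
  one equation and one unknown.\<close>

lemma underdetermined_system:
  fixes A :: "'i \<Rightarrow> 'j \<Rightarrow> real"
  assumes "finite I" "finite J" "card I < card J"
  shows "\<exists>x. (\<exists>j\<in>J. x j \<noteq> 0) \<and> (\<forall>i\<in>I. (\<Sum>j\<in>J. A i j * x j) = 0)"
  using assms
proof (induction I arbitrary: J A rule: finite_induct)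
  case empty
  then have "J \<noteq> {}" by auto
  then show ?case by (intro exI[of _ "\<lambda>_. 1"]) auto
next
  case (insert i I)
  show ?case
  proof (cases "\<forall>j\<in>J. A i j = 0")
    case True
    have "card I < card J" using insert by simp
    then obtain x where "\<exists>j\<in>J. x j \<noteq> 0" "\<forall>i\<in>I. (\<Sum>j\<in>J. A i j * x j) = 0"
      using insert.IH[OF insert.prems(1), of A] by blast
    then show ?thesis using True by (intro exI[of _ x]) simp
  next
    case False
    then obtain j0 where j0: "j0 \<in> J" "A i j0 \<noteq> 0" by blast
    let ?J = "J - {j0}"
    define B where "B i' j = A i' j - A i' j0 * A i j / A i j0" for i' j
    have "card I < card ?J" using insert j0 by simp
    then obtain x where x: "\<exists>j\<in>?J. x j \<noteq> 0" "\<forall>i\<in>I. (\<Sum>j\<in>?J. B i j * x j) = 0"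
      using insert.IH[of ?J B] insert.prems(1) by blast
    define s where "s = (\<Sum>j\<in>?J. A i j * x j) / A i j0"
    define y where "y = x(j0 := - s)"
    have sumy: "(\<Sum>j\<in>J. A i' j * y j) = (\<Sum>j\<in>?J. A i' j * x j) - A i' j0 * s" for i'
      using insert.prems(1) j0(1) by (subst sum.remove[of J j0]) (auto simp: y_def intro!: sum.cong)
    have "(\<Sum>j\<in>J. A i' j * y j) = 0" if "i' \<in> I" for i'
    proof -
      have "0 = (\<Sum>j\<in>?J. A i' j * x j - A i' j0 * (A i j * x j) / A i j0)"
        using x(2) that by (simp add: B_def left_diff_distrib mult.assoc)
      also have "\<dots> = (\<Sum>j\<in>?J. A i' j * x j) - A i' j0 * s"
        by (simp add: sum_subtractf s_def sum_distrib_left sum_divide_distrib)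
      finally show ?thesis using sumy by simp
    qed
    moreover have "(\<Sum>j\<in>J. A i j * y j) = 0" unfolding sumy s_def using j0(2) by simp
    moreover have "\<exists>j\<in>J. y j \<noteq> 0" using x(1) by (auto simp: y_def)
    ultimately show ?thesis by (intro exI[of _ y]) simp
  qed
qed

lemma vpoly_space_spanned:
  assumes f: "(f :: real^'n \<Rightarrow> 'e::euclidean_space) \<in> vpoly_space k"
  shows "\<exists>c. f = (\<lambda>x. \<Sum>j\<in>{\<alpha>. sum \<alpha> UNIV \<le> k} \<times> Basis. c j *\<^sub>R (monom_fun (fst j) x *\<^sub>R snd j))"
proof -
  have "\<forall>b. \<exists>c. b \<in> Basis \<longrightarrow> (\<lambda>x. f x \<bullet> b) = (\<lambda>x. \<Sum>\<alpha>\<in>{\<alpha>. sum \<alpha> UNIV \<le> k}. c \<alpha> * monom_fun \<alpha> x)"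
    using f unfolding vpoly_space_def poly_space_iff by blast
  then obtain c where c: "\<And>b. b \<in> Basis \<Longrightarrow> (\<lambda>x. f x \<bullet> b) = (\<lambda>x. \<Sum>\<alpha>\<in>{\<alpha>. sum \<alpha> UNIV \<le> k}. c b \<alpha> * monom_fun \<alpha> x)"
    by metis
  have "f x = (\<Sum>j\<in>{\<alpha>. sum \<alpha> UNIV \<le> k} \<times> Basis. c (snd j) (fst j) *\<^sub>R (monom_fun (fst j) x *\<^sub>R snd j))" for x
  proof -
    have "f x = (\<Sum>b\<in>Basis. (f x \<bullet> b) *\<^sub>R b)" by (rule euclidean_representation[symmetric])
    also have "\<dots> = (\<Sum>b\<in>Basis. \<Sum>\<alpha>\<in>{\<alpha>. sum \<alpha> UNIV \<le> k}. c b \<alpha> *\<^sub>R (monom_fun \<alpha> x *\<^sub>R b))"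
    proof (rule sum.cong[OF refl])
      fix b :: 'e assume "b \<in> Basis"
      from fun_cong[OF c[OF this], of x]
      show "(f x \<bullet> b) *\<^sub>R b = (\<Sum>\<alpha>\<in>{\<alpha>. sum \<alpha> UNIV \<le> k}. c b \<alpha> *\<^sub>R (monom_fun \<alpha> x *\<^sub>R b))"
        by (simp add: scaleR_sum_left)
    qed
    also have "\<dots> = (\<Sum>\<alpha>\<in>{\<alpha>. sum \<alpha> UNIV \<le> k}. \<Sum>b\<in>Basis. c b \<alpha> *\<^sub>R (monom_fun \<alpha> x *\<^sub>R b))"
      by (rule sum.swap)
    finally show ?thesis by (simp add: sum.cartesian_product case_prod_unfold)
  qed
  then show ?thesis by (intro exI[of _ "\<lambda>j. c (snd j) (fst j)"] ext)
qed

text \<open>A spanning set of monomial fields of least cardinality is independent, because a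
  dependent member could be expressed by the others and dropped. The dimension is never
  computed.\<close>

lemma vpoly_space_basis:
  obtains J :: "(('n::finite \<Rightarrow> nat) \<times> 'e::euclidean_space) set" and \<phi> :: "('n \<Rightarrow> nat) \<times> 'e \<Rightarrow> real^'n \<Rightarrow> 'e"
  where "finite J" "\<And>j. j \<in> J \<Longrightarrow> \<phi> j \<in> vpoly_space k"
    "\<And>f. f \<in> vpoly_space k \<Longrightarrow> \<exists>c. f = (\<lambda>x. \<Sum>j\<in>J. c j *\<^sub>R \<phi> j x)"
    "\<And>c. (\<lambda>x. \<Sum>j\<in>J. c j *\<^sub>R \<phi> j x) = (\<lambda>x. 0) \<Longrightarrow> \<forall>j\<in>J. c j = 0"
proof -
  define \<phi> :: "('n \<Rightarrow> nat) \<times> 'e \<Rightarrow> real^'n \<Rightarrow> 'e" where "\<phi> j x = monom_fun (fst j) x *\<^sub>R snd j" for j x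
  define I :: "(('n \<Rightarrow> nat) \<times> 'e) set" where "I = {\<alpha>. sum \<alpha> UNIV \<le> k} \<times> Basis"
  define spans where "spans J \<longleftrightarrow> J \<subseteq> I \<and> (\<forall>f\<in>vpoly_space k. \<exists>c. f = (\<lambda>x. \<Sum>j\<in>J. c j *\<^sub>R \<phi> j x))" for J
  have finI: "finite I" unfolding I_def by (simp add: finite_multi_index)
  have "spans I" using vpoly_space_spanned unfolding spans_def I_def \<phi>_def by blast
  then obtain J where J: "spans J" "\<And>J'. spans J' \<Longrightarrow> card J \<le> card J'"
    using ex_has_least_nat[of spans I card] by blast
  have finJ: "finite J" using J(1) finI finite_subset unfolding spans_def by blast
  show ?thesis
  proof (rule that[of J \<phi>])
    show "finite J" by fact
    show "\<phi> j \<in> vpoly_space k" if "j \<in> J" for j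
    proof -
      have "monom_fun (fst j) \<in> poly_space k"
        using that J(1) by (intro poly_space_monom) (auto simp: spans_def I_def)
      then have "(\<lambda>x. (snd j \<bullet> b) * monom_fun (fst j) x) \<in> poly_space k" for b by (rule poly_space_cmul)
      then show ?thesis by (simp add: vpoly_space_def \<phi>_def[abs_def] mult.commute)
    qed
    show "\<exists>c. f = (\<lambda>x. \<Sum>j\<in>J. c j *\<^sub>R \<phi> j x)" if "f \<in> vpoly_space k" for f
      using that J(1) unfolding spans_def by blast
    fix c assume c: "(\<lambda>x. \<Sum>j\<in>J. c j *\<^sub>R \<phi> j x) = (\<lambda>x. 0)"
    show "\<forall>j\<in>J. c j = 0"
    proof (rule ccontr)
      assume "\<not> (\<forall>j\<in>J. c j = 0)"
      then obtain j0 where j0: "j0 \<in> J" "c j0 \<noteq> 0" by blast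
      let ?J = "J - {j0}"
      have \<phi>0: "\<phi> j0 x = (\<Sum>j\<in>?J. (- c j / c j0) *\<^sub>R \<phi> j x)" for x
      proof -
        have "c j0 *\<^sub>R \<phi> j0 x + (\<Sum>j\<in>?J. c j *\<^sub>R \<phi> j x) = 0"
          using fun_cong[OF c, of x] sum.remove[OF finJ j0(1), of "\<lambda>j. c j *\<^sub>R \<phi> j x"] by simp
        then have *: "c j0 *\<^sub>R \<phi> j0 x = - (\<Sum>j\<in>?J. c j *\<^sub>R \<phi> j x)"
          by (simp add: eq_neg_iff_add_eq_0)
        have "\<phi> j0 x = (1 / c j0) *\<^sub>R (c j0 *\<^sub>R \<phi> j0 x)" using j0(2) by simp
        also have "\<dots> = (\<Sum>j\<in>?J. (- c j / c j0) *\<^sub>R \<phi> j x)"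
          unfolding * by (simp add: scaleR_sum_right sum_negf)
        finally show ?thesis .
      qed
      have "spans ?J"
        unfolding spans_def
      proof (intro conjI ballI)
        show "?J \<subseteq> I" using J(1) unfolding spans_def by blast
        fix f :: "real^'n \<Rightarrow> 'e" assume "f \<in> vpoly_space k"
        then obtain d where d: "f = (\<lambda>x. \<Sum>j\<in>J. d j *\<^sub>R \<phi> j x)" using J(1) unfolding spans_def by blast
        have "f x = (\<Sum>j\<in>?J. (d j - d j0 * c j / c j0) *\<^sub>R \<phi> j x)" for x
        proof -
          have "f x = d j0 *\<^sub>R \<phi> j0 x + (\<Sum>j\<in>?J. d j *\<^sub>R \<phi> j x)"
            unfolding d using sum.remove[OF finJ j0(1), of "\<lambda>j. d j *\<^sub>R \<phi> j x"] by simp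
          also have "\<dots> = (\<Sum>j\<in>?J. (d j - d j0 * c j / c j0) *\<^sub>R \<phi> j x)"
            unfolding \<phi>0 by (simp add: scaleR_sum_right sum.distrib[symmetric] scaleR_diff_left)
          finally show ?thesis .
        qed
        then show "\<exists>c. f = (\<lambda>x. \<Sum>j\<in>?J. c j *\<^sub>R \<phi> j x)"
          by (intro exI[of _ "\<lambda>j. d j - d j0 * c j / c j0"]) (rule ext)
      qed
      then have "card J \<le> card ?J" by (rule J(2))
      then show False using card_Diff1_less[OF finJ j0(1)] by simp
    qed
  qed
qed

text \<open>
  The parameter \<open>t\<close> scales the data: \<open>S Z 0\<close> is the homogeneous residual, and a nontrivial solution
  \<open>(Z, t)\<close> of the underdetermined system must have \<open>t \<noteq> 0\<close>, so that \<open>Z / t\<close> solves the given problem.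
\<close>
lemma ex1_solution_of_homogeneous_unique:
  fixes S :: "(real^'n \<Rightarrow> 'e::euclidean_space) \<Rightarrow> real \<Rightarrow> (real^'n \<Rightarrow> 'e) \<Rightarrow> real"
  assumes lin1: "\<And>Z Z' t t' a b Y. Z \<in> vpoly_space k \<Longrightarrow> Z' \<in> vpoly_space k \<Longrightarrow> Y \<in> vpoly_space k \<Longrightarrow>
      S (\<lambda>x. a *\<^sub>R Z x + b *\<^sub>R Z' x) (a * t + b * t') Y = a * S Z t Y + b * S Z' t' Y"
    and lin2: "\<And>Z t a b Y Y'. Z \<in> vpoly_space k \<Longrightarrow> Y \<in> vpoly_space k \<Longrightarrow> Y' \<in> vpoly_space k \<Longrightarrow>
      S Z t (\<lambda>x. a *\<^sub>R Y x + b *\<^sub>R Y' x) = a * S Z t Y + b * S Z t Y'"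
    and ker: "\<And>Z. Z \<in> vpoly_space k \<Longrightarrow> (\<And>Y. Y \<in> vpoly_space k \<Longrightarrow> S Z 0 Y = 0) \<Longrightarrow> Z = (\<lambda>x. 0)"
  shows "\<exists>!Z. Z \<in> vpoly_space k \<and> (\<forall>Y\<in>vpoly_space k. S Z 1 Y = 0)"
proof -
  let ?V = "vpoly_space k :: (real^'n \<Rightarrow> 'e) set"
  obtain J :: "(('n \<Rightarrow> nat) \<times> 'e) set" and \<phi> :: "('n \<Rightarrow> nat) \<times> 'e \<Rightarrow> real^'n \<Rightarrow> 'e" where fin: "finite J" and \<phi>: "\<And>j. j \<in> J \<Longrightarrow> \<phi> j \<in> ?V"
    and span: "\<And>f. f \<in> ?V \<Longrightarrow> \<exists>c. f = (\<lambda>x. \<Sum>j\<in>J. c j *\<^sub>R \<phi> j x)"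
    and indep: "\<And>c. (\<lambda>x. \<Sum>j\<in>J. c j *\<^sub>R \<phi> j x) = (\<lambda>x. 0) \<Longrightarrow> \<forall>j\<in>J. c j = 0"
    using vpoly_space_basis[where ?'n = 'n and ?'e = 'e and k = k] by blast
  have inV: "(\<lambda>x. \<Sum>j\<in>J. c j *\<^sub>R \<phi> j x) \<in> ?V" for c
    by (intro vpoly_space_sum vpoly_space_scaleR \<phi>)
  have zV: "(\<lambda>x. 0) \<in> ?V" by (rule vpoly_space_zero)
  have S00: "S (\<lambda>x. 0) 0 Y = 0" if "Y \<in> ?V" for Y
    using lin1[OF zV zV that, of 0 0 0 0] by simp
  have SY0: "S Z t (\<lambda>x. 0) = 0" if "Z \<in> ?V" for Z t
    using lin2[OF that zV zV, of t 0 0] by simp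
  have sum1: "S (\<lambda>x. \<Sum>j\<in>J'. c j *\<^sub>R \<phi> j x) 0 Y = (\<Sum>j\<in>J'. c j * S (\<phi> j) 0 Y)"
    if "finite J'" "J' \<subseteq> J" "Y \<in> ?V" for c J' Y
    using that
  proof (induction J' rule: finite_induct)
    case (insert j J')
    have "(\<lambda>x. \<Sum>j\<in>J'. c j *\<^sub>R \<phi> j x) \<in> ?V"
      using insert.prems by (intro vpoly_space_sum vpoly_space_scaleR \<phi>) blast
    then show ?case
      using lin1[OF \<phi>[of j] _ insert.prems(2), of "\<lambda>x. \<Sum>j\<in>J'. c j *\<^sub>R \<phi> j x" "c j" 1 0 0] insert by simp
  qed (simp add: S00)
  have sum2: "S Z t (\<lambda>x. \<Sum>j\<in>J'. c j *\<^sub>R \<phi> j x) = (\<Sum>j\<in>J'. c j * S Z t (\<phi> j))"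
    if "finite J'" "J' \<subseteq> J" "Z \<in> ?V" for c J' Z t
    using that
  proof (induction J' rule: finite_induct)
    case (insert j J')
    have "(\<lambda>x. \<Sum>j\<in>J'. c j *\<^sub>R \<phi> j x) \<in> ?V"
      using insert.prems by (intro vpoly_space_sum vpoly_space_scaleR \<phi>) blast
    then show ?case
      using lin2[OF insert.prems(2) \<phi>[of j], of "\<lambda>x. \<Sum>j\<in>J'. c j *\<^sub>R \<phi> j x" t "c j" 1] insert by simp
  qed (simp add: SY0)
  have expand: "S (\<lambda>x. \<Sum>j\<in>J. c j *\<^sub>R \<phi> j x) t Y = (\<Sum>j\<in>J. c j * S (\<phi> j) 0 Y) + t * S (\<lambda>x. 0) 1 Y" if "Y \<in> ?V" for c t Y
    using lin1[OF inV[of c] zV that, of 1 t 0 1] sum1[OF fin subset_refl that] by simp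
  \<comment> \<open>One column per basis function and the column \<open>None\<close> for the data:
    \<open>card J\<close> test equations face \<open>card J + 1\<close> unknowns.\<close>
  define A where "A i j = (case j of None \<Rightarrow> S (\<lambda>x. 0) 1 (\<phi> i) | Some j \<Rightarrow> S (\<phi> j) 0 (\<phi> i))" for i j
  let ?J = "insert None (Some ` J)"
  have "card J < card ?J" using fin by (simp add: card_image)
  then obtain x where x: "\<exists>j\<in>?J. x j \<noteq> 0" "\<forall>i\<in>J. (\<Sum>j\<in>?J. A i j * x j) = 0"
    using underdetermined_system[of J ?J A] fin by blast
  define Z where "Z = (\<lambda>y. \<Sum>j\<in>J. x (Some j) *\<^sub>R \<phi> j y)"
  have Z: "Z \<in> ?V" unfolding Z_def by (rule inV)
  have SZ: "S Z (x None) Y = 0" if Y: "Y \<in> ?V" for Y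
  proof -
    have "S Z (x None) (\<phi> i) = 0" if "i \<in> J" for i
      using x(2) that fin unfolding Z_def expand[OF \<phi>[OF that]]
      by (simp add: A_def sum.reindex mult.commute add.commute)
    moreover obtain c where "Y = (\<lambda>x. \<Sum>j\<in>J. c j *\<^sub>R \<phi> j x)" using span[OF Y] by blast
    ultimately show ?thesis using sum2[OF fin subset_refl Z] by simp
  qed
  \<comment> \<open>Otherwise \<open>Z\<close> solves the homogeneous problem, hence is zero, and
    independence of the basis kills every coefficient of a solution chosen nontrivial.\<close>
  have t: "x None \<noteq> 0"
  proof
    assume 0: "x None = 0"
    then have "Z = (\<lambda>x. 0)" using ker[OF Z] SZ by simp
    then have "\<forall>j\<in>J. x (Some j) = 0" unfolding Z_def by (rule indep)
    then show False using x(1) 0 by auto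
  qed
  define X where "X = (\<lambda>y. (1 / x None) *\<^sub>R Z y)"
  have X: "X \<in> ?V" unfolding X_def by (rule vpoly_space_scaleR[OF Z])
  have SX: "S X 1 Y = 0" if "Y \<in> ?V" for Y
    using lin1[OF Z zV that, of "1 / x None" 0 "x None" 0] SZ[OF that] t by (simp add: X_def)
  show ?thesis
  proof (rule ex1I[of _ X])
    show "X \<in> ?V \<and> (\<forall>Y\<in>?V. S X 1 Y = 0)" using X SX by blast
    fix X' assume X': "X' \<in> ?V \<and> (\<forall>Y\<in>?V. S X' 1 Y = 0)"
    have "S (\<lambda>x. 1 *\<^sub>R X' x + (-1) *\<^sub>R X x) (1 * 1 + (-1) * 1) Y = 0" if "Y \<in> ?V" for Y
      using lin1[of X' X Y 1 "-1" 1 1] X X' SX that by simp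
    then have "(\<lambda>x. 1 *\<^sub>R X' x + (-1) *\<^sub>R X x) = (\<lambda>x. 0)"
      using X X' by (intro ker vpoly_space_add vpoly_space_scaleR) auto
    then show "X' = X" by (simp add: fun_eq_iff)
  qed
qed

section \<open>Linear dependence of integrals on their integrands\<close>

text \<open>Residuals are built from integrals by sums, differences and factors. These rules
  preserve the shape \<open>F = a * F1 + c * F2\<close> while descending to the single
  integrals.\<close>

lemma linear_comb_add: "(F :: real) = a * F1 + c * F2 \<Longrightarrow> G = a * G1 + c * G2 \<Longrightarrow> F + G = a * (F1 + G1) + c * (F2 + G2)"
  and linear_comb_diff: "(F :: real) = a * F1 + c * F2 \<Longrightarrow> G = a * G1 + c * G2 \<Longrightarrow> F - G = a * (F1 - G1) + c * (F2 - G2)"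
  and linear_comb_mult: "(F :: real) = a * F1 + c * F2 \<Longrightarrow> s * F = a * (s * F1) + c * (s * F2)"
  and linear_comb_minus: "(F :: real) = a * F1 + c * F2 \<Longrightarrow> - F = a * (- F1) + c * (- F2)"
  by (simp_all add: algebra_simps)

text \<open>The relation between the integrands is asked for only almost everywhere: the curl of
  \<open>v x d\<close> is additive in \<open>v\<close> only where the partial derivatives
  exist.\<close>

lemma linear_comb_vint:
  assumes "set_integrable lebesgue K f" "set_integrable lebesgue K g"
    and "AE x in lebesgue. x \<in> K \<longrightarrow> h x = a * f x + c * g x"
  shows "vint K h = a * vint K f + c * vint K g"
proof -
  have i: "set_integrable lebesgue K (\<lambda>x. a * f x)" "set_integrable lebesgue K (\<lambda>x. c * g x)"
    using assms(1,2) by auto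
  have "vint K (\<lambda>x. a * f x + c * g x) = vint K h"
  proof (rule vint_cong_AE(2))
    show "set_integrable lebesgue K (\<lambda>x. a * f x + c * g x)" using i by simp
    show "AE x in lebesgue. x \<in> K \<longrightarrow> a * f x + c * g x = h x" using assms(3) by eventually_elim simp
  qed
  then show ?thesis by (simp add: vint_add[OF i] vint_cmul)
qed

lemma (in gauss_cell) linear_comb_bnd:
  assumes "bcont f" "bcont g" "\<forall>e\<in>Fs. \<forall>x. h e x = l * f e x + c * g e x"
  shows "bnd h = l * bnd f + c * bnd g"
proof -
  have "bnd h = bnd (\<lambda>e x. l * f e x + c * g e x)" by (rule bnd_cong) (use assms(3) in simp)
  moreover have "bcont (\<lambda>e x. l * f e x)" "bcont (\<lambda>e x. c * g e x)"
    using assms(1,2) unfolding bcont_def by (auto intro!: continuous_intros)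
  ultimately show ?thesis by (simp add: bnd_add bnd_cmul)
qed

lemma pdv_comb:
  assumes "f \<in> vpoly_space k" "g \<in> vpoly_space k"
  shows "pdv j (\<lambda>x. a *\<^sub>R f x + c *\<^sub>R g x) x = a *\<^sub>R pdv j f x + c *\<^sub>R pdv j g x"
proof -
  have "has_pdv (\<lambda>x. a *\<^sub>R f x) x" "has_pdv (\<lambda>x. c *\<^sub>R g x) x"
    using assms by (auto intro!: has_pdv_vpoly_space vpoly_space_scaleR)
  then show ?thesis
    using pdv_linear[OF bounded_linear_scaleR_right has_pdv_vpoly_space[OF assms(1)]]
      pdv_linear[OF bounded_linear_scaleR_right has_pdv_vpoly_space[OF assms(2)]]
    by (simp add: pdv_add del: pdv_real)
qed

lemma gradV_comb:
  "f \<in> vpoly_space k \<Longrightarrow> g \<in> vpoly_space k \<Longrightarrow> gradV (\<lambda>x. a *\<^sub>R f x + c *\<^sub>R g x) x = a *\<^sub>R gradV f x + c *\<^sub>R gradV g x"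
  unfolding gradV_eq
  by (simp add: pdv_comb linear_add[OF linear_outerp_left] linear_cmul[OF linear_outerp_left] sum.distrib scaleR_sum_right)

lemma gradS_comb:
  "f \<in> vpoly_space k \<Longrightarrow> g \<in> vpoly_space k \<Longrightarrow> gradS (\<lambda>x. a * f x + c * g x) x = a *\<^sub>R gradS f x + c *\<^sub>R gradS g x"
  using pdv_comb[of f k g, where a = a and c = c and x = x] by (simp add: gradS_eq scaleR_add_left sum.distrib scaleR_sum_right)

lemma divV_comb:
  "f \<in> vpoly_space k \<Longrightarrow> g \<in> vpoly_space k \<Longrightarrow> divV (\<lambda>x. a *\<^sub>R f x + c *\<^sub>R g x) x = a * divV f x + c * divV g x"
  using pdv_comb[of f k g, where a = a and c = c and x = x] by (simp add: divV_eq sum.distrib sum_distrib_left)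

lemma divM_comb:
  assumes "f \<in> vpoly_space k" "g \<in> vpoly_space k"
  shows "divM (\<lambda>x. a *\<^sub>R f x + c *\<^sub>R g x) x = a *\<^sub>R divM f x + c *\<^sub>R divM g x"
  using pdv_comb[OF vpoly_space_linear[OF assms(1) linear_matrix_vector_mul_left]
    vpoly_space_linear[OF assms(2) linear_matrix_vector_mul_left], where a = a and c = c and x = x]
  by (simp add: divM_eq linear_add[OF linear_matrix_vector_mul_left] linear_cmul[OF linear_matrix_vector_mul_left]
     sum.distrib scaleR_sum_right)

lemma vpoly_space_divM:
  assumes "f \<in> vpoly_space k" shows "divM f \<in> vpoly_space k"
  unfolding divM_eq[abs_def]
  by (intro vpoly_space_sum vpoly_space_pdv vpoly_space_linear[OF assms linear_matrix_vector_mul_left])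

lemma vpoly_space_fst: "f \<in> vpoly_space k \<Longrightarrow> (\<lambda>x. fst (f x)) \<in> vpoly_space k"
  by (erule vpoly_space_linear) (simp add: linear_iff)

lemma vpoly_space_snd: "f \<in> vpoly_space k \<Longrightarrow> (\<lambda>x. snd (f x)) \<in> vpoly_space k"
  by (erule vpoly_space_linear) (simp add: linear_iff)

lemma vpoly_space_Pair: "f \<in> vpoly_space k \<Longrightarrow> g \<in> vpoly_space k \<Longrightarrow> (\<lambda>x. (f x, g x)) \<in> vpoly_space k"
  unfolding vpoly_space_def by (auto simp: Basis_prod_def)

section \<open>The local problem as one square linear system\<close>

text \<open>The six unknowns form a single field with values in a product of Euclidean spaces, so
  one \<open>vpoly_space k\<close> serves as both trial and test space of the whole system.\<close>

type_synonym ('n, 'h) hdg_tuple = "(real^'n^'n) \<times> (real^'n) \<times> real \<times> 'h \<times> (real^'n) \<times> real"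

definition L_of :: "(real^'n \<Rightarrow> ('n, 'h) hdg_tuple) \<Rightarrow> real^'n \<Rightarrow> real^'n^'n" where "L_of Z x = fst (Z x)"
definition u_of :: "(real^'n \<Rightarrow> ('n, 'h) hdg_tuple) \<Rightarrow> real^'n \<Rightarrow> real^'n" where "u_of Z x = fst (snd (Z x))"
definition p_of :: "(real^'n \<Rightarrow> ('n, 'h) hdg_tuple) \<Rightarrow> real^'n \<Rightarrow> real" where "p_of Z x = fst (snd (snd (Z x)))"
definition H_of :: "(real^'n \<Rightarrow> ('n, 'h) hdg_tuple) \<Rightarrow> real^'n \<Rightarrow> 'h" where "H_of Z x = fst (snd (snd (snd (Z x))))"
definition b_of :: "(real^'n \<Rightarrow> ('n, 'h) hdg_tuple) \<Rightarrow> real^'n \<Rightarrow> real^'n" where "b_of Z x = fst (snd (snd (snd (snd (Z x)))))"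
definition r_of :: "(real^'n \<Rightarrow> ('n, 'h) hdg_tuple) \<Rightarrow> real^'n \<Rightarrow> real" where "r_of Z x = snd (snd (snd (snd (snd (Z x)))))"

lemmas of_defs = L_of_def[abs_def] u_of_def[abs_def] p_of_def[abs_def] H_of_def[abs_def] b_of_def[abs_def] r_of_def[abs_def]

lemma vpoly_space_of:
  fixes Z :: "real^'n \<Rightarrow> ('n, 'h::euclidean_space) hdg_tuple"
  assumes "Z \<in> vpoly_space k"
  shows "L_of Z \<in> vpoly_space k" "u_of Z \<in> vpoly_space k" "p_of Z \<in> vpoly_space k"
    "H_of Z \<in> vpoly_space k" "b_of Z \<in> vpoly_space k" "r_of Z \<in> vpoly_space k"
  unfolding of_defs by (intro vpoly_space_fst vpoly_space_snd assms)+

lemma of_comb: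
  fixes Z Z' :: "real^'n \<Rightarrow> ('n, 'h::euclidean_space) hdg_tuple"
  shows "L_of (\<lambda>x. a *\<^sub>R Z x + c *\<^sub>R Z' x) = (\<lambda>x. a *\<^sub>R L_of Z x + c *\<^sub>R L_of Z' x)"
    "u_of (\<lambda>x. a *\<^sub>R Z x + c *\<^sub>R Z' x) = (\<lambda>x. a *\<^sub>R u_of Z x + c *\<^sub>R u_of Z' x)"
    "p_of (\<lambda>x. a *\<^sub>R Z x + c *\<^sub>R Z' x) = (\<lambda>x. a * p_of Z x + c * p_of Z' x)"
    "H_of (\<lambda>x. a *\<^sub>R Z x + c *\<^sub>R Z' x) = (\<lambda>x. a *\<^sub>R H_of Z x + c *\<^sub>R H_of Z' x)"
    "b_of (\<lambda>x. a *\<^sub>R Z x + c *\<^sub>R Z' x) = (\<lambda>x. a *\<^sub>R b_of Z x + c *\<^sub>R b_of Z' x)"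
    "r_of (\<lambda>x. a *\<^sub>R Z x + c *\<^sub>R Z' x) = (\<lambda>x. a * r_of Z x + c * r_of Z' x)"
  by (simp_all add: of_defs)

text \<open>Cauchy-Schwarz and \<open>2 x y \<le> x^2 + y^2\<close> dominate the product by
  \<open>|g|^2 + |v|^2\<close>, which is integrable for square integrable \<open>g\<close> and
  continuous \<open>v\<close>.\<close>

lemma L2_on_inner_integrable:
  fixes g v :: "real^'n \<Rightarrow> real^'n"
  assumes g: "L2_on K g" and K: "compact K" and v: "continuous_on K v"
  shows "set_integrable lebesgue K (\<lambda>x. g x \<bullet> v x)"
proof -
  have gm: "(\<lambda>x. indicator K x *\<^sub>R g x) \<in> borel_measurable lebesgue"
    using g by (simp add: L2_on_def set_borel_measurable_def)
  have vm: "(\<lambda>x. indicator K x *\<^sub>R v x) \<in> borel_measurable lebesgue"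
    using borel_measurable_continuous_on_indicator[OF borel_compact[OF K] v]
    by (simp add: measurable_completion)
  have "set_integrable lebesgue K (\<lambda>x. (norm (g x))\<^sup>2 + (norm (v x))\<^sup>2)"
  proof (rule set_integral_add(1))
    show "set_integrable lebesgue K (\<lambda>x. (norm (g x))\<^sup>2)" using g by (simp add: L2_on_def)
    show "set_integrable lebesgue K (\<lambda>x. (norm (v x))\<^sup>2)"
      by (intro set_integrable_continuous[OF K] continuous_intros v)
  qed
  then have int: "integrable lebesgue (\<lambda>x. indicator K x *\<^sub>R ((norm (g x))\<^sup>2 + (norm (v x))\<^sup>2))"
    by (simp add: set_integrable_def)
  have "integrable lebesgue (\<lambda>x. (indicator K x *\<^sub>R g x) \<bullet> (indicator K x *\<^sub>R v x))"
  proof (rule Bochner_Integration.integrable_bound[OF int])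
    show "(\<lambda>x. (indicator K x *\<^sub>R g x) \<bullet> (indicator K x *\<^sub>R v x)) \<in> borel_measurable lebesgue"
      using gm vm by (rule borel_measurable_inner)
    have "\<bar>g x \<bullet> v x\<bar> \<le> (norm (g x))\<^sup>2 + (norm (v x))\<^sup>2" for x
    proof -
      have "\<bar>g x \<bullet> v x\<bar> \<le> norm (g x) * norm (v x)" by (rule Cauchy_Schwarz_ineq2)
      also have "2 * (norm (g x) * norm (v x)) \<le> (norm (g x))\<^sup>2 + (norm (v x))\<^sup>2"
        using sum_squares_bound[of "norm (g x)" "norm (v x)"] by simp
      moreover have "0 \<le> norm (g x) * norm (v x)" by simp
      ultimately show ?thesis by linarith
    qed
    then show "AE x in lebesgue. norm ((indicator K x *\<^sub>R g x) \<bullet> (indicator K x *\<^sub>R v x)) \<le>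
        norm (indicator K x *\<^sub>R ((norm (g x))\<^sup>2 + (norm (v x))\<^sup>2))"
      by (intro AE_I2) (auto simp: indicator_def)
  qed
  then show ?thesis
    unfolding set_integrable_def by (rule Bochner_Integration.integrable_cong[THEN iffD1, rotated 2]) (auto simp: indicator_def)
qed

locale hdg_problem = hdg_cell K Fs a T \<psi> nr ctr cVV cVH curlV curlH
  for K :: "(real^'n) set" and Fs :: "'f set" and a :: "'f \<Rightarrow> real"
    and T :: "'q::euclidean_space set" and \<psi> :: "'f \<Rightarrow> 'q \<Rightarrow> real^'n" and nr :: "'f \<Rightarrow> real^'n"
    and ctr :: "real^'n"
    and cVV :: "real^'n \<Rightarrow> real^'n \<Rightarrow> 'h::euclidean_space" and cVH :: "real^'n \<Rightarrow> 'h \<Rightarrow> real^'n"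
    and curlV :: "(real^'n \<Rightarrow> real^'n) \<Rightarrow> real^'n \<Rightarrow> 'h" and curlH :: "(real^'n \<Rightarrow> 'h) \<Rightarrow> real^'n \<Rightarrow> real^'n" +
  fixes k :: nat and Rey Rm \<kappa> :: real and dd w :: "real^'n \<Rightarrow> real^'n" and \<alpha>1 \<alpha>2 \<alpha>3 :: real
    and uh bh :: "'f \<Rightarrow> real^'n \<Rightarrow> real^'n" and rh :: "'f \<Rightarrow> real^'n \<Rightarrow> real"
    and g f :: "real^'n \<Rightarrow> real^'n" and \<rho> :: real
  assumes pos: "Rey > 0" "Rm > 0" "\<kappa> > 0" "\<alpha>2 > 0" "\<alpha>3 > 0"
    and dd: "lip_on K dd" and w: "lip_on K w" and div_w: "AE x in lebesgue. x \<in> K \<longrightarrow> divV w x = 0"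
    and \<alpha>1: "\<And>x. x \<in> K \<Longrightarrow> norm (w x) < 2 * \<alpha>1"
    and uh: "\<And>e. e \<in> Fs \<Longrightarrow> uh e \<in> vpoly_space k" and bh: "\<And>e. e \<in> Fs \<Longrightarrow> bh e \<in> vpoly_space k"
    and rh: "\<And>e. e \<in> Fs \<Longrightarrow> rh e \<in> vpoly_space k"
    and g: "L2_on K g" and f: "L2_on K f"
begin

abbreviation "tn e v \<equiv> tang cVH cVV (nr e) v"
abbreviation "vol \<equiv> measure lebesgue K"

text \<open>In this and the next five residuals \<open>t\<close> multiplies all prescribed data,
  which makes them jointly linear in \<open>(Z, t)\<close>; \<open>t = 1\<close> is the given
  problem and \<open>t = 0\<close> the homogeneous one.\<close>

definition res1 :: "(real^'n \<Rightarrow> ('n, 'h) hdg_tuple) \<Rightarrow> real \<Rightarrow> (real^'n \<Rightarrow> real^'n^'n) \<Rightarrow> real" where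
  "res1 Z t G = Rey * vint K (\<lambda>x. L_of Z x \<bullet> G x) + vint K (\<lambda>x. u_of Z x \<bullet> divM G x)
   - bnd (\<lambda>e x. outerp (t *\<^sub>R uh e x) (nr e) \<bullet> G x)"

definition res2 :: "(real^'n \<Rightarrow> ('n, 'h) hdg_tuple) \<Rightarrow> real \<Rightarrow> (real^'n \<Rightarrow> real^'n) \<Rightarrow> real" where
  "res2 Z t v = vint K (\<lambda>x. L_of Z x \<bullet> gradV v x) - vint K (\<lambda>x. p_of Z x * divV v x)
      - vint K (\<lambda>x. outerp (u_of Z x) (w x) \<bullet> gradV v x)
      + \<kappa> * vint K (\<lambda>x. b_of Z x \<bullet> curlH (\<lambda>y. cVV (v y) (dd y)) x)
      + bnd (\<lambda>e x. (- (L_of Z x *v nr e) + (w x \<bullet> nr e) *\<^sub>R u_of Z x + p_of Z x *\<^sub>R nr e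
            + (1/2 * \<kappa>) *\<^sub>R cVH (dd x) (cVV (nr e) (tn e (b_of Z x) + t *\<^sub>R bh e x))
            + \<alpha>1 *\<^sub>R (u_of Z x - t *\<^sub>R uh e x)) \<bullet> v x)
      - vint K (\<lambda>x. (t *\<^sub>R g x) \<bullet> v x)"

definition res3 :: "(real^'n \<Rightarrow> ('n, 'h) hdg_tuple) \<Rightarrow> real \<Rightarrow> (real^'n \<Rightarrow> real) \<Rightarrow> real" where
  "res3 Z t q = - vint K (\<lambda>x. u_of Z x \<bullet> gradS q x) + bnd (\<lambda>e x. ((t *\<^sub>R uh e x) \<bullet> nr e) * q x)
      + vint K (\<lambda>x. p_of Z x * (vint K q / vol)) - (1 / vol) * vint K (\<lambda>x. (t * \<rho>) * (vint K q / vol))"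

definition res4 :: "(real^'n \<Rightarrow> ('n, 'h) hdg_tuple) \<Rightarrow> real \<Rightarrow> (real^'n \<Rightarrow> 'h) \<Rightarrow> real" where
  "res4 Z t J = (Rm / \<kappa>) * vint K (\<lambda>x. H_of Z x \<bullet> J x) - vint K (\<lambda>x. b_of Z x \<bullet> curlH J x)
      - bnd (\<lambda>e x. cVV (nr e) (t *\<^sub>R bh e x) \<bullet> J x)"

definition res5 :: "(real^'n \<Rightarrow> ('n, 'h) hdg_tuple) \<Rightarrow> real \<Rightarrow> (real^'n \<Rightarrow> real^'n) \<Rightarrow> real" where
  "res5 Z t c = vint K (\<lambda>x. H_of Z x \<bullet> curlV c x) - vint K (\<lambda>x. r_of Z x * divV c x)
      - \<kappa> * vint K (\<lambda>x. u_of Z x \<bullet> cVH (dd x) (curlV c x))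
      + bnd (\<lambda>e x. (cVH (nr e) (H_of Z x) + (t * rh e x) *\<^sub>R nr e
            - (1/2 * \<kappa>) *\<^sub>R cVH (nr e) (cVV (u_of Z x + t *\<^sub>R uh e x) (dd x))
            + \<alpha>2 *\<^sub>R (tn e (b_of Z x) - t *\<^sub>R bh e x)) \<bullet> c x)
      - vint K (\<lambda>x. (t *\<^sub>R f x) \<bullet> c x)"

definition res6 :: "(real^'n \<Rightarrow> ('n, 'h) hdg_tuple) \<Rightarrow> real \<Rightarrow> (real^'n \<Rightarrow> real) \<Rightarrow> real" where
  "res6 Z t s = - vint K (\<lambda>x. b_of Z x \<bullet> gradS s x)
      + bnd (\<lambda>e x. (b_of Z x \<bullet> nr e + \<alpha>3 * (r_of Z x - t * rh e x)) * s x)"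

lemma hdg_system_iff_res:
  "hdg_system k Rey Rm \<kappa> dd w \<alpha>1 \<alpha>2 \<alpha>3 (\<lambda>e x. t *\<^sub>R uh e x) (\<lambda>e x. t *\<^sub>R bh e x) (\<lambda>e x. t * rh e x)
     (\<lambda>x. t *\<^sub>R g x) (\<lambda>x. t *\<^sub>R f x) (t * \<rho>) (L_of Z) (u_of Z) (p_of Z) (H_of Z) (b_of Z) (r_of Z) \<longleftrightarrow>
   (\<forall>G\<in>vpoly_space k. res1 Z t G = 0) \<and> (\<forall>v\<in>vpoly_space k. res2 Z t v = 0) \<and>
   (\<forall>q\<in>vpoly_space k. res3 Z t q = 0) \<and> (\<forall>J\<in>vpoly_space k. res4 Z t J = 0) \<and>
   (\<forall>c\<in>vpoly_space k. res5 Z t c = 0) \<and> (\<forall>s\<in>vpoly_space k. res6 Z t s = 0)"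
  unfolding hdg_local_system_def Let_def bnd_def[symmetric] res1_def res2_def res3_def res4_def res5_def res6_def
    right_minus_eq ..

lemma continuous_on_face: "e \<in> Fs \<Longrightarrow> continuous_on S (uh e)" "e \<in> Fs \<Longrightarrow> continuous_on S (bh e)" "e \<in> Fs \<Longrightarrow> continuous_on S (rh e)"
  by (rule vpoly_space_continuous[OF uh] vpoly_space_continuous[OF bh] vpoly_space_continuous[OF rh], assumption)+

lemma cont_dd: "continuous_on K dd" and cont_w: "continuous_on K w"
  using dd w by (auto intro: lip_on_continuous)

lemma continuous_on_matvec:
  fixes h :: "'z::euclidean_space \<Rightarrow> real^'i^'j"
  assumes "continuous_on S h" shows "continuous_on S (\<lambda>x. h x *v y)"
  using linear_continuous_on_compose[OF assms linear_matrix_vector_mul_left] .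

lemma continuous_on_outerp:
  fixes h :: "'z::euclidean_space \<Rightarrow> real^'i"
  assumes "continuous_on S h" shows "continuous_on S (\<lambda>x. outerp (h x) y)"
  using linear_continuous_on_compose[OF assms linear_outerp_left] .

lemma continuous_on_outerp2: "continuous_on S h \<Longrightarrow> continuous_on S h' \<Longrightarrow> continuous_on S (\<lambda>x. outerp (h x) (h' x))"
  unfolding outerp_def by (intro continuous_intros)

lemmas cont_derivs = vpoly_space_continuous[where k = k, OF vpoly_space_gradV] vpoly_space_continuous[where k = k, OF vpoly_space_gradS]
  vpoly_space_continuous[where k = k, OF vpoly_space_divV] vpoly_space_continuous[where k = k, OF vpoly_space_divM]
  vpoly_space_continuous[where k = k, OF vpoly_space_curlV] vpoly_space_continuous[where k = k, OF vpoly_space_curlH]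

lemmas cont_of = vpoly_space_of[where k = k, THEN vpoly_space_continuous]

lemma outerp_comb: "outerp (l *\<^sub>R y + c *\<^sub>R z) v = l *\<^sub>R outerp y v + c *\<^sub>R outerp z v"
  "outerp (s *\<^sub>R y) v = s *\<^sub>R outerp y v"
  by (simp_all add: outerp_def vec_eq_iff algebra_simps)

lemma tn_comb: "e \<in> Fs \<Longrightarrow> tn e (l *\<^sub>R y + c *\<^sub>R z) = l *\<^sub>R tn e y + c *\<^sub>R tn e z"
  by (simp add: tang_eq nr_unit algebra_simps)

lemma curlV_comb:
  "v \<in> vpoly_space k \<Longrightarrow> v' \<in> vpoly_space k \<Longrightarrow> curlV (\<lambda>x. l *\<^sub>R v x + c *\<^sub>R v' x) x = l *\<^sub>R curlV v x + c *\<^sub>R curlV v' x"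
  by (simp add: curlV_eq pdv_comb cVV_simps sum.distrib scaleR_sum_right)

lemma curlH_comb:
  "v \<in> vpoly_space k \<Longrightarrow> v' \<in> vpoly_space k \<Longrightarrow> curlH (\<lambda>x. l *\<^sub>R v x + c *\<^sub>R v' x) x = l *\<^sub>R curlH v x + c *\<^sub>R curlH v' x"
  by (simp add: curlH_eq pdv_comb cVH_simps sum.distrib scaleR_sum_right)

lemmas cont_intros = continuous_intros cont_cVV cont_cVH continuous_on_tang continuous_on_matvec continuous_on_outerp
  continuous_on_outerp2 cont_dd cont_w continuous_on_face

lemmas inner_linear = inner_add_left inner_add_right inner_diff_left algebra_simps

lemmas linear_comb = linear_comb_add linear_comb_diff linear_comb_mult linear_comb_minus linear_comb_vint linear_comb_bnd

lemma vint_comb: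
  fixes q q' :: "real^'n \<Rightarrow> real"
  assumes "q \<in> vpoly_space k" "q' \<in> vpoly_space k"
  shows "vint K (\<lambda>x. c * q x + d * q' x) = c * vint K q + d * vint K q'"
  by (rule linear_comb_vint) (use assms in \<open>auto intro!: set_integrable_kcont simp del: vpoly_space_real intro: vpoly_space_continuous\<close>)

text \<open>Outside a null set both products with \<open>d\<close> have partial derivatives, and
  there the derivative of the combination splits. Elsewhere in \<open>K\<close> the curl carries no
  information.\<close>

lemma curl_cross_comb:
  assumes v: "v \<in> vpoly_space k" "v' \<in> vpoly_space k"
  shows "AE x in lebesgue. x \<in> K \<longrightarrow> b x \<bullet> curlH (\<lambda>y. cVV (c *\<^sub>R v y + d *\<^sub>R v' y) (dd y)) x =
     c * (b x \<bullet> curlH (\<lambda>y. cVV (v y) (dd y)) x) + d * (b x \<bullet> curlH (\<lambda>y. cVV (v' y) (dd y)) x)"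
proof -
  have lv: "lip_on K (\<lambda>y. cVV (v y) (dd y))" "lip_on K (\<lambda>y. cVV (v' y) (dd y))"
    by (rule lip_on_bilinear[OF bilinear_cVV K(1) lip_vpoly[OF v(1)] dd]
      lip_on_bilinear[OF bilinear_cVV K(1) lip_vpoly[OF v(2)] dd])+
  show ?thesis
    using AE_has_pdv[OF lv(1)] AE_has_pdv[OF lv(2)]
  proof eventually_elim
    case (elim x)
    show ?case
    proof
      assume x: "x \<in> K"
      have h: "has_pdv (\<lambda>y. c *\<^sub>R cVV (v y) (dd y)) x" "has_pdv (\<lambda>y. d *\<^sub>R cVV (v' y) (dd y)) x"
        using elim x by (auto intro!: has_pdv_linear[OF bounded_linear_scaleR_right])
      have "pdv j (\<lambda>y. cVV (c *\<^sub>R v y + d *\<^sub>R v' y) (dd y)) x =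
          c *\<^sub>R pdv j (\<lambda>y. cVV (v y) (dd y)) x + d *\<^sub>R pdv j (\<lambda>y. cVV (v' y) (dd y)) x" for j
        using elim x by (simp add: cVV_simps pdv_add[OF h] pdv_linear[OF bounded_linear_scaleR_right])
      then have "curlH (\<lambda>y. cVV (c *\<^sub>R v y + d *\<^sub>R v' y) (dd y)) x =
          c *\<^sub>R curlH (\<lambda>y. cVV (v y) (dd y)) x + d *\<^sub>R curlH (\<lambda>y. cVV (v' y) (dd y)) x"
        by (simp add: curlH_eq cVH_simps sum.distrib scaleR_sum_right)
      then show "b x \<bullet> curlH (\<lambda>y. cVV (c *\<^sub>R v y + d *\<^sub>R v' y) (dd y)) x =
         c * (b x \<bullet> curlH (\<lambda>y. cVV (v y) (dd y)) x) + d * (b x \<bullet> curlH (\<lambda>y. cVV (v' y) (dd y)) x)"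
        by (simp add: inner_add_right)
    qed
  qed
qed

lemma curl_cross_integrable:
  assumes "v \<in> vpoly_space k" "b \<in> vpoly_space k"
  shows "set_integrable lebesgue K (\<lambda>x. b x \<bullet> curlH (\<lambda>y. cVV (v y) (dd y)) x)"
  by (rule ibp_curl(1)[OF lip_on_bilinear[OF bilinear_cVV K(1) lip_vpoly[OF assms(1)] dd] lip_vpoly[OF assms(2)]])

lemma source_integrable:
  assumes "v \<in> vpoly_space k"
  shows "set_integrable lebesgue K (\<lambda>x. (t *\<^sub>R g x) \<bullet> v x)" "set_integrable lebesgue K (\<lambda>x. (t *\<^sub>R f x) \<bullet> v x)"
  using L2_on_inner_integrable[OF g K(1) vpoly_space_continuous[OF assms]]
    L2_on_inner_integrable[OF f K(1) vpoly_space_continuous[OF assms]] by simp_all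

text \<open>Pattern of all twelve linearity lemmas: \<open>linear_comb\<close> descends to single
  integrals, continuity supplies integrability, and a pointwise identity of integrands remains.
  Source terms and the curl of \<open>v x d\<close> bring their own integrability lemmas.\<close>

lemma res1_linear_left:
  assumes Z: "Z \<in> vpoly_space k" "Z' \<in> vpoly_space k" and v: "v \<in> vpoly_space k"
  shows "res1 (\<lambda>x. c *\<^sub>R Z x + d *\<^sub>R Z' x) (c * t + d * t') v = c * res1 Z t v + d * res1 Z' t' v"
proof -
  note cv = vpoly_space_continuous[OF v]
  show ?thesis
    unfolding res1_def of_comb
    by (intro linear_comb;
      ((intro set_integrable_kcont bcontI cont_intros cont_derivs cont_of Z v cv; assumption) |
       ((rule AE_I2 | intro ballI allI), simp add: inner_linear outerp_comb)))
qed

lemma res1_linear_right: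
  assumes Z: "Z \<in> vpoly_space k" and v: "v \<in> vpoly_space k" "v' \<in> vpoly_space k"
  shows "res1 Z t (\<lambda>x. c *\<^sub>R v x + d *\<^sub>R v' x) = c * res1 Z t v + d * res1 Z t v'"
proof -
  note cv = vpoly_space_continuous[OF v(1)] vpoly_space_continuous[OF v(2)]
  show ?thesis
    unfolding res1_def
    by (intro linear_comb;
      ((intro set_integrable_kcont bcontI cont_intros cont_derivs cont_of Z v cv; assumption) |
       ((rule AE_I2 | intro ballI allI), simp add: inner_linear divM_comb[OF v])))
qed

lemma res2_linear_left:
  assumes Z: "Z \<in> vpoly_space k" "Z' \<in> vpoly_space k" and v: "v \<in> vpoly_space k"
  shows "res2 (\<lambda>x. c *\<^sub>R Z x + d *\<^sub>R Z' x) (c * t + d * t') v = c * res2 Z t v + d * res2 Z' t' v"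
proof -
  note cv = vpoly_space_continuous[OF v]
  show ?thesis
    unfolding res2_def of_comb
    by (intro linear_comb curl_cross_integrable source_integrable vpoly_space_of Z v;
      ((intro set_integrable_kcont bcontI cont_intros cont_derivs cont_of Z v cv; assumption) |
       ((rule AE_I2 | intro ballI allI), simp add: inner_linear outerp_comb scaleR_matrix_vector_assoc[symmetric] tn_comb cVV_simps cVH_simps)))
qed

lemma res2_linear_right:
  assumes Z: "Z \<in> vpoly_space k" and v: "v \<in> vpoly_space k" "v' \<in> vpoly_space k"
  shows "res2 Z t (\<lambda>x. c *\<^sub>R v x + d *\<^sub>R v' x) = c * res2 Z t v + d * res2 Z t v'"
proof -
  note cv = vpoly_space_continuous[OF v(1)] vpoly_space_continuous[OF v(2)]
  show ?thesis
    unfolding res2_def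
    by (intro linear_comb curl_cross_integrable curl_cross_comb source_integrable vpoly_space_of Z v;
      ((intro set_integrable_kcont bcontI cont_intros cont_derivs cont_of Z v cv; assumption) |
       ((rule AE_I2 | intro ballI allI), simp add: inner_linear gradV_comb[OF v] divV_comb[OF v])))
qed

lemma res3_linear_left:
  assumes Z: "Z \<in> vpoly_space k" "Z' \<in> vpoly_space k" and v: "v \<in> vpoly_space k"
  shows "res3 (\<lambda>x. c *\<^sub>R Z x + d *\<^sub>R Z' x) (c * t + d * t') v = c * res3 Z t v + d * res3 Z' t' v"
proof -
  note cv = vpoly_space_continuous[OF v]
  show ?thesis
    unfolding res3_def of_comb
    by (intro linear_comb;
      ((intro set_integrable_kcont bcontI cont_intros cont_derivs cont_of Z v cv; assumption) |
       ((rule AE_I2 | intro ballI allI), simp add: inner_linear add_divide_distrib)))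
qed

lemma res3_linear_right:
  assumes Z: "Z \<in> vpoly_space k" and v: "v \<in> vpoly_space k" "v' \<in> vpoly_space k"
  shows "res3 Z t (\<lambda>x. c * v x + d * v' x) = c * res3 Z t v + d * res3 Z t v'"
proof -
  note cv = vpoly_space_continuous[OF v(1)] vpoly_space_continuous[OF v(2)]
  show ?thesis
    unfolding res3_def
    by (intro linear_comb;
      ((intro set_integrable_kcont bcontI cont_intros cont_derivs cont_of Z v cv; assumption) |
       ((rule AE_I2 | intro ballI allI), simp add: inner_linear gradS_comb[OF v] vint_comb[OF v] add_divide_distrib)))
qed

lemma res4_linear_left:
  assumes Z: "Z \<in> vpoly_space k" "Z' \<in> vpoly_space k" and v: "v \<in> vpoly_space k"
  shows "res4 (\<lambda>x. c *\<^sub>R Z x + d *\<^sub>R Z' x) (c * t + d * t') v = c * res4 Z t v + d * res4 Z' t' v"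
proof -
  note cv = vpoly_space_continuous[OF v]
  show ?thesis
    unfolding res4_def of_comb
    by (intro linear_comb;
      ((intro set_integrable_kcont bcontI cont_intros cont_derivs cont_of Z v cv; assumption) |
       ((rule AE_I2 | intro ballI allI), simp add: inner_linear cVV_simps)))
qed

lemma res4_linear_right:
  assumes Z: "Z \<in> vpoly_space k" and v: "v \<in> vpoly_space k" "v' \<in> vpoly_space k"
  shows "res4 Z t (\<lambda>x. c *\<^sub>R v x + d *\<^sub>R v' x) = c * res4 Z t v + d * res4 Z t v'"
proof -
  note cv = vpoly_space_continuous[OF v(1)] vpoly_space_continuous[OF v(2)]
  show ?thesis
    unfolding res4_def
    by (intro linear_comb;
      ((intro set_integrable_kcont bcontI cont_intros cont_derivs cont_of Z v cv; assumption) |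
       ((rule AE_I2 | intro ballI allI), simp add: inner_linear curlH_comb[OF v])))
qed

lemma res5_linear_left:
  assumes Z: "Z \<in> vpoly_space k" "Z' \<in> vpoly_space k" and v: "v \<in> vpoly_space k"
  shows "res5 (\<lambda>x. c *\<^sub>R Z x + d *\<^sub>R Z' x) (c * t + d * t') v = c * res5 Z t v + d * res5 Z' t' v"
proof -
  note cv = vpoly_space_continuous[OF v]
  show ?thesis
    unfolding res5_def of_comb
    by (intro linear_comb source_integrable v;
      ((intro set_integrable_kcont bcontI cont_intros cont_derivs cont_of Z v cv; assumption) |
       ((rule AE_I2 | intro ballI allI), simp add: inner_linear tn_comb cVV_simps cVH_simps)))
qed

lemma res5_linear_right:
  assumes Z: "Z \<in> vpoly_space k" and v: "v \<in> vpoly_space k" "v' \<in> vpoly_space k"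
  shows "res5 Z t (\<lambda>x. c *\<^sub>R v x + d *\<^sub>R v' x) = c * res5 Z t v + d * res5 Z t v'"
proof -
  note cv = vpoly_space_continuous[OF v(1)] vpoly_space_continuous[OF v(2)]
  show ?thesis
    unfolding res5_def
    by (intro linear_comb source_integrable v;
      ((intro set_integrable_kcont bcontI cont_intros cont_derivs cont_of Z v cv; assumption) |
       ((rule AE_I2 | intro ballI allI), simp add: inner_linear curlV_comb[OF v] divV_comb[OF v] cVH_simps)))
qed

lemma res6_linear_left:
  assumes Z: "Z \<in> vpoly_space k" "Z' \<in> vpoly_space k" and v: "v \<in> vpoly_space k"
  shows "res6 (\<lambda>x. c *\<^sub>R Z x + d *\<^sub>R Z' x) (c * t + d * t') v = c * res6 Z t v + d * res6 Z' t' v"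
proof -
  note cv = vpoly_space_continuous[OF v]
  show ?thesis
    unfolding res6_def of_comb
    by (intro linear_comb;
      ((intro set_integrable_kcont bcontI cont_intros cont_derivs cont_of Z v cv; assumption) |
       ((rule AE_I2 | intro ballI allI), simp add: inner_linear)))
qed

lemma res6_linear_right:
  assumes Z: "Z \<in> vpoly_space k" and v: "v \<in> vpoly_space k" "v' \<in> vpoly_space k"
  shows "res6 Z t (\<lambda>x. c * v x + d * v' x) = c * res6 Z t v + d * res6 Z t v'"
proof -
  note cv = vpoly_space_continuous[OF v(1)] vpoly_space_continuous[OF v(2)]
  show ?thesis
    unfolding res6_def
    by (intro linear_comb;
      ((intro set_integrable_kcont bcontI cont_intros cont_derivs cont_of Z v cv; assumption) |
       ((rule AE_I2 | intro ballI allI), simp add: inner_linear gradS_comb[OF v])))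
qed

text \<open>Adding the six equations yields one bilinear form in solution and test tuple, the shape
  required by the abstract existence result.\<close>

definition residual :: "(real^'n \<Rightarrow> ('n, 'h) hdg_tuple) \<Rightarrow> real \<Rightarrow> (real^'n \<Rightarrow> ('n, 'h) hdg_tuple) \<Rightarrow> real" where
  "residual Z t Y = res1 Z t (L_of Y) + res2 Z t (u_of Y) + res3 Z t (p_of Y)
  + res4 Z t (H_of Y) + res5 Z t (b_of Y) + res6 Z t (r_of Y)"

lemma res_zero_test:
  assumes Z: "Z \<in> vpoly_space k"
  shows "res1 Z t (\<lambda>x. 0) = 0" "res2 Z t (\<lambda>x. 0) = 0" "res3 Z t (\<lambda>x. 0) = 0"
    "res4 Z t (\<lambda>x. 0) = 0" "res5 Z t (\<lambda>x. 0) = 0" "res6 Z t (\<lambda>x. 0) = 0"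
  using res1_linear_right[OF Z vpoly_space_zero vpoly_space_zero, where c = 0 and d = 0 and t = t]
    res2_linear_right[OF Z vpoly_space_zero vpoly_space_zero, where c = 0 and d = 0 and t = t]
    res3_linear_right[OF Z vpoly_space_zero vpoly_space_zero, where c = 0 and d = 0 and t = t]
    res4_linear_right[OF Z vpoly_space_zero vpoly_space_zero, where c = 0 and d = 0 and t = t]
    res5_linear_right[OF Z vpoly_space_zero vpoly_space_zero, where c = 0 and d = 0 and t = t]
    res6_linear_right[OF Z vpoly_space_zero vpoly_space_zero, where c = 0 and d = 0 and t = t]
  by simp_all

text \<open>A test tuple with a single nonzero slot isolates one equation, because the other
  residuals vanish on the zero test function.\<close>

lemma residual_zero_iff:
  assumes Z: "Z \<in> vpoly_space k"
  shows "(\<forall>Y\<in>vpoly_space k. residual Z t Y = 0) \<longleftrightarrow>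
    hdg_system k Rey Rm \<kappa> dd w \<alpha>1 \<alpha>2 \<alpha>3 (\<lambda>e x. t *\<^sub>R uh e x) (\<lambda>e x. t *\<^sub>R bh e x) (\<lambda>e x. t * rh e x)
     (\<lambda>x. t *\<^sub>R g x) (\<lambda>x. t *\<^sub>R f x) (t * \<rho>) (L_of Z) (u_of Z) (p_of Z) (H_of Z) (b_of Z) (r_of Z)"
  unfolding hdg_system_iff_res
proof
  assume *: "\<forall>Y\<in>vpoly_space k. residual Z t Y = 0"
  have 0: "(\<lambda>x. 0) \<in> vpoly_space k" by (rule vpoly_space_zero)
  show "(\<forall>G\<in>vpoly_space k. res1 Z t G = 0) \<and> (\<forall>v\<in>vpoly_space k. res2 Z t v = 0) \<and>
   (\<forall>q\<in>vpoly_space k. res3 Z t q = 0) \<and> (\<forall>J\<in>vpoly_space k. res4 Z t J = 0) \<and>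
   (\<forall>c\<in>vpoly_space k. res5 Z t c = 0) \<and> (\<forall>s\<in>vpoly_space k. res6 Z t s = 0)"
  proof (intro conjI ballI)
    fix G :: "real^'n \<Rightarrow> real^'n^'n" assume G: "G \<in> vpoly_space k"
    have "(\<lambda>x. (G x, 0, 0, 0, 0, 0)) \<in> vpoly_space k" by (intro vpoly_space_Pair G vpoly_space_zero)
    then have "residual Z t (\<lambda>x. (G x, 0, 0, 0, 0, 0)) = 0" using * by blast
    then show "res1 Z t G = 0" by (simp add: residual_def of_defs res_zero_test[OF Z])
  next
    fix G :: "real^'n \<Rightarrow> real^'n" assume G: "G \<in> vpoly_space k"
    have "(\<lambda>x. (0, G x, 0, 0, 0, 0)) \<in> vpoly_space k" by (intro vpoly_space_Pair G vpoly_space_zero)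
    then have "residual Z t (\<lambda>x. (0, G x, 0, 0, 0, 0)) = 0" using * by blast
    then show "res2 Z t G = 0" by (simp add: residual_def of_defs res_zero_test[OF Z])
  next
    fix G :: "real^'n \<Rightarrow> real" assume G: "G \<in> vpoly_space k"
    have "(\<lambda>x. (0, 0, G x, 0, 0, 0)) \<in> vpoly_space k" by (intro vpoly_space_Pair G vpoly_space_zero)
    then have "residual Z t (\<lambda>x. (0, 0, G x, 0, 0, 0)) = 0" using * by blast
    then show "res3 Z t G = 0" by (simp add: residual_def of_defs res_zero_test[OF Z])
  next
    fix G :: "real^'n \<Rightarrow> 'h" assume G: "G \<in> vpoly_space k"
    have "(\<lambda>x. (0, 0, 0, G x, 0, 0)) \<in> vpoly_space k" by (intro vpoly_space_Pair G vpoly_space_zero)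
    then have "residual Z t (\<lambda>x. (0, 0, 0, G x, 0, 0)) = 0" using * by blast
    then show "res4 Z t G = 0" by (simp add: residual_def of_defs res_zero_test[OF Z])
  next
    fix G :: "real^'n \<Rightarrow> real^'n" assume G: "G \<in> vpoly_space k"
    have "(\<lambda>x. (0, 0, 0, 0, G x, 0)) \<in> vpoly_space k" by (intro vpoly_space_Pair G vpoly_space_zero)
    then have "residual Z t (\<lambda>x. (0, 0, 0, 0, G x, 0)) = 0" using * by blast
    then show "res5 Z t G = 0" by (simp add: residual_def of_defs res_zero_test[OF Z])
  next
    fix G :: "real^'n \<Rightarrow> real" assume G: "G \<in> vpoly_space k"
    have "(\<lambda>x. (0, 0, 0, 0, 0, G x)) \<in> vpoly_space k" by (intro vpoly_space_Pair G vpoly_space_zero)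
    then have "residual Z t (\<lambda>x. (0, 0, 0, 0, 0, G x)) = 0" using * by blast
    then show "res6 Z t G = 0" by (simp add: residual_def of_defs res_zero_test[OF Z])
  qed
qed (simp add: residual_def vpoly_space_of del: vpoly_space_real)

theorem ex1_tuple:
  "\<exists>!Z. Z \<in> vpoly_space k \<and> (\<forall>Y\<in>vpoly_space k. residual Z 1 Y = 0)"
proof (rule ex1_solution_of_homogeneous_unique)
  fix Z Z' Y :: "real^'n \<Rightarrow> ('n, 'h) hdg_tuple" and t t' c d :: real
  assume V: "Z \<in> vpoly_space k" "Z' \<in> vpoly_space k" "Y \<in> vpoly_space k"
  note Y = vpoly_space_of[OF V(3)]
  show "residual (\<lambda>x. c *\<^sub>R Z x + d *\<^sub>R Z' x) (c * t + d * t') Y = c * residual Z t Y + d * residual Z' t' Y"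
    unfolding residual_def
    by (intro linear_comb_add res1_linear_left res2_linear_left res3_linear_left res4_linear_left res5_linear_left res6_linear_left V Y)
next
  fix Z Y Y' :: "real^'n \<Rightarrow> ('n, 'h) hdg_tuple" and t c d :: real
  assume V: "Z \<in> vpoly_space k" "Y \<in> vpoly_space k" "Y' \<in> vpoly_space k"
  note Y = vpoly_space_of[OF V(2)] vpoly_space_of[OF V(3)]
  show "residual Z t (\<lambda>x. c *\<^sub>R Y x + d *\<^sub>R Y' x) = c * residual Z t Y + d * residual Z t Y'"
    unfolding residual_def of_comb
    by (intro linear_comb_add res1_linear_right[OF V(1)] res2_linear_right[OF V(1)] res3_linear_right[OF V(1)]
      res4_linear_right[OF V(1)] res5_linear_right[OF V(1)] res6_linear_right[OF V(1)] Y)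
next
  fix Z :: "real^'n \<Rightarrow> ('n, 'h) hdg_tuple"
  assume Z: "Z \<in> vpoly_space k" and "\<And>Y. Y \<in> vpoly_space k \<Longrightarrow> residual Z 0 Y = 0"
  then have "hdg_system k Rey Rm \<kappa> dd w \<alpha>1 \<alpha>2 \<alpha>3 (\<lambda>e x. 0) (\<lambda>e x. 0) (\<lambda>e x. 0)
     (\<lambda>x. 0) (\<lambda>x. 0) 0 (L_of Z) (u_of Z) (p_of Z) (H_of Z) (b_of Z) (r_of Z)"
    using residual_zero_iff[OF Z, of 0] by simp
  note h = homogeneous_solution_zero[OF pos dd w div_w \<alpha>1 vpoly_space_of[OF Z] this]
  show "Z = (\<lambda>x. 0)"
  proof
    fix x
    show "Z x = 0" using h[of x] by (simp add: of_defs prod_eq_iff)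
  qed
qed

text \<open>Existence and uniqueness pass from one tuple-valued function to a tuple of functions,
  since forming the tuple pointwise and projecting are inverse to each other.\<close>

theorem ex1_solution:
  "\<exists>!X. case X of (L, u, p, H, b, r) \<Rightarrow>
      L \<in> vpoly_space k \<and> u \<in> vpoly_space k \<and> p \<in> vpoly_space k \<and>
      H \<in> vpoly_space k \<and> b \<in> vpoly_space k \<and> r \<in> vpoly_space k \<and>
      hdg_system k Rey Rm \<kappa> dd w \<alpha>1 \<alpha>2 \<alpha>3 uh bh rh g f \<rho> L u p H b r"
  (is "\<exists>!X. ?P X")
proof -
  let ?sys = "\<lambda>Z. hdg_system k Rey Rm \<kappa> dd w \<alpha>1 \<alpha>2 \<alpha>3 uh bh rh g f \<rho> (L_of Z) (u_of Z) (p_of Z) (H_of Z) (b_of Z) (r_of Z)"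
  have iff: "(\<forall>Y\<in>vpoly_space k. residual Z 1 Y = 0) \<longleftrightarrow> ?sys Z" if "Z \<in> vpoly_space k" for Z
    using residual_zero_iff[OF that, of 1] by simp
  obtain Z where Z: "Z \<in> vpoly_space k" "?sys Z" and uniq: "\<And>Z'. Z' \<in> vpoly_space k \<Longrightarrow> ?sys Z' \<Longrightarrow> Z' = Z"
    using ex1_tuple iff by (metis (no_types, lifting))
  show ?thesis
  proof (rule ex1I[of _ "(L_of Z, u_of Z, p_of Z, H_of Z, b_of Z, r_of Z)"])
    show "?P (L_of Z, u_of Z, p_of Z, H_of Z, b_of Z, r_of Z)"
      using Z vpoly_space_of[OF Z(1)] by simp
    fix X assume X: "?P X"
    obtain L u p H b r where Xe: "X = (L, u, p, H, b, r)" by (cases X) auto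
    let ?Z = "\<lambda>x. (L x, u x, p x, H x, b x, r x)"
    have e: "L_of ?Z = L" "u_of ?Z = u" "p_of ?Z = p" "H_of ?Z = H" "b_of ?Z = b" "r_of ?Z = r"
      by (simp_all add: of_defs)
    have "?Z \<in> vpoly_space k" using X unfolding Xe by (intro vpoly_space_Pair) auto
    moreover have "?sys ?Z" using X unfolding Xe e by simp
    ultimately have "?Z = Z" by (rule uniq)
    then show "X = (L_of Z, u_of Z, p_of Z, H_of Z, b_of Z, r_of Z)"
      using e unfolding Xe by simp
  qed
qed

end

section \<open>Simplices\<close>

lemma simplex_edges_span:
  fixes p :: "nat \<Rightarrow> real^'n"
  assumes p: "simplex_vertices p" and i: "i \<le> CARD('n)"
  shows "independent ((\<lambda>j. p j - p i) ` ({0..CARD('n)} - {i}))"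
    and "inj_on (\<lambda>j. p j - p i) ({0..CARD('n)} - {i})"
    and "span ((\<lambda>j. p j - p i) ` ({0..CARD('n)} - {i})) = UNIV"
proof -
  let ?V = "{0..CARD('n)}" and ?B = "(\<lambda>j. p j - p i) ` ({0..CARD('n)} - {i})"
  have inj: "inj_on p ?V" and aff: "\<not> affine_dependent (p ` ?V)"
    using p by (auto simp: simplex_vertices_def)
  have im: "(\<lambda>x. - p i + x) ` (p ` ?V - {p i}) = ?B"
  proof -
    have "p ` ?V - {p i} = p ` (?V - {i})"
      using inj_on_image_set_diff[OF inj, of ?V "{i}"] i by simp
    then show ?thesis by (simp add: image_image)
  qed
  show ind: "independent ?B"
    using aff affine_dependent_iff_dependent2[of "p i" "p ` ?V"] i unfolding im by simp
  show inj': "inj_on (\<lambda>j. p j - p i) (?V - {i})"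
  proof (rule inj_onI)
    fix j j' assume "j \<in> ?V - {i}" "j' \<in> ?V - {i}" "p j - p i = p j' - p i"
    then show "j = j'" using inj_onD[OF inj, of j j'] by simp
  qed
  have "card ?B = CARD('n)" using inj' i by (simp add: card_image)
  then have "UNIV \<subseteq> span ?B"
    using ind by (intro card_ge_dim_independent) (auto simp: dim_UNIV)
  then show "span ?B = UNIV" by auto
qed

text \<open>The edges from one vertex span the space, so \<open>z\<close> is orthogonal to itself.
  This single fact later gives uniqueness of normals, nonzero determinants and the reduction of the
  divergence theorem to edges.\<close>

lemma simplex_edges_orthogonal_zero:
  fixes p :: "nat \<Rightarrow> real^'n"
  assumes p: "simplex_vertices p" and i: "i \<le> CARD('n)"
    and orth: "\<And>j. j \<le> CARD('n) \<Longrightarrow> (p j - p i) \<bullet> z = 0"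
  shows "z = 0"
proof -
  have "z \<in> span ((\<lambda>j. p j - p i) ` ({0..CARD('n)} - {i}))"
    unfolding simplex_edges_span(3)[OF p i] by simp
  then have "orthogonal z z"
    by (rule orthogonal_to_span) (use orth in \<open>auto simp: orthogonal_def inner_commute\<close>)
  then show ?thesis by (simp add: orthogonal_self)
qed

text \<open>The definite description is justified by existence and uniqueness. The normal is
  obtained from the edge joining a face vertex to vertex \<open>i\<close>: its component orthogonal
  to the face, normalised and reversed.\<close>

lemma onormal:
  fixes p :: "nat \<Rightarrow> real^'n"
  assumes p: "simplex_vertices p" and i: "i \<le> CARD('n)"
  shows onormal_norm: "norm (onormal p i) = 1"
    and onormal_orth: "\<And>j j'. j \<le> CARD('n) \<Longrightarrow> j' \<le> CARD('n) \<Longrightarrow> j \<noteq> i \<Longrightarrow> j' \<noteq> i \<Longrightarrow> (p j - p j') \<bullet> onormal p i = 0"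
    and onormal_neg: "\<And>j. j \<le> CARD('n) \<Longrightarrow> j \<noteq> i \<Longrightarrow> (p i - p j) \<bullet> onormal p i < 0"
proof -
  let ?V = "{0..CARD('n)}"
  let ?P = "\<lambda>n. norm n = 1 \<and> (\<forall>j\<in>?V - {i}. \<forall>j'\<in>?V - {i}. (p j - p j') \<bullet> n = 0) \<and> (\<forall>j\<in>?V - {i}. (p i - p j) \<bullet> n < 0)"
  obtain j0 where j0: "j0 \<in> ?V - {i}"
  proof (cases "i = 0")
    case True
    then show ?thesis by (intro that[of 1]) (auto simp: Suc_le_eq)
  qed (auto intro: that[of 0])
  have j0': "j0 \<le> CARD('n)" using j0 by simp
  have "\<exists>!n. ?P n"
  proof (rule ex_ex1I)
    let ?B = "(\<lambda>j. p j - p j0) ` (?V - {j0})"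
    let ?v = "p i - p j0"
    have vB: "?v \<in> ?B" using i j0 by auto
    have ind: "independent ?B" by (rule simplex_edges_span(1)[OF p j0'])
    have nv: "?v \<notin> span (?B - {?v})" using ind vB unfolding dependent_def by blast
    \<comment> \<open>Independence of the edges from \<open>p j0\<close> makes the orthogonal part
      \<open>z\<close> nonzero. The edge has product \<open>z . z > 0\<close> with \<open>z\<close>,
      so \<open>z\<close> points inward and the outward normal is \<open>- z / |z|\<close>.\<close>
    obtain y z where yz: "y \<in> span (?B - {?v})" "\<And>w. w \<in> span (?B - {?v}) \<Longrightarrow> orthogonal z w" "?v = y + z"
      using orthogonal_subspace_decomp_exists[of "?B - {?v}" ?v] by blast
    have z0: "z \<noteq> 0"
    proof
      assume "z = 0"
      then have "?v = y" using yz(3) by simp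
      then show False using nv yz(1) by simp
    qed
    have inS: "p j - p j0 \<in> span (?B - {?v})" if "j \<in> ?V - {i}" for j
    proof (cases "j = j0")
      case False
      then have "p j - p j0 \<in> ?B" using that by auto
      moreover have "p j - p j0 \<noteq> ?v"
      proof -
        have "inj_on p ?V" using p by (simp add: simplex_vertices_def)
        then have "p j \<noteq> p i" using that i inj_onD[of p ?V j i] by auto
        then show ?thesis by simp
      qed
      ultimately show ?thesis by (intro span_base) auto
    qed (simp add: span_zero)
    have orth: "(p j - p j0) \<bullet> z = 0" if "j \<in> ?V - {i}" for j
      using yz(2)[OF inS[OF that]] by (simp add: orthogonal_def inner_commute)
    have vz: "?v \<bullet> z = z \<bullet> z"
    proof -
      have "?v \<bullet> z = y \<bullet> z + z \<bullet> z" unfolding yz(3) by (rule inner_add_left)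
      then show ?thesis using yz(2)[OF yz(1)] by (simp add: orthogonal_def inner_commute)
    qed
    show "\<exists>n. ?P n"
    proof (intro exI conjI ballI)
      show "norm (- (1 / norm z) *\<^sub>R z) = 1" using z0 by simp
      fix j assume j: "j \<in> ?V - {i}"
      have "(p i - p j) \<bullet> z = z \<bullet> z" using orth[OF j] vz by (simp add: inner_diff_left)
      then show "(p i - p j) \<bullet> (- (1 / norm z) *\<^sub>R z) < 0" using z0 by (simp add: divide_pos_pos)
      fix j' assume j': "j' \<in> ?V - {i}"
      show "(p j - p j') \<bullet> (- (1 / norm z) *\<^sub>R z) = 0"
        using orth[OF j] orth[OF j'] by (simp add: inner_diff_left)
    qed
  next
    fix n n' assume n: "?P n" and n': "?P n'"
    define v where "v = p i - p j0"
    \<comment> \<open>With these weights \<open>s' n - s n'\<close> is orthogonal also to the edge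
      towards vertex \<open>i\<close>, hence to all edges from \<open>p j0\<close>, and is zero.
      Unit length and equal signs of \<open>s\<close> and \<open>s'\<close> then give
      \<open>n = n'\<close>.\<close>
    define s s' where "s = v \<bullet> n" and "s' = v \<bullet> n'"
    have neg: "s < 0" "s' < 0"
      unfolding s_def s'_def v_def
      by (rule n[THEN conjunct2, THEN conjunct2, rule_format, OF j0] n'[THEN conjunct2, THEN conjunct2, rule_format, OF j0])+
    have norms: "norm n = 1" "norm n' = 1" by (rule n[THEN conjunct1] n'[THEN conjunct1])+
    have "s' *\<^sub>R n - s *\<^sub>R n' = 0"
    proof (rule simplex_edges_orthogonal_zero[OF p j0'])
      fix j assume j: "j \<le> CARD('n)"
      show "(p j - p j0) \<bullet> (s' *\<^sub>R n - s *\<^sub>R n') = 0"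
      proof (cases "j = i")
        case True
        have "v \<bullet> (s' *\<^sub>R n - s *\<^sub>R n') = 0"
          unfolding inner_diff_right inner_scaleR_right s_def[symmetric] s'_def[symmetric] by simp
        then show ?thesis using True by (simp add: v_def)
      next
        case False
        then have "j \<in> ?V - {i}" using j by simp
        then have "(p j - p j0) \<bullet> n = 0" "(p j - p j0) \<bullet> n' = 0"
          by (rule n[THEN conjunct2, THEN conjunct1, rule_format, OF _ j0] n'[THEN conjunct2, THEN conjunct1, rule_format, OF _ j0])+
        then show ?thesis unfolding inner_diff_right inner_scaleR_right by simp
      qed
    qed
    then have eq: "s' *\<^sub>R n = s *\<^sub>R n'" by simp
    then have "norm (s' *\<^sub>R n) = norm (s *\<^sub>R n')" by (rule arg_cong)
    then have "s' = s" using neg norms by simp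
    then show "n = n'" using eq neg by simp
  qed
  then have P: "?P (onormal p i)" unfolding onormal_def by (rule theI')
  then show "norm (onormal p i) = 1" by (rule conjunct1)
  show "\<And>j j'. j \<le> CARD('n) \<Longrightarrow> j' \<le> CARD('n) \<Longrightarrow> j \<noteq> i \<Longrightarrow> j' \<noteq> i \<Longrightarrow> (p j - p j') \<bullet> onormal p i = 0"
    by (rule P[THEN conjunct2, THEN conjunct1, rule_format]) auto
  show "\<And>j. j \<le> CARD('n) \<Longrightarrow> j \<noteq> i \<Longrightarrow> (p i - p j) \<bullet> onormal p i < 0"
    by (rule P[THEN conjunct2, THEN conjunct2, rule_format]) auto
qed

lemma simplex_of_eq:
  fixes p :: "nat \<Rightarrow> real^'n"
  assumes "simplex_vertices p"
  shows "simplex_of p = {x. \<exists>u. (\<forall>i\<le>CARD('n). 0 \<le> u i) \<and> (\<Sum>i\<le>CARD('n). u i) = 1 \<and> x = (\<Sum>i\<le>CARD('n). u i *\<^sub>R p i)}"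
proof -
  have inj: "inj_on p {..CARD('n)}" using assms by (simp add: simplex_vertices_def atLeast0AtMost)
  have inv: "inv_into {..CARD('n)} p (p i) = i" if "i \<le> CARD('n)" for i using inj that by simp
  have "simplex_of p = {y. \<exists>u. (\<forall>x\<in>p ` {..CARD('n)}. 0 \<le> u x) \<and> sum u (p ` {..CARD('n)}) = 1 \<and> (\<Sum>x\<in>p ` {..CARD('n)}. u x *\<^sub>R x) = y}"
    by (simp add: simplex_of_def atLeast0AtMost convex_hull_finite)
  also have "\<dots> = {x. \<exists>u. (\<forall>i\<le>CARD('n). 0 \<le> u i) \<and> (\<Sum>i\<le>CARD('n). u i) = 1 \<and> x = (\<Sum>i\<le>CARD('n). u i *\<^sub>R p i)}"
  proof (intro Collect_cong iffI)
    fix y assume "\<exists>u. (\<forall>x\<in>p ` {..CARD('n)}. 0 \<le> u x) \<and> sum u (p ` {..CARD('n)}) = 1 \<and> (\<Sum>x\<in>p ` {..CARD('n)}. u x *\<^sub>R x) = y"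
    then obtain u where u: "\<forall>x\<in>p ` {..CARD('n)}. 0 \<le> u x" "sum u (p ` {..CARD('n)}) = 1" "(\<Sum>x\<in>p ` {..CARD('n)}. u x *\<^sub>R x) = y"
      by blast
    then show "\<exists>u. (\<forall>i\<le>CARD('n). 0 \<le> u i) \<and> (\<Sum>i\<le>CARD('n). u i) = 1 \<and> y = (\<Sum>i\<le>CARD('n). u i *\<^sub>R p i)"
      unfolding sum.reindex[OF inj] o_def by (intro exI[of _ "\<lambda>i. u (p i)"] conjI) simp_all
  next
    fix y assume "\<exists>u. (\<forall>i\<le>CARD('n). 0 \<le> u i) \<and> (\<Sum>i\<le>CARD('n). u i) = 1 \<and> y = (\<Sum>i\<le>CARD('n). u i *\<^sub>R p i)"
    then obtain u where u: "\<forall>i\<le>CARD('n). 0 \<le> u i" "(\<Sum>i\<le>CARD('n). u i) = 1" "y = (\<Sum>i\<le>CARD('n). u i *\<^sub>R p i)"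
      by blast
    then show "\<exists>u. (\<forall>x\<in>p ` {..CARD('n)}. 0 \<le> u x) \<and> sum u (p ` {..CARD('n)}) = 1 \<and> (\<Sum>x\<in>p ` {..CARD('n)}. u x *\<^sub>R x) = y"
    proof (intro exI conjI ballI)
      let ?u = "\<lambda>x. u (inv_into {..CARD('n)} p x)"
      show "0 \<le> ?u x" if "x \<in> p ` {..CARD('n)}" for x
        using that u(1) by (auto simp: inv)
      have "sum ?u (p ` {..CARD('n)}) = (\<Sum>i\<le>CARD('n). u i)"
        unfolding sum.reindex[OF inj] by (intro sum.cong) (simp_all add: inv)
      then show "sum ?u (p ` {..CARD('n)}) = 1" using u(2) by simp
      show "(\<Sum>x\<in>p ` {..CARD('n)}. ?u x *\<^sub>R x) = y"
        unfolding sum.reindex[OF inj] u(3) by (intro sum.cong) (simp_all add: inv)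
    qed
  qed
  finally show ?thesis .
qed

lemma simplex_of_props:
  fixes p :: "nat \<Rightarrow> real^'n"
  assumes p: "simplex_vertices p"
  shows "compact (simplex_of p)" "convex (simplex_of p)" "interior (simplex_of p) \<noteq> {}"
proof -
  show "compact (simplex_of p)" unfolding simplex_of_def by (intro compact_convex_hull finite_imp_compact) simp
  show "convex (simplex_of p)" by (simp add: simplex_of_def)
  have "card (p ` {0..CARD('n)}) = Suc (DIM(real^'n))"
    using p by (simp add: simplex_vertices_def card_image)
  from interior_convex_hull_eq_empty[OF this]
  show "interior (simplex_of p) \<noteq> {}" using p by (simp add: simplex_vertices_def simplex_of_def)
qed

text \<open>Among the products \<open>(x - p m) . n\<close>, those for vertices of the face vanish
  and the one for the opposite vertex is positive; the claim is their mean. This supplies the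
  star-shape condition with the centroid as centre.\<close>

lemma centroid_pos:
  fixes p :: "nat \<Rightarrow> real^'n"
  assumes p: "simplex_vertices p" and e: "e \<le> CARD('n)" and j: "j \<le> CARD('n)" "j \<noteq> e"
    and x: "(x - p j) \<bullet> onormal p e = 0"
  shows "0 < (x - (1 / real (Suc CARD('n))) *\<^sub>R (\<Sum>m\<le>CARD('n). p m)) \<bullet> onormal p e"
proof -
  let ?n = "onormal p e" and ?N = "real (Suc CARD('n))"
  have "?N * ((x - (1 / ?N) *\<^sub>R (\<Sum>m\<le>CARD('n). p m)) \<bullet> ?n) = (\<Sum>m\<le>CARD('n). (x - p m) \<bullet> ?n)"
    by (simp add: inner_diff_left sum_subtractf inner_sum_left algebra_simps del: of_nat_Suc)
  also have "\<dots> = (\<Sum>m\<le>CARD('n). (p j - p m) \<bullet> ?n)"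
    using x by (simp add: inner_diff_left)
  also have "\<dots> = (p j - p e) \<bullet> ?n"
    using onormal_orth[OF p e j(1) _ j(2)] e by (subst sum.remove[of _ e]) auto
  also have "\<dots> > 0" using onormal_neg[OF p e j] by (simp add: inner_diff_left)
  finally show ?thesis by (simp add: zero_less_mult_iff)
qed

text \<open>Polynomials from uniform approximation have no fixed degree bound, so their derivatives
  are treated by induction on the construction of the function, apart from
  \<open>poly_space k\<close>.\<close>

lemma real_polynomial_function_pd:
  fixes f :: "real^'n \<Rightarrow> real"
  assumes "real_polynomial_function f"
  shows "real_polynomial_function (pd j f)" and "(f has_derivative (\<lambda>h. \<Sum>j\<in>UNIV. (h $ j) * pd j f x)) (at x)"
proof -
  have "\<exists>f'. real_polynomial_function f' \<and> (\<forall>x. ((\<lambda>t. f (x + t *\<^sub>R axis j 1)) has_vector_derivative f' x) (at 0))"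
    using assms
  proof induction
    case (linear f)
    have "((\<lambda>t. f (x + t *\<^sub>R axis j 1)) has_vector_derivative f (axis j 1)) (at 0)" for x
      by (rule bounded_linear.has_vector_derivative[OF linear]) (auto intro!: derivative_eq_intros)
    then show ?case by (intro exI[of _ "\<lambda>x. f (axis j 1)"]) (auto intro: real_polynomial_function.intros(2))
  next
    case (const c)
    then show ?case by (intro exI[of _ "\<lambda>x. 0"]) (auto intro: real_polynomial_function.intros(2))
  next
    case (add f g)
    then obtain f' g' where "real_polynomial_function f'" "real_polynomial_function g'"
      "\<And>x. ((\<lambda>t. f (x + t *\<^sub>R axis j 1)) has_vector_derivative f' x) (at 0)"
      "\<And>x. ((\<lambda>t. g (x + t *\<^sub>R axis j 1)) has_vector_derivative g' x) (at 0)" by blast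
    then show ?case
      by (intro exI[of _ "\<lambda>x. f' x + g' x"]) (auto intro: real_polynomial_function.intros(3) has_vector_derivative_add)
  next
    case (mult f g)
    then obtain f' g' where fg: "real_polynomial_function f'" "real_polynomial_function g'"
      "\<And>x. ((\<lambda>t. f (x + t *\<^sub>R axis j 1)) has_vector_derivative f' x) (at 0)"
      "\<And>x. ((\<lambda>t. g (x + t *\<^sub>R axis j 1)) has_vector_derivative g' x) (at 0)" by blast
    have "((\<lambda>t. f (x + t *\<^sub>R axis j 1) * g (x + t *\<^sub>R axis j 1)) has_vector_derivative f x * g' x + f' x * g x) (at 0)" for x
      using has_vector_derivative_mult[OF fg(3,4)[of x]] by simp
    moreover have "real_polynomial_function (\<lambda>x. f x * g' x + f' x * g x)"
      using fg(1,2) mult.hyps by (intro real_polynomial_function.intros(3,4))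
    ultimately show ?case by (intro exI[of _ "\<lambda>x. f x * g' x + f' x * g x"]) blast
  qed
  then obtain f' where f': "real_polynomial_function f'" "\<And>x. ((\<lambda>t. f (x + t *\<^sub>R axis j 1)) has_vector_derivative f' x) (at 0)"
    by blast
  have "pd j f = f'" by (rule ext) (rule pd_eqI[OF f'(2)])
  then show "real_polynomial_function (pd j f)" using f'(1) by simp
  have "f differentiable at x" by (rule differentiable_at_real_polynomial_function[OF assms])
  then obtain D where D: "(f has_derivative D) (at x)" unfolding differentiable_def by blast
  have lin: "linear D" using D by (rule has_derivative_linear)
  have Dj: "D (axis j 1) = pd j f x" for j
  proof -
    have "((\<lambda>t. x + t *\<^sub>R axis j 1) has_vector_derivative axis j 1) (at (0::real))"
      by (auto intro!: derivative_eq_intros)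
    then have "((\<lambda>t. f (x + t *\<^sub>R axis j 1)) has_vector_derivative D (axis j 1)) (at 0)"
      using vector_derivative_diff_chain_within[of "\<lambda>t. x + t *\<^sub>R axis j 1" "axis j 1" 0 UNIV f D] D
      by (simp add: o_def has_derivative_at_withinI)
    then show ?thesis using pd_eqI by fastforce
  qed
  have "D h = (\<Sum>j\<in>UNIV. (h $ j) * pd j f x)" for h
    using linear_sum[OF lin, of "\<lambda>j. (h $ j) *\<^sub>R axis j 1" UNIV]
    by (simp add: vec_expand_axis[of h, symmetric] linear_cmul[OF lin] Dj)
  then have "D = (\<lambda>h. \<Sum>j\<in>UNIV. (h $ j) * pd j f x)" by (rule ext)
  then show "(f has_derivative (\<lambda>h. \<Sum>j\<in>UNIV. (h $ j) * pd j f x)) (at x)" using D by simp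
qed

section \<open>Affine change of variables and integration along edges\<close>

text \<open>Both measures are compared on boxes: if \<open>S\<close> is the preimage of a box,
  \<open>A\<close> maps \<open>S\<close> onto the box shifted by \<open>- b\<close>, so the volume
  of the box is \<open>|det A|\<close> times that of \<open>S\<close>.\<close>

lemma lborel_affine:
  fixes A :: "real^'n::{finite,wellorder} \<Rightarrow> real^'n::_"
  assumes A: "linear A" and det: "det (matrix A) \<noteq> 0"
  shows "density (distr lborel borel (\<lambda>y. b + A y)) (\<lambda>_. ennreal \<bar>det (matrix A)\<bar>) = lborel"
proof (rule lborel_eqI[symmetric])
  fix l u :: "real^'n::_" assume lu: "\<And>k. k \<in> Basis \<Longrightarrow> l \<bullet> k \<le> u \<bullet> k"
  let ?f = "\<lambda>y. b + A y"
  have inj: "inj A" using A det by (simp add: det_nz_iff_inj)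
  then have surj: "surj A" using A by (simp add: linear_injective_imp_surjective)
  have Am: "?f \<in> borel_measurable borel"
    using A by (intro borel_measurable_continuous_onI continuous_intros linear_continuous_on) (simp add: linear_conv_bounded_linear)
  let ?S = "?f -` box l u"
  have opn: "open ?S"
    using A by (intro open_vimage continuous_intros linear_continuous_on) (auto simp: linear_conv_bounded_linear)
  have AS: "A ` ?S = box (l - b) (u - b)"
  proof -
    have "A ` ?S = (\<lambda>x. x - b) ` box l u"
    proof safe
      fix y assume "b + A y \<in> box l u"
      then show "A y \<in> (\<lambda>x. x - b) ` box l u" by (intro image_eqI[of _ _ "b + A y"]) auto
    next
      fix x assume "x \<in> box l u"
      obtain y where "A y = x - b" using surj by (metis surjD)
      then show "x - b \<in> A ` ?S" using \<open>x \<in> box l u\<close> by (intro image_eqI[of _ _ y]) auto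
    qed
    also have "\<dots> = box (l - b) (u - b)"
    proof safe
      fix x assume "x \<in> box (l - b) (u - b)"
      then show "x \<in> (\<lambda>x. x - b) ` box l u"
        by (intro image_eqI[of _ _ "x + b"]) (auto simp: mem_box inner_diff_left inner_add_left algebra_simps)
    qed (auto simp: mem_box inner_diff_left)
    finally show ?thesis .
  qed
  obtain g where g: "linear g" "g \<circ> A = id" using linear_injective_left_inverse[OF A inj] by blast
  have "bounded (g ` (A ` ?S))" unfolding AS
    using g(1) by (intro bounded_linear_image) (auto simp: linear_conv_bounded_linear)
  moreover have "g ` (A ` ?S) = ?S"
    using g(2) by (simp add: image_image fun_eq_iff)
  ultimately have bnd: "bounded ?S" by simp
  have "measure lebesgue (A ` ?S) = \<bar>det (matrix A)\<bar> * measure lebesgue ?S"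
    using bnd opn A by (intro measure_lebesgue_linear_transformation) auto
  then have m: "measure lborel (box (l - b) (u - b)) = \<bar>det (matrix A)\<bar> * measure lborel ?S"
    unfolding AS using opn by simp
  have fin: "emeasure lborel ?S = ennreal (measure lborel ?S)"
    using emeasure_bounded_finite[OF bnd] by (simp add: emeasure_eq_ennreal_measure)
  have "emeasure (density (distr lborel borel ?f) (\<lambda>_. ennreal \<bar>det (matrix A)\<bar>)) (box l u)
      = ennreal \<bar>det (matrix A)\<bar> * emeasure (distr lborel borel ?f) (box l u)"
    by (simp add: emeasure_density_const)
  also have "emeasure (distr lborel borel ?f) (box l u) = emeasure lborel ?S"
    using Am by (simp add: emeasure_distr)
  also have "ennreal \<bar>det (matrix A)\<bar> * \<dots> = ennreal (measure lborel (box (l - b) (u - b)))"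
    unfolding fin m by (simp add: ennreal_mult)
  also have "measure lborel (box (l - b) (u - b)) = (\<Prod>k\<in>Basis. (u - l) \<bullet> k)"
    using lu by (subst measure_lborel_box) (auto simp: inner_diff_left)
  finally show "emeasure (density (distr lborel borel ?f) (\<lambda>_. ennreal \<bar>det (matrix A)\<bar>)) (box l u) = (\<Prod>k\<in>Basis. (u - l) \<bullet> k)" .
qed simp

text \<open>
  \<open>K\<close> is the union of the segments in direction \<open>v\<close> of length \<open>len q\<close> that start at \<open>\<psi> q\<close>; the
  fundamental theorem of calculus along these segments leaves the two end faces.
\<close>
lemma slab_divergence:
  fixes K :: "(real^'n) set" and T :: "'q::euclidean_space set" and \<psi> \<psi>' :: "'q \<Rightarrow> real^'n"
  assumes K: "compact K" and T: "compact T" and c: "0 \<le> c"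
    and \<psi>: "continuous_on UNIV \<psi>" and \<psi>': "continuous_on UNIV \<psi>'"
    and cov: "density (distr lborel borel (\<lambda>z. \<psi> (fst z) + snd z *\<^sub>R v)) (\<lambda>_. ennreal c) = lborel"
    and char: "\<And>q \<tau>. \<psi> q + \<tau> *\<^sub>R v \<in> K \<longleftrightarrow> q \<in> T \<and> 0 \<le> \<tau> \<and> \<tau> \<le> len q"
    and len: "\<And>q. q \<in> T \<Longrightarrow> 0 \<le> len q" and end_face: "\<And>q. q \<in> T \<Longrightarrow> \<psi>' q = \<psi> q + len q *\<^sub>R v"
    and g: "real_polynomial_function g"
  shows "(\<Sum>j\<in>UNIV. v $ j * vint K (pd j g)) = c * ((LINT q:T|lborel. g (\<psi>' q)) - (LINT q:T|lborel. g (\<psi> q)))"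
proof -
  let ?\<phi> = "\<lambda>x. \<Sum>j\<in>UNIV. v $ j * pd j g x"
  let ?l = "\<lambda>z. \<psi> (fst z) + snd z *\<^sub>R v"
  have cpd: "continuous_on S (pd j g)" for S j
    using real_polynomial_function_pd(1)[OF g] by (simp add: real_polynomial_function_eq continuous_on_polymonial_function)
  have cg: "continuous_on S g" for S
    using g by (simp add: real_polynomial_function_eq continuous_on_polymonial_function)
  have c\<phi>: "continuous_on S ?\<phi>" for S by (intro continuous_intros cpd)
  have \<psi>m: "\<psi> \<in> borel_measurable borel" using \<psi> by (rule borel_measurable_continuous_onI)
  have lm[measurable]: "?l \<in> borel_measurable borel"
    by (intro borel_measurable_continuous_onI continuous_intros continuous_on_compose2[OF \<psi>]) auto
  let ?h = "\<lambda>x. indicator K x * ?\<phi> x"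
  have hm[measurable]: "?h \<in> borel_measurable borel"
    using borel_measurable_continuous_on_indicator[OF borel_compact[OF K] c\<phi>] by simp
  have hint: "integrable lborel ?h"
    using set_integrable_lborel_continuous[OF K c\<phi>] by (simp add: set_integrable_def)
  have "(\<Sum>j\<in>UNIV. v $ j * vint K (pd j g)) = vint K ?\<phi>"
    by (subst vint_sum) (auto simp: vint_cmul intro!: set_integrable_continuous[OF K] continuous_intros cpd)
  also have "\<dots> = (\<integral>x. ?h x \<partial>lborel)"
    unfolding vint_eq_lborel[OF K c\<phi>] by (simp add: set_lebesgue_integral_def)
  also have "\<dots> = (\<integral>x. ?h x \<partial>density (distr lborel borel ?l) (\<lambda>_. ennreal c))" by (simp add: cov)
  also have "\<dots> = (\<integral>z. c * ?h (?l z) \<partial>lborel)"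
  proof -
    have "(\<integral>x. ?h x \<partial>density (distr lborel borel ?l) (\<lambda>_. ennreal c)) = (\<integral>x. c *\<^sub>R ?h x \<partial>distr lborel borel ?l)"
      by (rule integral_density) (use c hm in simp_all)
    also have "\<dots> = (\<integral>z. c *\<^sub>R ?h (?l z) \<partial>lborel)"
      by (rule integral_distr) (use lm hm in simp_all)
    finally show ?thesis by simp
  qed
  also have "\<dots> = c * (\<integral>z. ?h (?l z) \<partial>(lborel \<Otimes>\<^sub>M lborel))" by (simp add: lborel_prod)
  also have "(\<integral>z. ?h (?l z) \<partial>(lborel \<Otimes>\<^sub>M lborel)) = (\<integral>q. indicator T q * (g (\<psi>' q) - g (\<psi> q)) \<partial>lborel)"
  \<comment> \<open>For \<open>c = 0\<close> the hypothesis \<open>cov\<close> would make Lebesgue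
    measure zero, so this case is contradictory.\<close>
  proof (cases "c = 0")
    case True
    have "emeasure (density (distr lborel borel ?l) (\<lambda>_. ennreal c)) UNIV = 0"
      unfolding True by (simp add: emeasure_density_const)
    then show ?thesis unfolding cov by simp
  next
    case False
    have "integrable (density (distr lborel borel ?l) (\<lambda>_. ennreal c)) ?h" using hint by (simp add: cov)
    then have "integrable (distr lborel borel ?l) (\<lambda>x. c *\<^sub>R ?h x)"
      by (subst (asm) integrable_density) (use c hm in simp_all)
    then have "integrable lborel (\<lambda>z. c *\<^sub>R ?h (?l z))"
      by (subst (asm) integrable_distr_eq) (use lm hm in simp_all)
    then have int: "integrable (lborel \<Otimes>\<^sub>M lborel) (\<lambda>z. ?h (?l z))" using False by (simp add: lborel_prod)
    have "(\<integral>z. ?h (?l z) \<partial>(lborel \<Otimes>\<^sub>M lborel)) = (\<integral>q. (\<integral>\<tau>. ?h (?l (q, \<tau>)) \<partial>lborel) \<partial>lborel)"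
      by (rule lborel_pair.integral_fst'[OF int, symmetric])
    also have "\<dots> = (\<integral>q. indicator T q * (g (\<psi>' q) - g (\<psi> q)) \<partial>lborel)"
    proof (rule Bochner_Integration.integral_cong[OF refl])
      fix q
      show "(\<integral>\<tau>. ?h (?l (q, \<tau>)) \<partial>lborel) = indicator T q * (g (\<psi>' q) - g (\<psi> q))"
      proof (cases "q \<in> T")
        case True
        \<comment> \<open>By \<open>char\<close> the line through \<open>\<psi> q\<close> in
          direction \<open>v\<close> meets \<open>K\<close> exactly for parameters between 0 and
          \<open>len q\<close>.\<close>
        have "(\<integral>\<tau>. ?h (?l (q, \<tau>)) \<partial>lborel) = (\<integral>\<tau>. ?\<phi> (\<psi> q + \<tau> *\<^sub>R v) * indicator {0..len q} \<tau> \<partial>lborel)"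
          using True by (intro Bochner_Integration.integral_cong refl) (simp add: indicator_def char)
        also have "\<dots> = g (\<psi> q + len q *\<^sub>R v) - g (\<psi> q + 0 *\<^sub>R v)"
        proof (rule integral_FTC_Icc_real)
          show "0 \<le> len q" using len[OF True] .
          fix \<tau> :: real
          have "((\<lambda>\<tau>. \<psi> q + \<tau> *\<^sub>R v) has_vector_derivative v) (at \<tau>)"
            by (auto intro!: derivative_eq_intros)
          from vector_derivative_diff_chain_within[OF this has_derivative_at_withinI[OF real_polynomial_function_pd(2)[OF g]]]
          have "((\<lambda>\<tau>. g (\<psi> q + \<tau> *\<^sub>R v)) has_vector_derivative ?\<phi> (\<psi> q + \<tau> *\<^sub>R v)) (at \<tau>)"
            by (simp add: o_def)
          then show "DERIV (\<lambda>\<tau>. g (\<psi> q + \<tau> *\<^sub>R v)) \<tau> :> ?\<phi> (\<psi> q + \<tau> *\<^sub>R v)"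
            by (simp add: has_real_derivative_iff_has_vector_derivative)
          show "isCont (\<lambda>\<tau>. ?\<phi> (\<psi> q + \<tau> *\<^sub>R v)) \<tau>"
          proof -
            have "continuous_on UNIV (\<lambda>\<tau>::real. ?\<phi> (\<psi> q + \<tau> *\<^sub>R v))"
              by (rule continuous_on_compose2[OF c\<phi>[of UNIV]]) (intro continuous_intros, simp)
            then show ?thesis by (simp add: continuous_on_eq_continuous_at)
          qed
        qed
        finally show ?thesis using True end_face[OF True] by simp
      next
        case False
        then show ?thesis by (simp add: indicator_def char)
      qed
    qed
    finally show ?thesis .
  qed
  also have "\<dots> = (LINT q:T|lborel. g (\<psi>' q)) - (LINT q:T|lborel. g (\<psi> q))"
  proof -
    have "set_integrable lborel T (\<lambda>q. g (\<psi>' q))" "set_integrable lborel T (\<lambda>q. g (\<psi> q))"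
      by (intro set_integrable_lborel_continuous[OF T] continuous_on_compose2[OF cg[of UNIV]]
        continuous_on_subset[OF \<psi>] continuous_on_subset[OF \<psi>'], auto)+
    from set_integral_diff(2)[OF this] show ?thesis
      by (simp add: set_lebesgue_integral_def)
  qed
  finally show ?thesis .
qed

text \<open>It suffices to test the divergence theorem against the edges \<open>p (i + 1) - p i\<close>, which span the space.\<close>
lemma gauss_of_edges:
  fixes p :: "nat \<Rightarrow> real^'n"
  assumes p: "simplex_vertices p"
    and edge: "\<And>i. i < CARD('n) \<Longrightarrow> (\<Sum>j\<in>UNIV. (p (Suc i) - p i) $ j * V j) = c * (I i - I (Suc i))"
    and pos: "\<And>i. i < CARD('n) \<Longrightarrow> a i * ((p (Suc i) - p i) \<bullet> onormal p i) = c"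
    and neg: "\<And>i. i < CARD('n) \<Longrightarrow> a (Suc i) * ((p (Suc i) - p i) \<bullet> onormal p (Suc i)) = - c"
  shows "V j = (\<Sum>e\<in>{0..CARD('n)}. a e * (onormal p e $ j * I e))"
proof -
  define z :: "real^'n" where "z = (\<chi> j. V j - (\<Sum>e\<in>{0..CARD('n)}. a e * (onormal p e $ j * I e)))"
  have orth: "(p (Suc i) - p i) \<bullet> z = 0" if i: "i < CARD('n)" for i
  proof -
    let ?v = "p (Suc i) - p i"
    have "?v \<bullet> z = (\<Sum>j\<in>UNIV. ?v $ j * V j) - (\<Sum>j\<in>UNIV. \<Sum>e\<in>{0..CARD('n)}. ?v $ j * (a e * (onormal p e $ j * I e)))"
      by (simp add: z_def inner_vec_def right_diff_distrib sum_subtractf sum_distrib_left)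
    also have "(\<Sum>j\<in>UNIV. \<Sum>e\<in>{0..CARD('n)}. ?v $ j * (a e * (onormal p e $ j * I e))) =
        (\<Sum>e\<in>{0..CARD('n)}. a e * (?v \<bullet> onormal p e) * I e)"
      by (subst sum.swap) (simp add: inner_vec_def sum_distrib_left sum_distrib_right mult_ac)
    \<comment> \<open>The face opposite any other vertex contains both \<open>p i\<close> and
      \<open>p (Suc i)\<close>, so the edge is tangential to it.\<close>
    also have "\<dots> = (\<Sum>e\<in>{i, Suc i}. a e * (?v \<bullet> onormal p e) * I e)"
    proof (rule sum.mono_neutral_right)
      show "\<forall>e\<in>{0..CARD('n)} - {i, Suc i}. a e * (?v \<bullet> onormal p e) * I e = 0"
        using onormal_orth[OF p] i by auto
    qed (use i in auto)
    also have "\<dots> = c * (I i - I (Suc i))" by (simp add: pos[OF i] neg[OF i] right_diff_distrib)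
    finally show ?thesis using edge[OF i] by simp
  qed
  \<comment> \<open>Consecutive edges telescope to the edges from \<open>p 0\<close>, which span the
    space.\<close>
  have "(p i - p 0) \<bullet> z = 0" if "i \<le> CARD('n)" for i
    using that
  proof (induction i)
    case (Suc i)
    then have "(p i - p 0) \<bullet> z = 0" "(p (Suc i) - p i) \<bullet> z = 0" using orth[of i] by auto
    then show ?case by (simp add: inner_diff_left)
  qed simp
  then have "z = 0" by (intro simplex_edges_orthogonal_zero[OF p, of 0]) auto
  then have "z $ j = 0" by simp
  then show ?thesis by (simp add: z_def)
qed

lemma prod_Basis_vec: "(\<Prod>b\<in>Basis. (y :: real^'n) \<bullet> b) = (\<Prod>i\<in>UNIV. y $ i)"
proof -
  have B: "(Basis :: (real^'n) set) = range (\<lambda>i. axis i 1)" by (auto simp: Basis_vec_def)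
  have inj: "inj (\<lambda>i. axis i (1::real) :: real^'n)" by (auto simp: inj_on_def axis_eq_axis)
  have "(\<Prod>b\<in>Basis. y \<bullet> b) = prod ((\<bullet>) y \<circ> (\<lambda>i. axis i 1)) UNIV"
    unfolding B by (rule prod.reindex[OF inj])
  then show ?thesis by (simp add: inner_axis)
qed

text \<open>A face parameter and a position along an edge form an element of a product space, where
  Fubini applies; the determinant formula lives on \<open>real^2\<close>. This map carries one
  Lebesgue measure to the other.\<close>

definition pair_vec :: "real \<times> real \<Rightarrow> real^2" where
  "pair_vec z = fst z *\<^sub>R axis 1 1 + snd z *\<^sub>R axis 2 1"

lemma pair_vec_nth [simp]: "pair_vec z $ 1 = fst z" "pair_vec z $ 2 = snd z"
  by (simp_all add: pair_vec_def axis_def)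

text \<open>Nested to the left: the inner pair parametrises a face, the last entry is the position
  along an edge.\<close>

definition triple_vec :: "(real \<times> real) \<times> real \<Rightarrow> real^3" where
  "triple_vec z = fst (fst z) *\<^sub>R axis 1 1 + snd (fst z) *\<^sub>R axis 2 1 + snd z *\<^sub>R axis 3 1"

lemma triple_vec_nth [simp]: "triple_vec z $ 1 = fst (fst z)" "triple_vec z $ 2 = snd (fst z)" "triple_vec z $ 3 = snd z"
  by (simp_all add: triple_vec_def axis_def)

lemma pair_vec_measurable [measurable]: "pair_vec \<in> borel_measurable borel"
  unfolding pair_vec_def[abs_def] by (intro borel_measurable_continuous_onI continuous_intros)

lemma triple_vec_measurable [measurable]: "triple_vec \<in> borel_measurable borel"
  unfolding triple_vec_def[abs_def] by (intro borel_measurable_continuous_onI continuous_intros)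

lemma distr_pair_vec: "distr lborel borel pair_vec = lborel"
proof (rule lborel_eqI[symmetric])
  fix l u :: "real^2" assume lu: "\<And>b. b \<in> Basis \<Longrightarrow> l \<bullet> b \<le> u \<bullet> b"
  have le: "l $ i \<le> u $ i" for i using lu[of "axis i 1"] by (simp add: inner_axis)
  have "pair_vec -` box l u = {l $ 1<..<u $ 1} \<times> {l $ 2<..<u $ 2}"
    by (auto simp: mem_box_cart forall_2)
  then have "emeasure (distr lborel borel pair_vec) (box l u) = emeasure (lborel \<Otimes>\<^sub>M lborel) ({l $ 1<..<u $ 1} \<times> {l $ 2<..<u $ 2})"
    by (simp add: emeasure_distr lborel_prod)
  also have "\<dots> = ennreal ((u $ 1 - l $ 1) * (u $ 2 - l $ 2))"
    using le by (simp add: lborel.emeasure_pair_measure_Times ennreal_mult)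
  also have "(u $ 1 - l $ 1) * (u $ 2 - l $ 2) = (\<Prod>b\<in>Basis. (u - l) \<bullet> b)"
    by (simp add: prod_Basis_vec UNIV_2)
  finally show "emeasure (distr lborel borel pair_vec) (box l u) = ennreal (\<Prod>b\<in>Basis. (u - l) \<bullet> b)" .
qed simp

lemma distr_triple_vec: "distr lborel borel triple_vec = lborel"
proof (rule lborel_eqI[symmetric])
  fix l u :: "real^3" assume lu: "\<And>b. b \<in> Basis \<Longrightarrow> l \<bullet> b \<le> u \<bullet> b"
  have le: "l $ i \<le> u $ i" for i using lu[of "axis i 1"] by (simp add: inner_axis)
  have prodE: "(\<Prod>b\<in>Basis. (u - l) \<bullet> b) = (u $ 1 - l $ 1) * (u $ 2 - l $ 2) * (u $ 3 - l $ 3)"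
    unfolding prod_Basis_vec UNIV_3 by (simp add: ac_simps)
  have AB: "emeasure (lborel \<Otimes>\<^sub>M lborel) ({l $ 1<..<u $ 1} \<times> {l $ 2<..<u $ 2}) = ennreal ((u $ 1 - l $ 1) * (u $ 2 - l $ 2))"
    using le by (simp add: lborel.emeasure_pair_measure_Times ennreal_mult)
  have "triple_vec -` box l u = ({l $ 1<..<u $ 1} \<times> {l $ 2<..<u $ 2}) \<times> {l $ 3<..<u $ 3}"
    by (simp add: set_eq_iff mem_box_cart forall_3 mem_Times_iff conj_ac)
  moreover have "emeasure (distr lborel borel triple_vec) (box l u) = emeasure lborel (triple_vec -` box l u)"
    by (simp add: emeasure_distr)
  ultimately have "emeasure (distr lborel borel triple_vec) (box l u) =
      emeasure (lborel \<Otimes>\<^sub>M lborel) (({l $ 1<..<u $ 1} \<times> {l $ 2<..<u $ 2}) \<times> {l $ 3<..<u $ 3})"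
    unfolding lborel_prod by (simp only:)
  also have "\<dots> = emeasure (lborel \<Otimes>\<^sub>M lborel) ({l $ 1<..<u $ 1} \<times> {l $ 2<..<u $ 2}) * ennreal (u $ 3 - l $ 3)"
  proof -
    have "{l $ 1<..<u $ 1} \<times> {l $ 2<..<u $ 2} \<in> sets lborel" by (simp add: borel_open open_Times)
    moreover have "{l $ 3<..<u $ 3} \<in> sets lborel" by simp
    ultimately have "emeasure (lborel \<Otimes>\<^sub>M lborel) (({l $ 1<..<u $ 1} \<times> {l $ 2<..<u $ 2}) \<times> {l $ 3<..<u $ 3}) =
        emeasure lborel ({l $ 1<..<u $ 1} \<times> {l $ 2<..<u $ 2}) * emeasure lborel {l $ 3<..<u $ 3}"
      by (rule lborel.emeasure_pair_measure_Times)
    then show ?thesis unfolding emeasure_lborel_Ioo[OF le] lborel_prod .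
  qed
  also have "\<dots> = ennreal ((u $ 1 - l $ 1) * (u $ 2 - l $ 2)) * ennreal (u $ 3 - l $ 3)"
    by (simp only: AB)
  also have "\<dots> = ennreal ((u $ 1 - l $ 1) * (u $ 2 - l $ 2) * (u $ 3 - l $ 3))"
    using le by (intro ennreal_mult[symmetric]) simp_all
  also have "\<dots> = ennreal (\<Prod>b\<in>Basis. (u - l) \<bullet> b)"
    by (simp only: prodE)
  finally show "emeasure (distr lborel borel triple_vec) (box l u) = ennreal (\<Prod>b\<in>Basis. (u - l) \<bullet> b)" .
qed simp

lemma lborel_affine_param:
  fixes A :: "real^'n::{finite,wellorder} \<Rightarrow> real^'n::_" and \<iota> :: "'z::euclidean_space \<Rightarrow> real^'n::_"
  assumes \<iota>: "distr lborel borel \<iota> = lborel" "\<iota> \<in> borel_measurable borel"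
    and A: "linear A" "det (matrix A) \<noteq> 0"
  shows "density (distr lborel borel (\<lambda>z. b + A (\<iota> z))) (\<lambda>_. ennreal \<bar>det (matrix A)\<bar>) = lborel"
proof -
  have Am: "(\<lambda>y. b + A y) \<in> borel_measurable borel"
    using A by (intro borel_measurable_continuous_onI continuous_intros linear_continuous_on) (simp add: linear_conv_bounded_linear)
  have "distr lborel borel (\<lambda>z. b + A (\<iota> z)) = distr (distr lborel borel \<iota>) borel (\<lambda>y. b + A y)"
    using Am \<iota>(2) by (subst distr_distr) (auto simp: o_def)
  then show ?thesis using lborel_affine[OF A, of b] \<iota>(1) by simp
qed

lemma lborel_slab2:
  assumes "cross2VV e v \<noteq> 0"
  shows "density (distr lborel borel (\<lambda>z. (b + fst z *\<^sub>R e) + snd z *\<^sub>R v)) (\<lambda>_. ennreal \<bar>cross2VV e v\<bar>) = lborel"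
proof -
  define A where "A y = y $ 1 *\<^sub>R e + y $ 2 *\<^sub>R v" for y :: "real^2"
  have A: "linear A" by (rule linearI) (simp_all add: A_def algebra_simps)
  have det: "det (matrix A) = cross2VV e v"
    by (simp add: det_2 matrix_def A_def axis_def cross2VV_def)
  show ?thesis
    using lborel_affine_param[OF distr_pair_vec pair_vec_measurable A, of b] assms
    unfolding det by (simp add: A_def add.assoc)
qed

lemma lborel_slab3:
  assumes "cross3 e e' \<bullet> v \<noteq> 0"
  shows "density (distr lborel borel (\<lambda>z. (b + fst (fst z) *\<^sub>R e + snd (fst z) *\<^sub>R e') + snd z *\<^sub>R v)) (\<lambda>_. ennreal \<bar>cross3 e e' \<bullet> v\<bar>) = lborel"
proof -
  define A where "A y = y $ 1 *\<^sub>R e + y $ 2 *\<^sub>R e' + y $ 3 *\<^sub>R v" for y :: "real^3"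
  have A: "linear A" by (rule linearI) (simp_all add: A_def algebra_simps)
  have det: "det (matrix A) = cross3 e e' \<bullet> v"
    by (simp add: det_3 matrix_def A_def axis_def cross3_def inner_vec_def sum_3 algebra_simps)
  show ?thesis
    using lborel_affine_param[OF distr_triple_vec triple_vec_measurable A, of b] assms
    unfolding det by (simp add: A_def add.assoc)
qed

text \<open>Base times height is the area of a parallelogram: \<open>e\<close>, orthogonal to the
  unit vector \<open>n\<close>, equals \<open>s\<close> times \<open>n\<close> rotated by a right
  angle, and \<open>cross2VV e v\<close> is \<open>- s (v . n)\<close>.\<close>

lemma cross2_normal:
  assumes n: "norm n = 1" and e: "e \<bullet> n = 0"
  shows "norm e * \<bar>v \<bullet> n\<bar> = \<bar>cross2VV e v\<bar>"
proof -
  have n1: "n $ 1 * n $ 1 + n $ 2 * n $ 2 = 1"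
    using n by (simp add: norm_eq_1 inner_vec_def sum_2)
  have e0: "e $ 1 * n $ 1 + e $ 2 * n $ 2 = 0" using e by (simp add: inner_vec_def sum_2)
  define s where "s = n $ 1 * e $ 2 - n $ 2 * e $ 1"
  have e1: "e $ 1 = - s * n $ 2" and e2: "e $ 2 = s * n $ 1"
    using n1 e0 unfolding s_def by algebra+
  have "e \<bullet> e = s * s * (n $ 1 * n $ 1 + n $ 2 * n $ 2)"
    by (simp add: inner_vec_def sum_2 e1 e2 algebra_simps)
  then have "norm e = \<bar>s\<bar>" unfolding n1 by (simp add: norm_eq_sqrt_inner)
  moreover have "cross2VV e v = - (s * (v \<bullet> n))"
    by (simp add: cross2VV_def e1 e2 inner_vec_def sum_2 algebra_simps)
  ultimately show ?thesis by (simp add: abs_mult)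
qed

text \<open>\<open>cross3 e e'\<close> is a multiple of \<open>n\<close>, so up to sign its product
  with \<open>v\<close> is the base area times the height \<open>v . n\<close>.\<close>

lemma cross3_normal:
  assumes n: "norm n = 1" and e: "e \<bullet> n = 0" "e' \<bullet> n = 0"
  shows "norm (cross3 e e') * \<bar>v \<bullet> n\<bar> = \<bar>cross3 e e' \<bullet> v\<bar>"
proof -
  define x where "x = cross3 e e'"
  have nn: "n \<bullet> n = 1" using n by (simp add: norm_eq_1)
  have "cross3 n x = 0" unfolding x_def Lagrange using e by (simp add: inner_commute)
  then have "cross3 n (cross3 n x) = 0" by simp
  then have x: "x = (n \<bullet> x) *\<^sub>R n" unfolding Lagrange nn by simp
  define s where "s = n \<bullet> x"
  have "x = s *\<^sub>R n" using x by (simp add: s_def)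
  then have "norm x = \<bar>s\<bar>" "x \<bullet> v = s * (v \<bullet> n)" using n by (simp_all add: inner_commute)
  then show ?thesis unfolding x_def[symmetric] by (simp add: abs_mult)
qed

lemma simplex2_det:
  fixes P :: "nat \<Rightarrow> real^2"
  assumes P: "simplex_vertices P"
  shows "cross2VV (P 1 - P 0) (P 2 - P 0) \<noteq> 0"
proof -
  let ?M = "vector [P 1 - P 0, P 2 - P 0] :: real^2^2"
  have "\<forall>z. ?M *v z = 0 \<longrightarrow> z = 0"
  proof (intro allI impI)
    fix z assume z: "?M *v z = 0"
    have "(?M *v z) $ i = 0" for i using z by simp
    from this[of 1] this[of 2] have "(P 1 - P 0) \<bullet> z = 0" "(P 2 - P 0) \<bullet> z = 0"
      by (simp_all only: matrix_vector_mul_component vector_2)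
    then show "z = 0"
    proof (intro simplex_edges_orthogonal_zero[OF P, of 0])
      fix j assume z2: "(P 1 - P 0) \<bullet> z = 0" "(P 2 - P 0) \<bullet> z = 0" and "j \<le> CARD(2)"
      then have "j = 0 \<or> j = 1 \<or> j = 2" by auto
      then show "(P j - P 0) \<bullet> z = 0" using z2 by (elim disjE) simp_all
    qed simp
  qed
  then have "invertible ?M" using matrix_left_invertible_ker[of ?M] invertible_left_inverse[of ?M] by blast
  then have "det ?M \<noteq> 0" using invertible_det_nz by blast
  then show ?thesis by (simp add: det_2 cross2VV_def)
qed

lemma simplex3_det:
  fixes P :: "nat \<Rightarrow> real^3"
  assumes P: "simplex_vertices P"
  shows "cross3 (P 1 - P 0) (P 2 - P 0) \<bullet> (P 3 - P 0) \<noteq> 0"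
proof -
  let ?M = "vector [P 1 - P 0, P 2 - P 0, P 3 - P 0] :: real^3^3"
  have "\<forall>z. ?M *v z = 0 \<longrightarrow> z = 0"
  proof (intro allI impI)
    fix z assume z: "?M *v z = 0"
    have "(?M *v z) $ i = 0" for i using z by simp
    from this[of 1] this[of 2] this[of 3] have "(P 1 - P 0) \<bullet> z = 0" "(P 2 - P 0) \<bullet> z = 0" "(P 3 - P 0) \<bullet> z = 0"
      by (simp_all only: matrix_vector_mul_component vector_3)
    then show "z = 0"
    proof (intro simplex_edges_orthogonal_zero[OF P, of 0])
      fix j assume z3: "(P 1 - P 0) \<bullet> z = 0" "(P 2 - P 0) \<bullet> z = 0" "(P 3 - P 0) \<bullet> z = 0" and "j \<le> CARD(3)"
      then have "j = 0 \<or> j = 1 \<or> j = 2 \<or> j = 3" by auto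
      then show "(P j - P 0) \<bullet> z = 0" using z3 by (elim disjE) simp_all
    qed simp
  qed
  then have "invertible ?M" using matrix_left_invertible_ker[of ?M] invertible_left_inverse[of ?M] by blast
  then have "det ?M \<noteq> 0" using invertible_det_nz by blast
  moreover have "det ?M = cross3 (P 1 - P 0) (P 2 - P 0) \<bullet> (P 3 - P 0)"
    by (simp add: det_3 cross3_def inner_vec_def sum_3) (simp add: algebra_simps)
  ultimately show ?thesis by simp
qed

text \<open>Edge coordinates are barycentric coordinates: the nonzero determinant makes them unique,
  and the weight of \<open>P 0\<close> is \<open>1 - s - t\<close>.\<close>

lemma simplex2_mem:
  fixes P :: "nat \<Rightarrow> real^2"
  assumes P: "simplex_vertices P"
  shows "P 0 + s *\<^sub>R (P 1 - P 0) + t *\<^sub>R (P 2 - P 0) \<in> simplex_of P \<longleftrightarrow> 0 \<le> s \<and> 0 \<le> t \<and> s + t \<le> 1"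
proof
  define e1 e2 where "e1 = P 1 - P 0" and "e2 = P 2 - P 0"
  have D: "cross2VV e1 e2 \<noteq> 0" using simplex2_det[OF P] by (simp add: e1_def e2_def)
  have 2: "{..CARD(2)} = {0, 1, 2}" by auto
  assume "P 0 + s *\<^sub>R (P 1 - P 0) + t *\<^sub>R (P 2 - P 0) \<in> simplex_of P"
  then obtain u where u: "\<forall>i\<le>CARD(2). 0 \<le> u i" "(\<Sum>i\<in>{0,1,2}. u i) = 1"
    "P 0 + s *\<^sub>R (P 1 - P 0) + t *\<^sub>R (P 2 - P 0) = (\<Sum>i\<in>{0,1,2}. u i *\<^sub>R P i)"
    unfolding simplex_of_eq[OF P] 2 by blast
  have pos: "0 \<le> u 0" "0 \<le> u 1" "0 \<le> u 2" using u(1) by simp_all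
  have u0: "u 0 = 1 - u 1 - u 2" using u(2) by simp
  have "P 0 + s *\<^sub>R e1 + t *\<^sub>R e2 = P 0 + u 1 *\<^sub>R e1 + u 2 *\<^sub>R e2"
    using u(3) by (simp add: u0 e1_def e2_def algebra_simps)
  then have eq: "(s - u 1) *\<^sub>R e1 + (t - u 2) *\<^sub>R e2 = 0" by (simp add: algebra_simps)
  have c: "(s - u 1) * e1 $ i + (t - u 2) * e2 $ i = 0" for i
    using arg_cong[OF eq, of "\<lambda>x. x $ i"] by simp
  have "(s - u 1) * cross2VV e1 e2 = 0" "(t - u 2) * cross2VV e1 e2 = 0"
    using c[of 1] c[of 2] unfolding cross2VV_def by algebra+
  then have "s = u 1" "t = u 2" using D by simp_all
  then show "0 \<le> s \<and> 0 \<le> t \<and> s + t \<le> 1" using pos u0 by simp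
next
  assume st: "0 \<le> s \<and> 0 \<le> t \<and> s + t \<le> 1"
  have 2: "{..CARD(2)} = {0, 1, 2}" by auto
  let ?u = "\<lambda>i::nat. if i = 0 then 1 - s - t else if i = 1 then s else t"
  show "P 0 + s *\<^sub>R (P 1 - P 0) + t *\<^sub>R (P 2 - P 0) \<in> simplex_of P"
    unfolding simplex_of_eq[OF P] 2
    by (intro CollectI exI[of _ ?u]) (use st in \<open>auto simp: algebra_simps\<close>)
qed

lemma simplex3_mem:
  fixes P :: "nat \<Rightarrow> real^3"
  assumes P: "simplex_vertices P"
  shows "P 0 + r *\<^sub>R (P 1 - P 0) + s *\<^sub>R (P 2 - P 0) + t *\<^sub>R (P 3 - P 0) \<in> simplex_of P \<longleftrightarrow>
    0 \<le> r \<and> 0 \<le> s \<and> 0 \<le> t \<and> r + s + t \<le> 1"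
proof
  define e1 e2 e3 where "e1 = P 1 - P 0" and "e2 = P 2 - P 0" and "e3 = P 3 - P 0"
  have D: "cross3 e1 e2 \<bullet> e3 \<noteq> 0" using simplex3_det[OF P] by (simp add: e1_def e2_def e3_def)
  have 3: "{..CARD(3)} = {0, 1, 2, 3}" by auto
  assume "P 0 + r *\<^sub>R (P 1 - P 0) + s *\<^sub>R (P 2 - P 0) + t *\<^sub>R (P 3 - P 0) \<in> simplex_of P"
  then obtain u where u: "\<forall>i\<le>CARD(3). 0 \<le> u i" "(\<Sum>i\<in>{0,1,2,3}. u i) = 1"
    "P 0 + r *\<^sub>R (P 1 - P 0) + s *\<^sub>R (P 2 - P 0) + t *\<^sub>R (P 3 - P 0) = (\<Sum>i\<in>{0,1,2,3}. u i *\<^sub>R P i)"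
    unfolding simplex_of_eq[OF P] 3 by blast
  have pos: "0 \<le> u 0" "0 \<le> u 1" "0 \<le> u 2" "0 \<le> u 3" using u(1) by simp_all
  have u0: "u 0 = 1 - u 1 - u 2 - u 3" using u(2) by simp
  have "P 0 + r *\<^sub>R e1 + s *\<^sub>R e2 + t *\<^sub>R e3 = P 0 + u 1 *\<^sub>R e1 + u 2 *\<^sub>R e2 + u 3 *\<^sub>R e3"
    using u(3) by (simp add: u0 e1_def e2_def e3_def algebra_simps)
  then have eq: "(r - u 1) *\<^sub>R e1 + (s - u 2) *\<^sub>R e2 + (t - u 3) *\<^sub>R e3 = 0" by (simp add: algebra_simps)
  define x y z where "x = r - u 1" and "y = s - u 2" and "z = t - u 3"
  have eq': "x *\<^sub>R e1 + y *\<^sub>R e2 + z *\<^sub>R e3 = 0" using eq by (simp add: x_def y_def z_def)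
  \<comment> \<open>Pairing with the cross product of two edges isolates the coefficient of the
    third.\<close>
  have dots: "cross3 e1 e2 \<bullet> e1 = 0" "cross3 e1 e2 \<bullet> e2 = 0" "cross3 e2 e3 \<bullet> e2 = 0" "cross3 e2 e3 \<bullet> e3 = 0"
    "cross3 e3 e1 \<bullet> e3 = 0" "cross3 e3 e1 \<bullet> e1 = 0"
    "cross3 e2 e3 \<bullet> e1 = cross3 e1 e2 \<bullet> e3" "cross3 e3 e1 \<bullet> e2 = cross3 e1 e2 \<bullet> e3"
    by (simp_all add: cross3_def inner_vec_def sum_3 algebra_simps)
  have "z * (cross3 e1 e2 \<bullet> e3) = 0" "x * (cross3 e1 e2 \<bullet> e3) = 0" "y * (cross3 e1 e2 \<bullet> e3) = 0"
    using arg_cong[OF eq', of "\<lambda>v. cross3 e1 e2 \<bullet> v"] arg_cong[OF eq', of "\<lambda>v. cross3 e2 e3 \<bullet> v"]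
      arg_cong[OF eq', of "\<lambda>v. cross3 e3 e1 \<bullet> v"]
    by (simp_all only: inner_add_right inner_scaleR_right dots inner_zero_right mult_zero_right add_0_left add_0_right)
  then have "r = u 1" "s = u 2" "t = u 3" using D by (simp_all add: x_def y_def z_def)
  then show "0 \<le> r \<and> 0 \<le> s \<and> 0 \<le> t \<and> r + s + t \<le> 1" using pos u0 by simp
next
  assume st: "0 \<le> r \<and> 0 \<le> s \<and> 0 \<le> t \<and> r + s + t \<le> 1"
  have 3: "{..CARD(3)} = {0, 1, 2, 3}" by auto
  let ?u = "\<lambda>i::nat. if i = 0 then 1 - r - s - t else if i = 1 then r else if i = 2 then s else t"
  show "P 0 + r *\<^sub>R (P 1 - P 0) + s *\<^sub>R (P 2 - P 0) + t *\<^sub>R (P 3 - P 0) \<in> simplex_of P"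
    unfolding simplex_of_eq[OF P] 3
    by (intro CollectI exI[of _ ?u]) (use st in \<open>auto simp: algebra_simps\<close>)
qed

section \<open>The triangle and the tetrahedron as cells\<close>

definition face2 :: "(nat \<Rightarrow> real^2) \<Rightarrow> nat \<Rightarrow> real \<Rightarrow> real^2" where
  "face2 P i t = P (oth i 0) + t *\<^sub>R (P (oth i 1) - P (oth i 0))"

definition face3 :: "(nat \<Rightarrow> real^3) \<Rightarrow> nat \<Rightarrow> real \<times> real \<Rightarrow> real^3" where
  "face3 P i st = P (oth i 0) + fst st *\<^sub>R (P (oth i 1) - P (oth i 0)) + snd st *\<^sub>R (P (oth i 2) - P (oth i 0))"

definition unit_triangle :: "(real \<times> real) set" where
  "unit_triangle = {st. 0 \<le> fst st \<and> 0 \<le> snd st \<and> fst st + snd st \<le> 1}"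

lemma face_int2_eq: "face_int2 P = (\<lambda>i. param_int (dist (P (oth i 0)) (P (oth i 1))) {0..1} (face2 P i))"
  by (simp add: fun_eq_iff face_int2_def param_int_def face2_def)

lemma face_int3_eq: "face_int3 P = (\<lambda>i. param_int (norm (cross3 (P (oth i 1) - P (oth i 0)) (P (oth i 2) - P (oth i 0))))
    unit_triangle (face3 P i))"
  by (simp add: fun_eq_iff face_int3_def param_int_def face3_def unit_triangle_def)

lemma oth_neq: "oth i j \<noteq> i" by (simp add: oth_def)

lemma oth_le: "j < n \<Longrightarrow> oth i j \<le> n" by (simp add: oth_def)

lemma unit_triangle: "compact unit_triangle" "convex unit_triangle" "interior unit_triangle \<noteq> {}"
proof -
  have "closed unit_triangle"
    unfolding unit_triangle_def by (intro closed_Collect_conj closed_Collect_le continuous_intros)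
  moreover have "unit_triangle \<subseteq> cbox (0, 0) (1, 1)" by (auto simp: unit_triangle_def cbox_Pair_eq)
  ultimately show "compact unit_triangle"
    using bounded_cbox bounded_subset compact_eq_bounded_closed by blast
  show "convex unit_triangle"
  proof (rule convexI)
    fix x y :: "real \<times> real" and u v :: real
    assume "x \<in> unit_triangle" "y \<in> unit_triangle" and uv: "0 \<le> u" "0 \<le> v" "u + v = 1"
    then have "0 \<le> u * fst x + v * fst y" "0 \<le> u * snd x + v * snd y"
      "u * (fst x + snd x) + v * (fst y + snd y) \<le> 1"
      by (auto simp: unit_triangle_def intro!: convex_bound_le)
    then show "u *\<^sub>R x + v *\<^sub>R y \<in> unit_triangle"
      using uv by (simp add: unit_triangle_def algebra_simps)
  qed
  have "box (0, 0) (1/2, 1/2) \<subseteq> unit_triangle"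
  proof
    fix x :: "real \<times> real" assume "x \<in> box (0, 0) (1/2, 1/2)"
    then have "0 < fst x \<and> fst x < 1/2" "0 < snd x \<and> snd x < 1/2" by (cases x; simp add: mem_box Basis_prod_def)+
    then show "x \<in> unit_triangle" by (simp add: unit_triangle_def)
  qed
  then have "box (0, 0) (1/2, 1/2) \<subseteq> interior unit_triangle" by (intro interior_maximal open_box)
  moreover have "(1/4, 1/4) \<in> box (0 :: real, 0 :: real) (1/2, 1/2)" by (auto simp: mem_box Basis_prod_def)
  ultimately show "interior unit_triangle \<noteq> {}" by blast
qed

text \<open>\<open>oth\<close> lists face vertices in increasing order, so the lists of faces
  \<open>i\<close> and \<open>i + 1\<close> differ only in position \<open>i\<close>, which holds
  \<open>P (i + 1)\<close> and \<open>P i\<close>. Points with equal parameter thus differ by the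
  weight of that position times the edge \<open>P (i + 1) - P i\<close>, as integration along the
  edge requires. The weights are \<open>1 - t\<close> for \<open>i = 0\<close> and \<open>t\<close>
  for \<open>i = 1\<close>.\<close>

lemma gauss_cell_simplex2:
  fixes P :: "nat \<Rightarrow> real^2"
  assumes P: "simplex_vertices P"
  shows "gauss_cell (simplex_of P) {0..2} (\<lambda>i. dist (P (oth i 0)) (P (oth i 1))) {0..1} (face2 P) (onormal P)
    ((1 / real (Suc CARD(2))) *\<^sub>R (\<Sum>m\<le>CARD(2). P m))"
proof
  show "compact (simplex_of P)" "convex (simplex_of P)" "interior (simplex_of P) \<noteq> {}"
    by (rule simplex_of_props[OF P])+
  show "compact {0..1::real}" "convex {0..1::real}" "interior {0..1::real} \<noteq> {}" by simp_all
  show "finite {0..2::nat}" "{0..2::nat} \<noteq> {}" by simp_all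
  have inj: "inj_on P {0..2}" using P by (simp add: simplex_vertices_def)
  fix e :: nat assume e: "e \<in> {0..2}"
  then have e': "e \<le> CARD(2)" by simp
  have o: "oth e 0 \<in> {0..2}" "oth e 1 \<in> {0..2}" "oth e 0 \<noteq> oth e 1" using e by (auto simp: oth_def)
  show "0 < dist (P (oth e 0)) (P (oth e 1))"
    using inj_onD[OF inj _ o(1,2)] o(3) by auto
  show "continuous_on {0..1} (face2 P e)" unfolding face2_def by (intro continuous_intros)
  show "face2 P e ` {0..1} \<subseteq> simplex_of P"
  proof (rule image_subsetI)
    fix t :: real assume t: "t \<in> {0..1}"
    have "P (oth e 0) \<in> simplex_of P" "P (oth e 1) \<in> simplex_of P"
      using o unfolding simplex_of_def by (auto intro!: hull_inc)
    then have "(1 - t) *\<^sub>R P (oth e 0) + t *\<^sub>R P (oth e 1) \<in> simplex_of P"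
      using t by (intro convexD[OF simplex_of_props(2)[OF P]]) auto
    moreover have "face2 P e t = (1 - t) *\<^sub>R P (oth e 0) + t *\<^sub>R P (oth e 1)"
      by (simp add: face2_def algebra_simps)
    ultimately show "face2 P e t \<in> simplex_of P" by simp
  qed
  show "norm (onormal P e) = 1" by (rule onormal_norm[OF P e'])
  fix x assume "x \<in> face2 P e ` {0..1}"
  then obtain t where "x = face2 P e t" by auto
  then have x: "x - P (oth e 0) = t *\<^sub>R (P (oth e 1) - P (oth e 0))" by (simp add: face2_def)
  have "(x - P (oth e 0)) \<bullet> onormal P e = t * ((P (oth e 1) - P (oth e 0)) \<bullet> onormal P e)"
    unfolding x by (rule inner_scaleR_left)
  also have "(P (oth e 1) - P (oth e 0)) \<bullet> onormal P e = 0"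
    using o by (intro onormal_orth[OF P e']) (simp_all add: oth_neq)
  finally show "0 < (x - (1 / real (Suc CARD(2))) *\<^sub>R (\<Sum>m\<le>CARD(2). P m)) \<bullet> onormal P e"
    using o by (intro centroid_pos[OF P e', of "oth e 0"]) (simp_all add: oth_neq)
next
  fix g :: "real^2 \<Rightarrow> real" and j :: 2 assume g: "real_polynomial_function g"
  define e1 e2 where "e1 = P 1 - P 0" and "e2 = P 2 - P 0"
  define D where "D = \<bar>cross2VV e1 e2\<bar>"
  define I where "I i = (LINT t:{0..1}|lborel. g (face2 P i t))" for i
  have P1: "P 1 = P 0 + e1" and P2: "P 2 = P 0 + e2" by (simp_all add: e1_def e2_def)
  have S1: "P (Suc 0) = P 0 + e1" and S2: "P (Suc (Suc 0)) = P 0 + e2"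
    by (simp_all add: e1_def e2_def numeral_2_eq_2)
  have cross: "cross2VV e1 e2 \<noteq> 0" using simplex2_det[OF P] by (simp add: e1_def e2_def)
  have mem: "P 0 + s *\<^sub>R e1 + t *\<^sub>R e2 \<in> simplex_of P \<longleftrightarrow> 0 \<le> s \<and> 0 \<le> t \<and> s + t \<le> 1" for s t
    using simplex2_mem[OF P, of s t] by (simp add: e1_def e2_def)
  have cK: "compact (simplex_of P)" by (rule simplex_of_props(1)[OF P])
  have cf: "continuous_on UNIV (face2 P i)" for i unfolding face2_def by (intro continuous_intros)
  have f0: "face2 P 0 t = P 0 + (1 - t) *\<^sub>R e1 + t *\<^sub>R e2" and f1: "face2 P 1 t = P 0 + t *\<^sub>R e2"
    and f2: "face2 P 2 t = P 0 + t *\<^sub>R e1" for t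
    by (simp_all add: face2_def oth_def P2 S1 S2 algebra_simps)
  have two: "i < CARD(2) \<Longrightarrow> i = 0 \<or> i = 1" for i :: nat by auto
  have "vint (simplex_of P) (pd j g) = (\<Sum>e\<in>{0..CARD(2)}. dist (P (oth e 0)) (P (oth e 1)) * (onormal P e $ j * I e))"
  proof (rule gauss_of_edges[OF P, where c = D])
    fix i assume i: "i < CARD(2)"
    show "(\<Sum>j\<in>UNIV. (P (Suc i) - P i) $ j * vint (simplex_of P) (pd j g)) = D * (I i - I (Suc i))"
      using two[OF i]
    proof
      assume i0: "i = 0"
      have "cross2VV e2 e1 = - cross2VV e1 e2" by (simp add: cross2VV_def)
      then have D': "D = \<bar>cross2VV e2 e1\<bar>" by (simp add: D_def)
      have c0: "cross2VV e2 e1 \<noteq> 0" using cross by (simp add: cross2VV_def algebra_simps)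
      have "(\<Sum>j\<in>UNIV. e1 $ j * vint (simplex_of P) (pd j g)) =
          D * ((LINT t:{0..1}|lborel. g (face2 P 0 t)) - (LINT t:{0..1}|lborel. g (face2 P 1 t)))"
      proof (rule slab_divergence[OF cK _ _ cf cf _ _ _ _ g, where len = "\<lambda>t. 1 - t"])
        show "density (distr lborel borel (\<lambda>z. face2 P 1 (fst z) + snd z *\<^sub>R e1)) (\<lambda>_. ennreal D) = lborel"
          unfolding f1 D' using lborel_slab2[OF c0] .
        fix t \<tau> :: real
        have E: "face2 P 1 t + \<tau> *\<^sub>R e1 = P 0 + \<tau> *\<^sub>R e1 + t *\<^sub>R e2"
          unfolding f1 by (simp add: algebra_simps)
        show "face2 P 1 t + \<tau> *\<^sub>R e1 \<in> simplex_of P \<longleftrightarrow> t \<in> {0..1} \<and> 0 \<le> \<tau> \<and> \<tau> \<le> 1 - t"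
          unfolding E mem by auto
        show "face2 P 0 t = face2 P 1 t + (1 - t) *\<^sub>R e1" unfolding f0 f1 by (simp add: algebra_simps)
      qed (auto simp: D_def)
      moreover have "P (Suc i) - P i = e1" "I i = I 0" "I (Suc i) = I 1" using i0 by (simp_all add: S1)
      ultimately show ?thesis by (simp only: I_def)
    next
      assume i1: "i = 1"
      have D': "D = \<bar>cross2VV e1 (e2 - e1)\<bar>" by (simp add: D_def cross2VV_def algebra_simps)
      have c0: "cross2VV e1 (e2 - e1) \<noteq> 0" using cross by (simp add: cross2VV_def algebra_simps)
      have "(\<Sum>j\<in>UNIV. (e2 - e1) $ j * vint (simplex_of P) (pd j g)) =
          D * ((LINT t:{0..1}|lborel. g (face2 P 1 t)) - (LINT t:{0..1}|lborel. g (face2 P 2 t)))"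
      proof (rule slab_divergence[OF cK _ _ cf cf _ _ _ _ g, where len = "\<lambda>t. t"])
        show "density (distr lborel borel (\<lambda>z. face2 P 2 (fst z) + snd z *\<^sub>R (e2 - e1))) (\<lambda>_. ennreal D) = lborel"
          unfolding f2 D' using lborel_slab2[OF c0] .
        fix t \<tau> :: real
        have E: "face2 P 2 t + \<tau> *\<^sub>R (e2 - e1) = P 0 + (t - \<tau>) *\<^sub>R e1 + \<tau> *\<^sub>R e2"
          unfolding f2 by (simp add: algebra_simps)
        show "face2 P 2 t + \<tau> *\<^sub>R (e2 - e1) \<in> simplex_of P \<longleftrightarrow> t \<in> {0..1} \<and> 0 \<le> \<tau> \<and> \<tau> \<le> t"
          unfolding E mem by auto
        show "face2 P 1 t = face2 P 2 t + t *\<^sub>R (e2 - e1)" unfolding f1 f2 by (simp add: algebra_simps)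
      qed (auto simp: D_def)
      moreover have "P (Suc i) - P i = e2 - e1" "I i = I 1" "I (Suc i) = I 2"
        using i1 by (simp_all add: S1 S2 numeral_2_eq_2)
      ultimately show ?thesis by (simp only: I_def)
    qed
    \<comment> \<open>The length of an end face times the height of the triangle above it is twice
      the area, which is \<open>D\<close>. Hence both end faces get the same constant.\<close>
    have height: "dist (P (oth e 0)) (P (oth e 1)) * \<bar>(P (Suc i) - P i) \<bullet> onormal P e\<bar> = D" if e: "e = i \<or> e = Suc i" for e
    proof -
      have e': "e \<le> CARD(2)" using e i by auto
      have "(P (oth e 1) - P (oth e 0)) \<bullet> onormal P e = 0"
        using e' by (intro onormal_orth[OF P e']) (simp_all add: oth_neq oth_le)
      from cross2_normal[OF onormal_norm[OF P e'] this, of "P (Suc i) - P i"]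
      have "dist (P (oth e 0)) (P (oth e 1)) * \<bar>(P (Suc i) - P i) \<bullet> onormal P e\<bar> = \<bar>cross2VV (P (oth e 1) - P (oth e 0)) (P (Suc i) - P i)\<bar>"
        by (simp add: dist_norm norm_minus_commute)
      also have "cross2VV (P (oth e 1) - P (oth e 0)) (P (Suc i) - P i) = cross2VV e1 e2 \<or>
          cross2VV (P (oth e 1) - P (oth e 0)) (P (Suc i) - P i) = - cross2VV e1 e2"
        using two[OF i] e by (auto simp: oth_def P2 S1 S2 cross2VV_def algebra_simps)
      then have "\<bar>cross2VV (P (oth e 1) - P (oth e 0)) (P (Suc i) - P i)\<bar> = D"
        unfolding D_def by auto
      finally show ?thesis .
    qed
    \<comment> \<open>The edge starts at \<open>P i\<close> on face \<open>i + 1\<close> and ends at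
      \<open>P (i + 1)\<close> on face \<open>i\<close>, so it enters through the former and leaves
      through the latter. This fixes the signs.\<close>
    have "(P i - P (Suc i)) \<bullet> onormal P i < 0" "(P (Suc i) - P i) \<bullet> onormal P (Suc i) < 0"
      using i by (auto intro!: onormal_neg[OF P])
    then have sg: "\<bar>(P (Suc i) - P i) \<bullet> onormal P i\<bar> = (P (Suc i) - P i) \<bullet> onormal P i"
      "\<bar>(P (Suc i) - P i) \<bullet> onormal P (Suc i)\<bar> = - ((P (Suc i) - P i) \<bullet> onormal P (Suc i))"
      by (auto simp: inner_diff_left)
    show "dist (P (oth i 0)) (P (oth i 1)) * ((P (Suc i) - P i) \<bullet> onormal P i) = D"
      using height[of i] sg(1) by simp
    show "dist (P (oth (Suc i) 0)) (P (oth (Suc i) 1)) * ((P (Suc i) - P i) \<bullet> onormal P (Suc i)) = - D"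
      using height[of "Suc i"] sg(2) by simp
  qed
  then show "vint (simplex_of P) (pd j g) =
      (\<Sum>e = 0..2. param_int (dist (P (oth e 0)) (P (oth e 1))) {0..1} (face2 P e) (\<lambda>x. g x * onormal P e $ j))"
    by (simp add: param_int_def I_def mult_ac)
qed

text \<open>Both sides are six times the volume: replacing base edges and apex changes the
  determinant of three edges at most by its sign. In particular the value depends neither on the
  face nor on the base point \<open>m\<close>.\<close>

lemma simplex3_face_det:
  fixes P :: "nat \<Rightarrow> real^3"
  assumes e: "e \<le> 3" and m: "m \<le> 3" "m \<noteq> e"
  shows "\<bar>cross3 (P (oth e 1) - P (oth e 0)) (P (oth e 2) - P (oth e 0)) \<bullet> (P e - P m)\<bar> =
    \<bar>cross3 (P 1 - P 0) (P 2 - P 0) \<bullet> (P 3 - P 0)\<bar>"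
proof -
  define e1 e2 e3 where "e1 = P 1 - P 0" and "e2 = P 2 - P 0" and "e3 = P 3 - P 0"
  have S: "P (Suc 0) = P 0 + e1" "P (Suc (Suc 0)) = P 0 + e2" "P (Suc (Suc (Suc 0))) = P 0 + e3"
    "P 2 = P 0 + e2" "P 3 = P 0 + e3"
    by (simp_all add: e1_def e2_def e3_def numeral_2_eq_2 numeral_3_eq_3)
  have skew: "cross3 e2 e1 = - cross3 e1 e2" "cross3 e3 e1 = - cross3 e1 e3" "cross3 e3 e2 = - cross3 e2 e3"
    by (rule cross_skew)+
  have triple: "cross3 e2 e3 \<bullet> e1 = cross3 e1 e2 \<bullet> e3" "cross3 e1 e3 \<bullet> e2 = - (cross3 e1 e2 \<bullet> e3)"
    by (simp_all add: cross3_def inner_vec_def sum_3 algebra_simps)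
  note bilin = Cross3.left_diff_distrib Cross3.right_diff_distrib inner_diff_left inner_diff_right inner_add_left inner_add_right
  have "e = 0 \<or> e = 1 \<or> e = 2 \<or> e = 3" using e by auto
  moreover have "m = 0 \<or> m = 1 \<or> m = 2 \<or> m = 3" using m by auto
  ultimately show ?thesis
    using m(2)
    by (elim disjE) (simp_all add: oth_def S bilin skew triple dot_cross_self)
qed

text \<open>As in the plane, faces \<open>i\<close> and \<open>i + 1\<close> differ in one position
  of their vertex lists. The chord lengths \<open>1 - s - t\<close>, \<open>s\<close> and
  \<open>t\<close> along the three consecutive edges are the barycentric weights of that
  position.\<close>

lemma gauss_cell_simplex3:
  fixes P :: "nat \<Rightarrow> real^3"
  assumes P: "simplex_vertices P"
  shows "gauss_cell (simplex_of P) {0..3} (\<lambda>i. norm (cross3 (P (oth i 1) - P (oth i 0)) (P (oth i 2) - P (oth i 0))))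
    unit_triangle (face3 P) (onormal P) ((1 / real (Suc CARD(3))) *\<^sub>R (\<Sum>m\<le>CARD(3). P m))"
proof
  show "compact (simplex_of P)" "convex (simplex_of P)" "interior (simplex_of P) \<noteq> {}"
    by (rule simplex_of_props[OF P])+
  show "compact unit_triangle" "convex unit_triangle" "interior unit_triangle \<noteq> {}" by (rule unit_triangle)+
  show "finite {0..3::nat}" "{0..3::nat} \<noteq> {}" by simp_all
  fix e :: nat assume e: "e \<in> {0..3}"
  then have e': "e \<le> CARD(3)" "e \<le> 3" by simp_all
  have o: "oth e 0 \<in> {0..3}" "oth e 1 \<in> {0..3}" "oth e 2 \<in> {0..3}" using e by (auto simp: oth_def)
  show "0 < norm (cross3 (P (oth e 1) - P (oth e 0)) (P (oth e 2) - P (oth e 0)))"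
  proof -
    have "\<bar>cross3 (P (oth e 1) - P (oth e 0)) (P (oth e 2) - P (oth e 0)) \<bullet> (P e - P (oth e 0))\<bar> \<noteq> 0"
      using simplex3_face_det[OF e'(2), of "oth e 0" P] simplex3_det[OF P] o by (simp add: oth_neq)
    then have "cross3 (P (oth e 1) - P (oth e 0)) (P (oth e 2) - P (oth e 0)) \<noteq> 0"
      by (metis abs_zero inner_zero_left)
    then show ?thesis unfolding zero_less_norm_iff .
  qed
  show "continuous_on unit_triangle (face3 P e)" unfolding face3_def by (intro continuous_intros)
  show "face3 P e ` unit_triangle \<subseteq> simplex_of P"
  proof (rule image_subsetI)
    fix q :: "real \<times> real" assume q: "q \<in> unit_triangle"
    have v: "P (oth e 0) \<in> simplex_of P" "P (oth e 1) \<in> simplex_of P" "P (oth e 2) \<in> simplex_of P"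
      using o unfolding simplex_of_def by (auto intro!: hull_inc)
    have "convex hull {P (oth e 0), P (oth e 1), P (oth e 2)} \<subseteq> simplex_of P"
      using v by (intro hull_minimal simplex_of_props(2)[OF P]) auto
    moreover have "face3 P e q \<in> convex hull {P (oth e 0), P (oth e 1), P (oth e 2)}"
      unfolding convex_hull_3
      using q by (intro CollectI exI[of _ "1 - fst q - snd q"] exI[of _ "fst q"] exI[of _ "snd q"])
        (auto simp: face3_def unit_triangle_def algebra_simps)
    ultimately show "face3 P e q \<in> simplex_of P" by blast
  qed
  show "norm (onormal P e) = 1" by (rule onormal_norm[OF P e'(1)])
  fix x assume "x \<in> face3 P e ` unit_triangle"
  then obtain q where "x = face3 P e q" by auto
  then have x: "x - P (oth e 0) = fst q *\<^sub>R (P (oth e 1) - P (oth e 0)) + snd q *\<^sub>R (P (oth e 2) - P (oth e 0))"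
    by (simp add: face3_def)
  have "(x - P (oth e 0)) \<bullet> onormal P e = fst q * ((P (oth e 1) - P (oth e 0)) \<bullet> onormal P e) + snd q * ((P (oth e 2) - P (oth e 0)) \<bullet> onormal P e)"
    unfolding x inner_add_left inner_scaleR_left ..
  also have "(P (oth e 1) - P (oth e 0)) \<bullet> onormal P e = 0"
    using o by (intro onormal_orth[OF P e'(1)]) (simp_all add: oth_neq)
  also have "(P (oth e 2) - P (oth e 0)) \<bullet> onormal P e = 0"
    using o by (intro onormal_orth[OF P e'(1)]) (simp_all add: oth_neq)
  finally have z: "(x - P (oth e 0)) \<bullet> onormal P e = 0" by simp
  show "0 < (x - (1 / real (Suc CARD(3))) *\<^sub>R (\<Sum>m\<le>CARD(3). P m)) \<bullet> onormal P e"
    by (rule centroid_pos[OF P e'(1) _ oth_neq z]) (use o in simp)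
next
  fix g :: "real^3 \<Rightarrow> real" and j :: 3 assume g: "real_polynomial_function g"
  define e1 e2 e3 where "e1 = P 1 - P 0" and "e2 = P 2 - P 0" and "e3 = P 3 - P 0"
  define D where "D = \<bar>cross3 e1 e2 \<bullet> e3\<bar>"
  define I where "I i = (LINT q:unit_triangle|lborel. g (face3 P i q))" for i
  have S1: "P (Suc 0) = P 0 + e1" and S2: "P (Suc (Suc 0)) = P 0 + e2" and S3: "P (Suc (Suc (Suc 0))) = P 0 + e3"
    and P2: "P 2 = P 0 + e2" and P3: "P 3 = P 0 + e3"
    by (simp_all add: e1_def e2_def e3_def numeral_2_eq_2 numeral_3_eq_3)
  have cross: "cross3 e1 e2 \<bullet> e3 \<noteq> 0" using simplex3_det[OF P] by (simp add: e1_def e2_def e3_def)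
  have mem: "P 0 + r *\<^sub>R e1 + s *\<^sub>R e2 + t *\<^sub>R e3 \<in> simplex_of P \<longleftrightarrow> 0 \<le> r \<and> 0 \<le> s \<and> 0 \<le> t \<and> r + s + t \<le> 1" for r s t
    using simplex3_mem[OF P, of r s t] by (simp add: e1_def e2_def e3_def)
  have cK: "compact (simplex_of P)" by (rule simplex_of_props(1)[OF P])
  have cf: "continuous_on UNIV (face3 P i)" for i unfolding face3_def by (intro continuous_intros)
  have f0: "face3 P 0 q = P 0 + (1 - fst q - snd q) *\<^sub>R e1 + fst q *\<^sub>R e2 + snd q *\<^sub>R e3"
    and f1: "face3 P 1 q = P 0 + fst q *\<^sub>R e2 + snd q *\<^sub>R e3"
    and f2: "face3 P 2 q = P 0 + fst q *\<^sub>R e1 + snd q *\<^sub>R e3"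
    and f3: "face3 P 3 q = P 0 + fst q *\<^sub>R e1 + snd q *\<^sub>R e2" for q
    by (simp_all add: face3_def oth_def P2 P3 S1 S2 S3 algebra_simps)
  have three: "i < CARD(3) \<Longrightarrow> i = 0 \<or> i = 1 \<or> i = 2" for i :: nat by auto
  have dets: "cross3 e2 e3 \<bullet> e1 = cross3 e1 e2 \<bullet> e3" "cross3 e1 e3 \<bullet> (e2 - e1) = - (cross3 e1 e2 \<bullet> e3)"
    "cross3 e1 e2 \<bullet> (e3 - e2) = cross3 e1 e2 \<bullet> e3"
    by (simp_all add: cross3_def inner_vec_def sum_3 algebra_simps)
  have nz: "cross3 e2 e3 \<bullet> e1 \<noteq> 0" "cross3 e1 e3 \<bullet> (e2 - e1) \<noteq> 0" "cross3 e1 e2 \<bullet> (e3 - e2) \<noteq> 0"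
    unfolding dets using cross by simp_all
  have D': "D = \<bar>cross3 e2 e3 \<bullet> e1\<bar>" "D = \<bar>cross3 e1 e3 \<bullet> (e2 - e1)\<bar>" "D = \<bar>cross3 e1 e2 \<bullet> (e3 - e2)\<bar>"
    unfolding dets by (simp_all add: D_def)
  have "vint (simplex_of P) (pd j g) = (\<Sum>e\<in>{0..CARD(3)}.
      norm (cross3 (P (oth e 1) - P (oth e 0)) (P (oth e 2) - P (oth e 0))) * (onormal P e $ j * I e))"
  proof (rule gauss_of_edges[OF P, where c = D])
    fix i assume i: "i < CARD(3)"
    show "(\<Sum>j\<in>UNIV. (P (Suc i) - P i) $ j * vint (simplex_of P) (pd j g)) = D * (I i - I (Suc i))"
      using three[OF i]
    proof (elim disjE)
      assume i0: "i = 0"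
      have "(\<Sum>j\<in>UNIV. e1 $ j * vint (simplex_of P) (pd j g)) =
          D * ((LINT q:unit_triangle|lborel. g (face3 P 0 q)) - (LINT q:unit_triangle|lborel. g (face3 P 1 q)))"
      proof (rule slab_divergence[OF cK unit_triangle(1) _ cf cf _ _ _ _ g, where len = "\<lambda>q. 1 - fst q - snd q"])
        show "density (distr lborel borel (\<lambda>z. face3 P 1 (fst z) + snd z *\<^sub>R e1)) (\<lambda>_. ennreal D) = lborel"
          unfolding f1 D'(1) using lborel_slab3[OF nz(1)] .
        fix q :: "real \<times> real" and \<tau> :: real
        have E: "face3 P 1 q + \<tau> *\<^sub>R e1 = P 0 + \<tau> *\<^sub>R e1 + fst q *\<^sub>R e2 + snd q *\<^sub>R e3"
          unfolding f1 by (simp add: algebra_simps)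
        show "face3 P 1 q + \<tau> *\<^sub>R e1 \<in> simplex_of P \<longleftrightarrow> q \<in> unit_triangle \<and> 0 \<le> \<tau> \<and> \<tau> \<le> 1 - fst q - snd q"
          unfolding E mem unit_triangle_def by auto
        show "face3 P 0 q = face3 P 1 q + (1 - fst q - snd q) *\<^sub>R e1" unfolding f0 f1 by (simp add: algebra_simps)
      qed (auto simp: D_def unit_triangle_def)
      moreover have "P (Suc i) - P i = e1" "I i = I 0" "I (Suc i) = I 1" using i0 by (simp_all add: S1)
      ultimately show ?thesis by (simp only: I_def)
    next
      assume i1: "i = 1"
      have "(\<Sum>j\<in>UNIV. (e2 - e1) $ j * vint (simplex_of P) (pd j g)) =
          D * ((LINT q:unit_triangle|lborel. g (face3 P 1 q)) - (LINT q:unit_triangle|lborel. g (face3 P 2 q)))"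
      proof (rule slab_divergence[OF cK unit_triangle(1) _ cf cf _ _ _ _ g, where len = fst])
        show "density (distr lborel borel (\<lambda>z. face3 P 2 (fst z) + snd z *\<^sub>R (e2 - e1))) (\<lambda>_. ennreal D) = lborel"
          unfolding f2 D'(2) using lborel_slab3[OF nz(2)] .
        fix q :: "real \<times> real" and \<tau> :: real
        have E: "face3 P 2 q + \<tau> *\<^sub>R (e2 - e1) = P 0 + (fst q - \<tau>) *\<^sub>R e1 + \<tau> *\<^sub>R e2 + snd q *\<^sub>R e3"
          unfolding f2 by (simp add: algebra_simps)
        show "face3 P 2 q + \<tau> *\<^sub>R (e2 - e1) \<in> simplex_of P \<longleftrightarrow> q \<in> unit_triangle \<and> 0 \<le> \<tau> \<and> \<tau> \<le> fst q"
          unfolding E mem unit_triangle_def by auto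
        show "face3 P 1 q = face3 P 2 q + fst q *\<^sub>R (e2 - e1)" unfolding f1 f2 by (simp add: algebra_simps)
      qed (auto simp: D_def unit_triangle_def)
      moreover have "P (Suc i) - P i = e2 - e1" "I i = I 1" "I (Suc i) = I 2"
        using i1 by (simp_all add: S1 S2 numeral_2_eq_2)
      ultimately show ?thesis by (simp only: I_def)
    next
      assume i2: "i = 2"
      have "(\<Sum>j\<in>UNIV. (e3 - e2) $ j * vint (simplex_of P) (pd j g)) =
          D * ((LINT q:unit_triangle|lborel. g (face3 P 2 q)) - (LINT q:unit_triangle|lborel. g (face3 P 3 q)))"
      proof (rule slab_divergence[OF cK unit_triangle(1) _ cf cf _ _ _ _ g, where len = snd])
        show "density (distr lborel borel (\<lambda>z. face3 P 3 (fst z) + snd z *\<^sub>R (e3 - e2))) (\<lambda>_. ennreal D) = lborel"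
          unfolding f3 D'(3) using lborel_slab3[OF nz(3)] .
        fix q :: "real \<times> real" and \<tau> :: real
        have E: "face3 P 3 q + \<tau> *\<^sub>R (e3 - e2) = P 0 + fst q *\<^sub>R e1 + (snd q - \<tau>) *\<^sub>R e2 + \<tau> *\<^sub>R e3"
          unfolding f3 by (simp add: algebra_simps)
        show "face3 P 3 q + \<tau> *\<^sub>R (e3 - e2) \<in> simplex_of P \<longleftrightarrow> q \<in> unit_triangle \<and> 0 \<le> \<tau> \<and> \<tau> \<le> snd q"
          unfolding E mem unit_triangle_def by auto
        show "face3 P 2 q = face3 P 3 q + snd q *\<^sub>R (e3 - e2)" unfolding f2 f3 by (simp add: algebra_simps)
      qed (auto simp: D_def unit_triangle_def)
      moreover have "P (Suc i) - P i = e3 - e2" "I i = I 2" "I (Suc i) = I 3"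
        using i2 by (simp_all add: S2 S3 numeral_2_eq_2 numeral_3_eq_3)
      ultimately show ?thesis by (simp only: I_def)
    qed
    have height: "norm (cross3 (P (oth e 1) - P (oth e 0)) (P (oth e 2) - P (oth e 0))) * \<bar>(P e - P m) \<bullet> onormal P e\<bar> = D"
      if e: "e \<le> CARD(3)" and m: "m \<le> CARD(3)" "m \<noteq> e" for e m
    proof -
      have "(P (oth e 1) - P (oth e 0)) \<bullet> onormal P e = 0" "(P (oth e 2) - P (oth e 0)) \<bullet> onormal P e = 0"
        using e by (auto intro!: onormal_orth[OF P e] oth_le simp: oth_neq)
      from cross3_normal[OF onormal_norm[OF P e] this, of "P e - P m"]
      show ?thesis using simplex3_face_det[of e m P] e m by (simp add: D_def e1_def e2_def e3_def)
    qed
    have "(P i - P (Suc i)) \<bullet> onormal P i < 0" "(P (Suc i) - P i) \<bullet> onormal P (Suc i) < 0"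
      using i by (auto intro!: onormal_neg[OF P])
    then have sg: "\<bar>(P i - P (Suc i)) \<bullet> onormal P i\<bar> = (P (Suc i) - P i) \<bullet> onormal P i"
      "\<bar>(P (Suc i) - P i) \<bullet> onormal P (Suc i)\<bar> = - ((P (Suc i) - P i) \<bullet> onormal P (Suc i))"
      by (auto simp: inner_diff_left)
    show "norm (cross3 (P (oth i 1) - P (oth i 0)) (P (oth i 2) - P (oth i 0))) * ((P (Suc i) - P i) \<bullet> onormal P i) = D"
      using height[of i "Suc i"] sg(1) i by simp
    show "norm (cross3 (P (oth (Suc i) 1) - P (oth (Suc i) 0)) (P (oth (Suc i) 2) - P (oth (Suc i) 0))) * ((P (Suc i) - P i) \<bullet> onormal P (Suc i)) = - D"
      using height[of "Suc i" i] sg(2) i by simp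
  qed
  then show "vint (simplex_of P) (pd j g) =
      (\<Sum>e = 0..3. param_int (norm (cross3 (P (oth e 1) - P (oth e 0)) (P (oth e 2) - P (oth e 0)))) unit_triangle (face3 P e) (\<lambda>x. g x * onormal P e $ j))"
    by (simp add: param_int_def I_def mult_ac)
qed

section \<open>Cross products and curls in both dimensions, and the final statement\<close>

lemma bounded_bilinear_of_linear:
  fixes h :: "'a::euclidean_space \<Rightarrow> 'b::euclidean_space \<Rightarrow> 'c::real_normed_vector"
  assumes "\<And>x. linear (h x)" "\<And>y. linear (\<lambda>x. h x y)"
  shows "bounded_bilinear h"
  using assms by (simp add: bilinear_conv_bounded_bilinear[symmetric] bilinear_def)

lemma vec2_eq_iff: "(x :: 'a^2) = y \<longleftrightarrow> x $ 1 = y $ 1 \<and> x $ 2 = y $ 2"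
  by (simp add: vec_eq_iff forall_2)

lemma vec3_eq_iff: "(x :: 'a^3) = y \<longleftrightarrow> x $ 1 = y $ 1 \<and> x $ 2 = y $ 2 \<and> x $ 3 = y $ 3"
  by (simp add: vec_eq_iff forall_3)

lemma hdg_cell_axioms2: "hdg_cell_axioms cross2VV cross2VS curl2V curl2S"
proof (rule hdg_cell_axioms.intro)
  show "2 \<le> CARD(2)" by simp
  show "bounded_bilinear cross2VV"
    by (rule bounded_bilinear_of_linear; rule linearI) (simp_all add: cross2VV_def algebra_simps)
  show "bounded_bilinear cross2VS"
    by (rule bounded_bilinear_of_linear; rule linearI) (simp_all add: cross2VS_def vec2_eq_iff algebra_simps)
  show "cross2VS c h \<bullet> v = h \<bullet> cross2VV v c" for c v :: "real^2" and h
    by (simp add: cross2VS_def cross2VV_def inner_vec_def sum_2 algebra_simps)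
  show "cross2VV c v = - cross2VV v c" for c v by (simp add: cross2VV_def)
  show "cross2VS n (cross2VV n v) = (v \<bullet> n) *\<^sub>R n - v" if "norm n = 1" for n v :: "real^2"
  proof -
    have n: "n $ 1 * n $ 1 + n $ 2 * n $ 2 = 1" using that by (simp add: norm_eq_1 inner_vec_def sum_2)
    have "n $ 2 * (n $ 1 * v $ 2 - n $ 2 * v $ 1) = (v $ 1 * n $ 1 + v $ 2 * n $ 2) * n $ 1 - v $ 1"
      "- (n $ 1 * (n $ 1 * v $ 2 - n $ 2 * v $ 1)) = (v $ 1 * n $ 1 + v $ 2 * n $ 2) * n $ 2 - v $ 2"
      using n by algebra+
    then show ?thesis by (simp add: vec2_eq_iff cross2VS_def cross2VV_def inner_vec_def sum_2)
  qed
  show "curl2V v x = (\<Sum>j\<in>UNIV. cross2VV (axis j 1) (pdv j v x))" for v x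
    by (simp add: sum_2 curl2V_def cross2VV_def pdv_nth axis_def)
  show "curl2S h x = (\<Sum>j\<in>UNIV. cross2VS (axis j 1) (pdv j h x))" for h x
    by (simp add: sum_2 curl2S_def cross2VS_def vec2_eq_iff axis_def)
  fix D :: "2 \<Rightarrow> real^2" and j i :: 2
  assume "(\<Sum>j\<in>UNIV. cross2VV (axis j 1) (D j)) = 0"
  then have "D 1 $ 2 = D 2 $ 1" by (simp add: sum_2 cross2VV_def axis_def)
  then show "D j $ i = D i $ j" using exhaust_2[of i] exhaust_2[of j] by auto
qed

lemma hdg_cell_axioms3: "hdg_cell_axioms cross3 cross3 curl3 curl3"
proof (rule hdg_cell_axioms.intro)
  show "2 \<le> CARD(3)" by simp
  show "bounded_bilinear cross3"
    by (rule bounded_bilinear_of_linear; rule linearI) (simp_all add: cross_add_left cross_add_right cross_mult_left cross_mult_right)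
  then show "bounded_bilinear cross3" .
  show "cross3 c h \<bullet> v = h \<bullet> cross3 v c" for c h v :: "real^3"
    by (simp add: cross3_def inner_vec_def sum_3 algebra_simps)
  show "cross3 c v = - cross3 v c" for c v by (rule cross_skew)
  show "cross3 n (cross3 n v) = (v \<bullet> n) *\<^sub>R n - v" if "norm n = 1" for n v :: "real^3"
    using that by (simp add: Lagrange norm_eq_1 inner_commute)
  show c: "curl3 v x = (\<Sum>j\<in>UNIV. cross3 (axis j 1) (pdv j v x))" for v x
    by (simp add: sum_3 vec3_eq_iff curl3_def cross3_def pdv_nth axis_def)
  then show "curl3 v x = (\<Sum>j\<in>UNIV. cross3 (axis j 1) (pdv j v x))" for v x .
  fix D :: "3 \<Rightarrow> real^3" and j i :: 3
  assume "(\<Sum>j\<in>UNIV. cross3 (axis j 1) (D j)) = 0"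
  then have "D 1 $ 2 = D 2 $ 1" "D 1 $ 3 = D 3 $ 1" "D 2 $ 3 = D 3 $ 2"
    by (simp_all add: sum_3 vec3_eq_iff cross3_def axis_def)
  then show "D j $ i = D i $ j" using exhaust_3[of i] exhaust_3[of j] by auto
qed

text \<open>A real supremum bounds its members only if the set is bounded above; compactness of
  \<open>K\<close> and continuity of \<open>w\<close> provide this. The result is the pointwise
  bound used in the energy argument, valid up to the faces.\<close>

lemma norm_less_of_SUP:
  fixes w :: "'a::metric_space \<Rightarrow> 'b::real_normed_vector"
  assumes "compact K" "continuous_on K w" "1/2 * (SUP x\<in>K. norm (w x)) < \<alpha>" "x \<in> K"
  shows "norm (w x) < 2 * \<alpha>"
proof -
  have "compact ((\<lambda>x. norm (w x)) ` K)" using assms(1,2) by (intro compact_continuous_image continuous_intros)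
  then have "bdd_above ((\<lambda>x. norm (w x)) ` K)" by (intro bounded_imp_bdd_above compact_imp_bounded)
  from cSUP_upper[OF assms(4) this] show ?thesis using assms(3) by simp
qed

lemma W1inf_on_iff_lip_on: "W1inf_on K g \<longleftrightarrow> lip_on K g"
  by (simp add: W1inf_on_def lip_on_def)

text \<open>Both halves interpret the same locale and differ only in the cell and the cross
  products. Surface integrals are matched by \<open>face_int2_eq\<close> and
  \<open>face_int3_eq\<close>.\<close>

theorem theorem3p2:
  shows
  "(\<forall>(P :: nat \<Rightarrow> real^2) (k::nat) Rey Rm \<kappa> (dd :: real^2 \<Rightarrow> real^2) (w :: real^2 \<Rightarrow> real^2)
      \<alpha>1 \<alpha>2 \<alpha>3 (uh :: nat \<Rightarrow> real^2 \<Rightarrow> real^2) (bh :: nat \<Rightarrow> real^2 \<Rightarrow> real^2)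
      (rh :: nat \<Rightarrow> real^2 \<Rightarrow> real) (g :: real^2 \<Rightarrow> real^2) (f :: real^2 \<Rightarrow> real^2) (\<rho>::real).
     simplex_vertices P \<and> Rey > 0 \<and> Rm > 0 \<and> \<kappa> > 0 \<and>
     W1inf_on (simplex_of P) dd \<and> W1inf_on (simplex_of P) w \<and>
     (AE x in lebesgue. x \<in> simplex_of P \<longrightarrow> divV w x = 0) \<and>
     \<alpha>1 > 1/2 * (SUP x\<in>simplex_of P. norm (w x)) \<and> \<alpha>2 > 0 \<and> \<alpha>3 > 0 \<and>
     (\<forall>e\<in>{0..2}. uh e \<in> vpoly_space k \<and> bh e \<in> vpoly_space k \<and> rh e \<in> vpoly_space k \<and>
        (\<forall>x\<in>face P e. bh e x \<bullet> onormal P e = 0)) \<and>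
     L2_on (simplex_of P) g \<and> L2_on (simplex_of P) f
     \<longrightarrow>
     (\<exists>!(X :: (real^2 \<Rightarrow> real^2^2) \<times> (real^2 \<Rightarrow> real^2) \<times> (real^2 \<Rightarrow> real) \<times>
             (real^2 \<Rightarrow> real) \<times> (real^2 \<Rightarrow> real^2) \<times> (real^2 \<Rightarrow> real)).
        case X of (L, u, p, H, b, r) \<Rightarrow>
          L \<in> vpoly_space k \<and> u \<in> vpoly_space k \<and> p \<in> vpoly_space k \<and>
          H \<in> vpoly_space k \<and> b \<in> vpoly_space k \<and> r \<in> vpoly_space k \<and>
          hdg_system2 k P Rey Rm \<kappa> dd w \<alpha>1 \<alpha>2 \<alpha>3 uh bh rh g f \<rho> L u p H b r))
   \<and>
   (\<forall>(P :: nat \<Rightarrow> real^3) (k::nat) Rey Rm \<kappa> (dd :: real^3 \<Rightarrow> real^3) (w :: real^3 \<Rightarrow> real^3)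
      \<alpha>1 \<alpha>2 \<alpha>3 (uh :: nat \<Rightarrow> real^3 \<Rightarrow> real^3) (bh :: nat \<Rightarrow> real^3 \<Rightarrow> real^3)
      (rh :: nat \<Rightarrow> real^3 \<Rightarrow> real) (g :: real^3 \<Rightarrow> real^3) (f :: real^3 \<Rightarrow> real^3) (\<rho>::real).
     simplex_vertices P \<and> Rey > 0 \<and> Rm > 0 \<and> \<kappa> > 0 \<and>
     W1inf_on (simplex_of P) dd \<and> W1inf_on (simplex_of P) w \<and>
     (AE x in lebesgue. x \<in> simplex_of P \<longrightarrow> divV w x = 0) \<and>
     \<alpha>1 > 1/2 * (SUP x\<in>simplex_of P. norm (w x)) \<and> \<alpha>2 > 0 \<and> \<alpha>3 > 0 \<and>
     (\<forall>e\<in>{0..3}. uh e \<in> vpoly_space k \<and> bh e \<in> vpoly_space k \<and> rh e \<in> vpoly_space k \<and>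
        (\<forall>x\<in>face P e. bh e x \<bullet> onormal P e = 0)) \<and>
     L2_on (simplex_of P) g \<and> L2_on (simplex_of P) f
     \<longrightarrow>
     (\<exists>!(X :: (real^3 \<Rightarrow> real^3^3) \<times> (real^3 \<Rightarrow> real^3) \<times> (real^3 \<Rightarrow> real) \<times>
             (real^3 \<Rightarrow> real^3) \<times> (real^3 \<Rightarrow> real^3) \<times> (real^3 \<Rightarrow> real)).
        case X of (L, u, p, H, b, r) \<Rightarrow>
          L \<in> vpoly_space k \<and> u \<in> vpoly_space k \<and> p \<in> vpoly_space k \<and>
          H \<in> vpoly_space k \<and> b \<in> vpoly_space k \<and> r \<in> vpoly_space k \<and>
          hdg_system3 k P Rey Rm \<kappa> dd w \<alpha>1 \<alpha>2 \<alpha>3 uh bh rh g f \<rho> L u p H b r))"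
proof (intro conjI allI impI, goal_cases)
  case (1 P k Rey Rm \<kappa> dd w \<alpha>1 \<alpha>2 \<alpha>3 uh bh rh g f \<rho>)
  then have P: "simplex_vertices P" by blast
  have w: "lip_on (simplex_of P) w" using 1 by (simp add: W1inf_on_iff_lip_on)
  interpret gauss_cell "simplex_of P" "{0..2}" "\<lambda>i. dist (P (oth i 0)) (P (oth i 1))" "{0..1}" "face2 P" "onormal P"
    "(1 / real (Suc CARD(2))) *\<^sub>R (\<Sum>m\<le>CARD(2). P m)"
    by (rule gauss_cell_simplex2[OF P])
  interpret hdg_problem "simplex_of P" "{0..2}" "\<lambda>i. dist (P (oth i 0)) (P (oth i 1))" "{0..1}" "face2 P" "onormal P"
    "(1 / real (Suc CARD(2))) *\<^sub>R (\<Sum>m\<le>CARD(2). P m)" cross2VV cross2VS curl2V curl2S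
    k Rey Rm \<kappa> dd w \<alpha>1 \<alpha>2 \<alpha>3 uh bh rh g f \<rho>
  proof (intro hdg_problem.intro hdg_cell.intro gauss_cell_axioms hdg_cell_axioms2 hdg_problem_axioms.intro)
    show "norm (w x) < 2 * \<alpha>1" if "x \<in> simplex_of P" for x
      using 1 that by (intro norm_less_of_SUP[OF K(1) lip_on_continuous[OF w]]) auto
  qed (use 1 in \<open>simp_all only: W1inf_on_iff_lip_on\<close>)
  show ?case using ex1_solution by (simp only: face_int2_eq)
next
  case (2 P k Rey Rm \<kappa> dd w \<alpha>1 \<alpha>2 \<alpha>3 uh bh rh g f \<rho>)
  then have P: "simplex_vertices P" by blast
  have w: "lip_on (simplex_of P) w" using 2 by (simp add: W1inf_on_iff_lip_on)
  interpret gauss_cell "simplex_of P" "{0..3}" "\<lambda>i. norm (cross3 (P (oth i 1) - P (oth i 0)) (P (oth i 2) - P (oth i 0)))"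
    unit_triangle "face3 P" "onormal P" "(1 / real (Suc CARD(3))) *\<^sub>R (\<Sum>m\<le>CARD(3). P m)"
    by (rule gauss_cell_simplex3[OF P])
  interpret hdg_problem "simplex_of P" "{0..3}" "\<lambda>i. norm (cross3 (P (oth i 1) - P (oth i 0)) (P (oth i 2) - P (oth i 0)))"
    unit_triangle "face3 P" "onormal P" "(1 / real (Suc CARD(3))) *\<^sub>R (\<Sum>m\<le>CARD(3). P m)" cross3 cross3 curl3 curl3
    k Rey Rm \<kappa> dd w \<alpha>1 \<alpha>2 \<alpha>3 uh bh rh g f \<rho>
  proof (intro hdg_problem.intro hdg_cell.intro gauss_cell_axioms hdg_cell_axioms3 hdg_problem_axioms.intro)
    show "norm (w x) < 2 * \<alpha>1" if "x \<in> simplex_of P" for x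
      using 2 that by (intro norm_less_of_SUP[OF K(1) lip_on_continuous[OF w]]) auto
  qed (use 2 in \<open>simp_all only: W1inf_on_iff_lip_on\<close>)
  show ?case using ex1_solution by (simp only: face_int3_eq)
qed

end
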